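(* Let $\mathbb G$ be any filiform group of the first kind, of step $s\ge2$. Let $E\subset\mathbb G$ be a measurable set with constant horizontal normal. Then $E$ is, up to a set of Haar measure zero, a Lipschitz Euclidean domain.
   Context: A filiform group of the first kind of step $s$ is a connected simply connected Lie group $\mathbb G$ whose Lie algebra has a basis $X_0,X_1,\dots,X_s$ with $[X_0,X_{j-1}]=X_j$ for $j=2,\dots,s$, all other brackets of basis elements (up to antisymmetry) being zero. It is stratified with $V_1=\mathrm{span}\{X_0,X_1\}$ (horizontal layer) and $V_j=\mathbb RX_j$ for $j=2,\dots,s$. Elements of $\mathrm{Lie}(\mathbb G)$ are regarded as left-invariant vector fields; $\mathrm{vol}_{\mathbb G}$ is a Haar measure. For measurable $E\subset\mathbb G$ and $X\in \mathrm{Lie}(\mathbb G)$, write $X\mathbb 1_E\ge 0$ if $-\int_E X\phi\,d\mathrm{vol}_{\mathbb G}\ge 0$ for all $\phi\in C_c^\infty(\mathbb G)$ with $\phi\ge0$, and $X\mathbb 1_E=0$ if $\int_E X\phi\,d\mathrm{vol}_{\mathbb G}=0$ for all such $\phi$. Fix a scalar product on $V_1$. $E$ has constant horizontal normal if there is $X\in V_1$ such that $X\mathbb 1_E\ge0$ and $Y\mathbb 1_E=0$ for every $Y\in V_1$ orthogonal to $X$. A set $E\subseteq\mathbb G$ is a Lipschitz Euclidean domain if, for one (and thus for all) diffeomorphisms $f:\mathbb G\to\mathbb R^{s+1}$, the set $f(E)$ is open and any point of the boundary of $f(E)$ has a neighborhood in which $f(E)$ can be described (after a choice of linear coordinates)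 as the upper-graph of a Lipschitz map of $s$ variables. *)

theory Defs
  imports "HOL-Analysis.Analysis"
begin

section \<open>Smooth maps and smooth manifolds\<close>

text \<open>\<open>Ck_on k S f\<close> is meant for open \<open>S\<close>: all partial derivatives of \<open>f\<close> of order at most \<open>k\<close>
  exist (in the Frechet sense) and are continuous on \<open>S\<close>.\<close>

fun Ck_on :: "nat \<Rightarrow> 'a::euclidean_space set \<Rightarrow> ('a \<Rightarrow> 'b::real_normed_vector) \<Rightarrow> bool" where
  "Ck_on 0 S f \<longleftrightarrow> continuous_on S f"
| "Ck_on (Suc k) S f \<longleftrightarrow>
     (\<forall>x\<in>S. f differentiable (at x)) \<and>
     (\<forall>v. Ck_on k S (\<lambda>x. frechet_derivative f (at x) v))"

definition smooth_on :: "'a::euclidean_space set \<Rightarrow> ('a \<Rightarrow> 'b::real_normed_vector) \<Rightarrow> bool" where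
  "smooth_on S f \<longleftrightarrow> (\<forall>k. Ck_on k S f)"

text \<open>A chart is a pair \<open>(U, \<phi>)\<close>; only the values of \<open>\<phi>\<close> on \<open>U\<close> matter. The manifold is the whole
  type \<open>'g\<close>; its dimension is \<open>DIM('e)\<close>. Atlases are not required to be maximal.\<close>

type_synonym ('g, 'e) chart = "'g set \<times> ('g \<Rightarrow> 'e)"

definition smooth_atlas :: "('g::topological_space, 'e::euclidean_space) chart set \<Rightarrow> bool" where
  "smooth_atlas A \<longleftrightarrow>
     (\<Union>(U, \<phi>)\<in>A. U) = UNIV \<and>
     (\<forall>(U, \<phi>)\<in>A. open U \<and> open (\<phi> ` U) \<and> homeomorphism U (\<phi> ` U) \<phi> (inv_into U \<phi>)) \<and>
     (\<forall>(U, \<phi>)\<in>A. \<forall>(V, \<psi>)\<in>A. smooth_on (\<phi> ` (U \<inter> V)) (\<psi> \<circ> inv_into U \<phi>))"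

definition euclidean_atlas :: "('e::euclidean_space, 'e) chart set" where
  "euclidean_atlas = {(UNIV, \<lambda>x. x)}"

definition product_atlas ::
    "('g, 'e) chart set \<Rightarrow> ('h, 'f) chart set \<Rightarrow> ('g \<times> 'h, 'e \<times> 'f) chart set" where
  "product_atlas A B = {(U \<times> V, map_prod \<phi> \<psi>) | U \<phi> V \<psi>. (U, \<phi>) \<in> A \<and> (V, \<psi>) \<in> B}"

definition smooth_map ::
    "('g::topological_space, 'e::euclidean_space) chart set \<Rightarrow>
     ('h::topological_space, 'f::euclidean_space) chart set \<Rightarrow> ('g \<Rightarrow> 'h) \<Rightarrow> bool" where
  "smooth_map A B f \<longleftrightarrow> continuous_on UNIV f \<and>
     (\<forall>(U, \<phi>)\<in>A. \<forall>(V, \<psi>)\<in>B. smooth_on (\<phi> ` (U \<inter> f -` V)) (\<psi> \<circ> f \<circ> inv_into U \<phi>))"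

definition diffeomorphism ::
    "('g::topological_space, 'e::euclidean_space) chart set \<Rightarrow>
     ('h::topological_space, 'f::euclidean_space) chart set \<Rightarrow> ('g \<Rightarrow> 'h) \<Rightarrow> bool" where
  "diffeomorphism A B f \<longleftrightarrow> bij f \<and> smooth_map A B f \<and> smooth_map B A (inv f)"

abbreviation smooth_fun ::
    "('g::topological_space, 'e::euclidean_space) chart set \<Rightarrow> ('g \<Rightarrow> real) \<Rightarrow> bool" where
  "smooth_fun A \<phi> \<equiv> smooth_map A euclidean_atlas \<phi>"


section \<open>Lie groups and their Lie algebras\<close>

text \<open>As usual for the class \<^class>\<open>group_add\<close>, the group operation is written \<open>+\<close> although it is
  not assumed to be commutative.\<close>

definition lie_group ::
    "('g::{topological_group_add,t2_space,second_countable_topology},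
      'e::euclidean_space) chart set \<Rightarrow> bool" where
  "lie_group A \<longleftrightarrow> smooth_atlas A \<and>
     smooth_map (product_atlas A A) A (\<lambda>(x, y). x + y) \<and> smooth_map A A (\<lambda>x. - x)"

text \<open>Vector fields are derivations of the algebra of smooth functions. They are made to vanish on
  non-smooth arguments, so that equality of fields is equality in HOL.\<close>

type_synonym 'g vfield = "('g \<Rightarrow> real) \<Rightarrow> ('g \<Rightarrow> real)"

definition vector_field ::
    "('g::topological_space, 'e::euclidean_space) chart set \<Rightarrow> 'g vfield \<Rightarrow> bool" where
  "vector_field A X \<longleftrightarrow>
     (\<forall>f. smooth_fun A f \<longrightarrow> smooth_fun A (X f)) \<and>
     (\<forall>f g. smooth_fun A f \<longrightarrow> smooth_fun A g \<longrightarrow>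
        X (\<lambda>x. f x + g x) = (\<lambda>x. X f x + X g x)) \<and>
     (\<forall>c f. smooth_fun A f \<longrightarrow> X (\<lambda>x. c * f x) = (\<lambda>x. c * X f x)) \<and>
     (\<forall>f g. smooth_fun A f \<longrightarrow> smooth_fun A g \<longrightarrow>
        X (\<lambda>x. f x * g x) = (\<lambda>x. X f x * g x + f x * X g x)) \<and>
     (\<forall>f. \<not> smooth_fun A f \<longrightarrow> X f = (\<lambda>x. 0))"

definition lie_algebra ::
    "('g::{topological_group_add,t2_space,second_countable_topology},
      'e::euclidean_space) chart set \<Rightarrow> 'g vfield set" where
  "lie_algebra A = {X. vector_field A X \<and>
     (\<forall>a f. smooth_fun A f \<longrightarrow> X (\<lambda>x. f (a + x)) = (\<lambda>x. X f (a + x)))}"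

definition vf_zero :: "'g vfield" where
  "vf_zero = (\<lambda>f x. 0)"

definition vf_add :: "'g vfield \<Rightarrow> 'g vfield \<Rightarrow> 'g vfield" where
  "vf_add X Y = (\<lambda>f x. X f x + Y f x)"

definition vf_scale :: "real \<Rightarrow> 'g vfield \<Rightarrow> 'g vfield" where
  "vf_scale c X = (\<lambda>f x. c * X f x)"

definition vf_bracket :: "'g vfield \<Rightarrow> 'g vfield \<Rightarrow> 'g vfield" where
  "vf_bracket X Y = (\<lambda>f x. X (Y f) x - Y (X f) x)"

definition vf_lincomb :: "nat \<Rightarrow> (nat \<Rightarrow> real) \<Rightarrow> (nat \<Rightarrow> 'g vfield) \<Rightarrow> 'g vfield" where
  "vf_lincomb s c X = (\<lambda>f x. \<Sum>j\<le>s. c j * X j f x)"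

definition lie_algebra_basis ::
    "('g::{topological_group_add,t2_space,second_countable_topology},
      'e::euclidean_space) chart set \<Rightarrow> nat \<Rightarrow> (nat \<Rightarrow> 'g vfield) \<Rightarrow> bool" where
  "lie_algebra_basis A s X \<longleftrightarrow>
     (\<forall>j\<le>s. X j \<in> lie_algebra A) \<and>
     (\<forall>c. vf_lincomb s c X = vf_zero \<longrightarrow> (\<forall>j\<le>s. c j = 0)) \<and>
     (\<forall>Z\<in>lie_algebra A. \<exists>c. Z = vf_lincomb s c X)"


section \<open>Filiform groups of the first kind\<close>

text \<open>The group is given together with the basis \<open>X 0, \<dots>, X s\<close> of its Lie algebra, which
  determines the horizontal layer. The condition on \<open>DIM('e)\<close> says that charts take values in a
  space of dimension \<open>s + 1\<close>.\<close>

definition filiform_first_kind ::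
    "('g::{topological_group_add,t2_space,second_countable_topology},
      'e::euclidean_space) chart set \<Rightarrow> nat \<Rightarrow> (nat \<Rightarrow> 'g vfield) \<Rightarrow> bool" where
  "filiform_first_kind A s X \<longleftrightarrow>
     lie_group A \<and> DIM('e) = s + 1 \<and>
     connected (UNIV :: 'g set) \<and> simply_connected (UNIV :: 'g set) \<and>
     lie_algebra_basis A s X \<and>
     (\<forall>j\<in>{2..s}. vf_bracket (X 0) (X (j - 1)) = X j) \<and>
     vf_bracket (X 0) (X s) = vf_zero \<and>
     (\<forall>i\<in>{1..s}. \<forall>j\<in>{1..s}. vf_bracket (X i) (X j) = vf_zero)"

definition horizontal_layer :: "(nat \<Rightarrow> 'g vfield) \<Rightarrow> 'g vfield set" where
  "horizontal_layer X = {vf_add (vf_scale a (X 0)) (vf_scale b (X 1)) | a b. True}"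

definition scalar_product_on :: "'g vfield set \<Rightarrow> ('g vfield \<Rightarrow> 'g vfield \<Rightarrow> real) \<Rightarrow> bool" where
  "scalar_product_on V ip \<longleftrightarrow>
     (\<forall>Y\<in>V. \<forall>Z\<in>V. ip Y Z = ip Z Y) \<and>
     (\<forall>Y\<in>V. \<forall>Z\<in>V. \<forall>W\<in>V. ip (vf_add Y Z) W = ip Y W + ip Z W) \<and>
     (\<forall>c. \<forall>Y\<in>V. \<forall>Z\<in>V. ip (vf_scale c Y) Z = c * ip Y Z) \<and>
     (\<forall>Y\<in>V. Y \<noteq> vf_zero \<longrightarrow> ip Y Y > 0)"


section \<open>Haar measure and constant horizontal normal\<close>

text \<open>Regularity need not be demanded: on a locally compact, second countable Hausdorff space every
  Borel measure that is finite on compact sets is Radon.\<close>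

definition haar_measure :: "'g::topological_group_add measure \<Rightarrow> bool" where
  "haar_measure vol \<longleftrightarrow>
     sets vol = sets borel \<and>
     emeasure vol UNIV \<noteq> 0 \<and>
     (\<forall>K. compact K \<longrightarrow> K \<in> sets vol \<longrightarrow> emeasure vol K < \<infinity>) \<and>
     (\<forall>a. \<forall>B\<in>sets vol. emeasure vol ((\<lambda>x. a + x) ` B) = emeasure vol B)"

definition test_function ::
    "('g::topological_space, 'e::euclidean_space) chart set \<Rightarrow> ('g \<Rightarrow> real) \<Rightarrow> bool" where
  "test_function A \<phi> \<longleftrightarrow> smooth_fun A \<phi> \<and> compact (closure {x. \<phi> x \<noteq> 0})"

text \<open>Measurability of \<open>E\<close> and integration over \<open>E\<close> refer to the completed Haar measure.\<close>

definition indicator_nondecreasing ::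
    "('g::topological_space, 'e::euclidean_space) chart set \<Rightarrow> 'g measure \<Rightarrow> 'g vfield \<Rightarrow>
     'g set \<Rightarrow> bool" where
  "indicator_nondecreasing A vol X E \<longleftrightarrow>
     (\<forall>\<phi>. test_function A \<phi> \<longrightarrow> (\<forall>x. \<phi> x \<ge> 0) \<longrightarrow>
        - (LINT x:E|completion vol. X \<phi> x) \<ge> 0)"

definition indicator_invariant ::
    "('g::topological_space, 'e::euclidean_space) chart set \<Rightarrow> 'g measure \<Rightarrow> 'g vfield \<Rightarrow>
     'g set \<Rightarrow> bool" where
  "indicator_invariant A vol X E \<longleftrightarrow>
     (\<forall>\<phi>. test_function A \<phi> \<longrightarrow> (\<forall>x. \<phi> x \<ge> 0) \<longrightarrow>
        (LINT x:E|completion vol. X \<phi> x) = 0)"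

definition constant_horizontal_normal ::
    "('g::topological_space, 'e::euclidean_space) chart set \<Rightarrow> 'g measure \<Rightarrow> 'g vfield set \<Rightarrow>
     ('g vfield \<Rightarrow> 'g vfield \<Rightarrow> real) \<Rightarrow> 'g set \<Rightarrow> bool" where
  "constant_horizontal_normal A vol V ip E \<longleftrightarrow>
     (\<exists>Z\<in>V. indicator_nondecreasing A vol Z E \<and>
        (\<forall>Y\<in>V. ip Z Y = 0 \<longrightarrow> indicator_invariant A vol Y E))"


section \<open>Lipschitz Euclidean domains\<close>

text \<open>The linear bijection \<open>T\<close> is the choice of linear coordinates and \<open>b\<close> selects the coordinate
  that is bounded below by the Lipschitz function \<open>h\<close> of the remaining \<open>DIM('e) - 1\<close> ones.
  The empty set and the whole space, having no boundary, are Lipschitz domains.\<close>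

definition lipschitz_domain :: "'e::euclidean_space set \<Rightarrow> bool" where
  "lipschitz_domain D \<longleftrightarrow> open D \<and>
     (\<forall>p\<in>frontier D. \<exists>N T b h L.
        open N \<and> p \<in> N \<and> linear T \<and> bij T \<and> b \<in> Basis \<and>
        L-lipschitz_on {y :: 'e. y \<bullet> b = 0} h \<and>
        D \<inter> N = {x \<in> N. T x \<bullet> b > (h (T x - (T x \<bullet> b) *\<^sub>R b) :: real)})"

definition lipschitz_euclidean_domain ::
    "('g::topological_space, 'e::euclidean_space) chart set \<Rightarrow> 'g set \<Rightarrow> bool" where
  "lipschitz_euclidean_domain A E \<longleftrightarrow>
     (\<exists>f :: 'g \<Rightarrow> 'e. diffeomorphism A euclidean_atlas f \<and> lipschitz_domain (f ` E))"

end

theory Submission imports Defs begin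

text \<open>In the coordinates \<open>x \<mapsto> exp(x\<^sub>1 X\<^sub>1 + \<dots> + x\<^sub>s X\<^sub>s) exp(x\<^sub>0 X\<^sub>0)\<close> the group becomes a
  polynomial group law on a Euclidean space whose Haar measure is Lebesgue measure: locally these
  coordinates arise by integrating the left-invariant coframe, and simple connectedness makes them
  global. The elements \<open>c\<close> such that right translation by \<open>c\<close> maps almost every point of \<open>E\<close> into
  \<open>E\<close> form a semigroup. After a change of basis \<open>1\<^sub>E\<close> is invariant along one of \<open>X\<^sub>0\<close>, \<open>X\<^sub>1\<close> and
  monotone along the other. If it is invariant along \<open>X\<^sub>0\<close>, conjugating \<open>exp(r X\<^sub>1)\<close> by
  \<open>exp(t X\<^sub>0)\<close> fills out a convex cone spanned by a moment curve, and in both cases the semigroup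
  contains an open convex cone \<open>C\<close> for which the left translates \<open>p C\<close> are the Euclidean
  translates \<open>p + C\<close>. By Fubini, \<open>p + C\<close> is almost contained in \<open>E\<close> for almost every \<open>p \<in> E\<close>.
  The union of these cones is the upper graph of a Lipschitz function, and it exhausts \<open>E\<close> up to a
  null set, since what it misses meets every line in a direction of \<open>C\<close> at most once.\<close>

section \<open>Calculus of smooth maps between Euclidean spaces\<close>

text \<open>The obstacle to global coordinates is that the Maurer--Cartan form is not closed, so its
  components cannot be integrated as they stand. For this Lie algebra the defect is triangular: the
  \<open>e 0\<close> component is closed and gives a function \<open>t\<close>, and once the form is
  multiplied by \<open>shear t\<close>, whose entries are divided powers of \<open>t\<close>, the
  other components become closed too. The order of the two exponential factors makes left
  translation affine, with a linear part depending on the \<open>e 0\<close> coordinate alone; this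
  is why a cone that is stable under every \<open>shear t\<close> has Euclidean translates as group
  translates. The abelian ideal also permits the change of basis: any horizontal vector that is not
  a multiple of \<open>X 1\<close> can replace \<open>X 0\<close>, because adding a multiple of
  \<open>X 1\<close> leaves the brackets with \<open>X 1\<close>, ..., \<open>X s\<close> unchanged.
  When the invariant direction is \<open>X 1\<close>, only forward motion along \<open>X 0\<close>
  is available, yet inserting multiples of \<open>X 1\<close> at finitely many increasing times
  reaches the whole half-space of positive \<open>e 0\<close> coordinate, since every arc of the
  moment curve spans the hyperplane.\<close>

lemma Ck_on_subset: "Ck_on k S f \<Longrightarrow> T \<subseteq> S \<Longrightarrow> Ck_on k T f"
  by (induction k arbitrary: f) (auto intro: continuous_on_subset)

lemma Ck_on_continuous: "Ck_on k S f \<Longrightarrow> continuous_on S f"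
proof (cases k)
  case (Suc j)
  assume "Ck_on k S f"
  then have "\<forall>x\<in>S. f differentiable (at x)" using Suc by simp
  then show ?thesis
    by (meson continuous_at_imp_continuous_on differentiable_imp_continuous_within)
qed simp

lemma Ck_on_Suc_imp: "Ck_on (Suc k) S f \<Longrightarrow> Ck_on k S f"
proof (induction k arbitrary: f)
  case 0
  then show ?case by (metis Ck_on.simps(1) Ck_on_continuous)
next
  case (Suc k)
  then show ?case by (metis Ck_on.simps(2))
qed

text \<open>\<open>frechet_derivative\<close> is a choice among all derivatives, so it suffices that
  both functions have the same set of derivatives at \<open>x\<close>. Points where neither is
  differentiable are thereby covered.\<close>

lemma frechet_derivative_cong_open:
  assumes "open S" "x \<in> S" "\<And>y. y \<in> S \<Longrightarrow> f y = g y"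
  shows "frechet_derivative f (at x) = frechet_derivative g (at x)"
proof -
  have "(f has_derivative D) (at x) \<longleftrightarrow> (g has_derivative D) (at x)" for D
    using assms by (metis has_derivative_transform_within_open)
  then show ?thesis unfolding frechet_derivative_def by simp
qed

lemma Ck_on_cong_open:
  assumes "open S" "\<And>y. y \<in> S \<Longrightarrow> f y = g y"
  shows "Ck_on k S f \<longleftrightarrow> Ck_on k S g"
  using assms(2)
proof (induction k arbitrary: f g)
  case 0
  then show ?case by (simp cong: continuous_on_cong)
next
  case (Suc k)
  have 1: "f differentiable (at x) \<longleftrightarrow> g differentiable (at x)" if "x \<in> S" for x
    using Suc.prems that assms(1) unfolding differentiable_def
    by (metis has_derivative_transform_within_open)
  have 2: "Ck_on k S (\<lambda>x. frechet_derivative f (at x) v) \<longleftrightarrow>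
     Ck_on k S (\<lambda>x. frechet_derivative g (at x) v)" for v
    by (rule Suc.IH) (metis Suc.prems assms(1) frechet_derivative_cong_open)
  show ?case using 1 2 by auto
qed

lemma Ck_on_local:
  assumes "\<And>x. x \<in> S \<Longrightarrow> \<exists>T. open T \<and> x \<in> T \<and> Ck_on k T f"
  shows "Ck_on k S f"
  using assms
proof (induction k arbitrary: f)
  case 0
  show ?case unfolding Ck_on.simps
  proof (rule continuous_at_imp_continuous_on, rule ballI)
    fix x assume "x \<in> S"
    with 0 obtain T where "open T" "x \<in> T" "continuous_on T f" by auto
    then show "isCont f x" by (metis continuous_on_eq_continuous_at)
  qed
next
  case (Suc k)
  then show ?case unfolding Ck_on.simps by meson
qed

lemma Ck_on_has_derivative:
  "Ck_on (Suc k) S f \<Longrightarrow> x \<in> S \<Longrightarrow> (f has_derivative frechet_derivative f (at x)) (at x)"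
  by (simp add: frechet_derivative_works)

text \<open>Lets an explicit formula \<open>D\<close> stand in for the chosen derivative; openness
  of \<open>S\<close> makes the two agree near every point, hence also in all higher
  derivatives.\<close>

lemma Ck_on_SucI:
  assumes S: "open S"
    and d: "\<And>x. x \<in> S \<Longrightarrow> (f has_derivative D x) (at x)"
    and k: "\<And>v. Ck_on k S (\<lambda>x. D x v)"
  shows "Ck_on (Suc k) S f"
proof -
  have eq: "frechet_derivative f (at x) = D x" if "x \<in> S" for x
    using d[OF that] by (metis frechet_derivative_at)
  show ?thesis unfolding Ck_on.simps
  proof (intro conjI ballI allI)
    show "f differentiable at x" if "x \<in> S" for x using d[OF that] differentiable_def by blast
    show "Ck_on k S (\<lambda>x. frechet_derivative f (at x) v)" for v
      using k[of v] Ck_on_cong_open[OF S, of "\<lambda>x. frechet_derivative f (at x) v" "\<lambda>x. D x v" k] eq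
      by simp
  qed
qed

lemma Ck_on_const [simp]: "Ck_on k S (\<lambda>x. c)"
proof (induction k arbitrary: c)
  case (Suc k)
  have "frechet_derivative (\<lambda>x::'a. c) (at x) = (\<lambda>v. 0)" for x
    by (metis frechet_derivative_at has_derivative_const)
  with Suc show ?case by simp
qed simp

lemma Ck_on_bounded_linear:
  assumes "bounded_linear L"
  shows "Ck_on k S L"
proof (cases k)
  case 0
  then show ?thesis using assms by (simp add: linear_continuous_on)
next
  case (Suc j)
  have "Ck_on (Suc j) UNIV L"
    by (rule Ck_on_SucI[where D = "\<lambda>x. L"])
      (auto simp: assms bounded_linear_imp_has_derivative)
  then show ?thesis using Suc Ck_on_subset by blast
qed

lemma Ck_on_id [simp]: "Ck_on k S (\<lambda>x. x)"
  by (simp add: Ck_on_bounded_linear bounded_linear_ident)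

lemma Ck_on_linear_compose:
  assumes L: "bounded_linear L" and "open S" "Ck_on k S f"
  shows "Ck_on k S (\<lambda>x. L (f x))"
  using assms(3)
proof (induction k arbitrary: f)
  case 0
  then show ?case using L by (simp add: bounded_linear.continuous_on)
next
  case (Suc k)
  show ?case
  proof (rule Ck_on_SucI[OF \<open>open S\<close>])
    show "((\<lambda>x. L (f x)) has_derivative (\<lambda>v. L (frechet_derivative f (at x) v))) (at x)" if "x \<in> S" for x
      using Ck_on_has_derivative[OF Suc.prems that] L by (rule bounded_linear.has_derivative[rotated])
    show "Ck_on k S (\<lambda>x. L (frechet_derivative f (at x) v))" for v
      by (rule Suc.IH) (use Suc.prems in simp)
  qed
qed

lemma Ck_on_add:
  assumes "open S" "Ck_on k S f" "Ck_on k S g"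
  shows "Ck_on k S (\<lambda>x. f x + g x)"
  using assms(2,3)
proof (induction k arbitrary: f g)
  case 0
  then show ?case by (simp add: continuous_on_add)
next
  case (Suc k)
  show ?case
  proof (rule Ck_on_SucI[OF \<open>open S\<close>])
    show "((\<lambda>x. f x + g x) has_derivative
       (\<lambda>v. frechet_derivative f (at x) v + frechet_derivative g (at x) v)) (at x)" if "x \<in> S" for x
      using Ck_on_has_derivative[OF Suc.prems(1) that] Ck_on_has_derivative[OF Suc.prems(2) that]
      by (rule has_derivative_add)
  qed (use Suc in simp)
qed

lemma Ck_on_sum:
  assumes "open S" "\<And>i. i \<in> I \<Longrightarrow> Ck_on k S (f i)"
  shows "Ck_on k S (\<lambda>x. \<Sum>i\<in>I. f i x)"
  using assms(2) by (induction I rule: infinite_finite_induct) (auto intro!: Ck_on_add assms(1))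

lemma Ck_on_bilinear:
  assumes B: "bounded_bilinear B" and "open S" "Ck_on k S f" "Ck_on k S g"
  shows "Ck_on k S (\<lambda>x. B (f x) (g x))"
  using assms(3,4)
proof (induction k arbitrary: f g)
  case 0
  then show ?case using B by (simp add: bounded_bilinear.continuous_on)
next
  case (Suc k)
  show ?case
  proof (rule Ck_on_SucI[OF \<open>open S\<close>])
    show "((\<lambda>x. B (f x) (g x)) has_derivative
       (\<lambda>v. B (f x) (frechet_derivative g (at x) v) + B (frechet_derivative f (at x) v) (g x))) (at x)"
      if "x \<in> S" for x
      using Ck_on_has_derivative[OF Suc.prems(1) that] Ck_on_has_derivative[OF Suc.prems(2) that]
      by (rule bounded_bilinear.FDERIV[OF B])
    show "Ck_on k S (\<lambda>x. B (f x) (frechet_derivative g (at x) v) + B (frechet_derivative f (at x) v) (g x))" for v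
      using Suc.prems by (intro Ck_on_add Suc.IH \<open>open S\<close>) (auto intro: Ck_on_Suc_imp)
  qed
qed

text \<open>The derivative given by the chain rule is expanded in the basis, which turns it into a
  sum of products of a component of the derivative of \<open>f\<close> with a partial derivative of
  \<open>g\<close> composed with the same \<open>f\<close>. The induction therefore varies
  \<open>g\<close> only.\<close>

lemma Ck_on_compose:
  fixes f :: "'a::euclidean_space \<Rightarrow> 'b::euclidean_space" and g :: "'b \<Rightarrow> 'c::real_normed_vector"
  assumes "open S" "open T" "Ck_on k S f" "Ck_on k T g" "f ` S \<subseteq> T"
  shows "Ck_on k S (\<lambda>x. g (f x))"
  using assms(3-)
proof (induction k arbitrary: g)
  case 0
  then show ?case by (auto intro: continuous_on_compose2)
next
  case (Suc k)
  let ?D = "\<lambda>x v. \<Sum>b\<in>Basis. (frechet_derivative f (at x) v \<bullet> b) *\<^sub>R frechet_derivative g (at (f x)) b"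
  show ?case
  proof (rule Ck_on_SucI[OF \<open>open S\<close>])
    fix x assume x: "x \<in> S"
    then have fx: "f x \<in> T" using Suc.prems by auto
    note g = Ck_on_has_derivative[OF Suc.prems(2) fx]
    have lin: "linear (frechet_derivative g (at (f x)))"
      using g has_derivative_linear by blast
    have C: "((\<lambda>x. g (f x)) has_derivative (\<lambda>v. frechet_derivative g (at (f x)) (frechet_derivative f (at x) v))) (at x)"
      using diff_chain_at[OF Ck_on_has_derivative[OF Suc.prems(1) x] g] by (simp add: o_def)
    have D: "frechet_derivative g (at (f x)) w = (\<Sum>b\<in>Basis. (w \<bullet> b) *\<^sub>R frechet_derivative g (at (f x)) b)" for w
    proof -
      have "frechet_derivative g (at (f x)) (\<Sum>b\<in>Basis. (w \<bullet> b) *\<^sub>R b) =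
         (\<Sum>b\<in>Basis. (w \<bullet> b) *\<^sub>R frechet_derivative g (at (f x)) b)"
        by (simp add: linear_sum[OF lin] linear_scale[OF lin])
      then show ?thesis by (simp add: euclidean_representation)
    qed
    show "((\<lambda>x. g (f x)) has_derivative ?D x) (at x)"
      by (rule has_derivative_eq_rhs[OF C]) (rule ext, rule D)
  next
    fix v
    have f: "Ck_on k S f" using Suc.prems Ck_on_Suc_imp by blast
    have fv: "Ck_on k S (\<lambda>x. frechet_derivative f (at x) v)" using Suc.prems by simp
    show "Ck_on k S (\<lambda>x. ?D x v)"
    proof (rule Ck_on_sum[OF \<open>open S\<close>], rule Ck_on_bilinear[OF bounded_bilinear_scaleR \<open>open S\<close>])
      fix b :: 'b assume b: "b \<in> Basis"
      show "Ck_on k S (\<lambda>x. frechet_derivative f (at x) v \<bullet> b)"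
        using fv by (rule Ck_on_linear_compose[OF bounded_linear_inner_left \<open>open S\<close>])
      show "Ck_on k S (\<lambda>x. frechet_derivative g (at (f x)) b)"
        using Suc.prems by (intro Suc.IH f) auto
    qed
  qed
qed

lemma Ck_on_Pair:
  fixes f :: "'a::euclidean_space \<Rightarrow> 'b::real_normed_vector" and g :: "'a \<Rightarrow> 'c::real_normed_vector"
  assumes "open S" "Ck_on k S f" "Ck_on k S g"
  shows "Ck_on k S (\<lambda>x. (f x, g x))"
proof -
  have L: "bounded_linear (\<lambda>a. (a, 0))" "bounded_linear (\<lambda>b. (0, b))"
    by (intro bounded_linear_Pair bounded_linear_ident bounded_linear_zero)+
  have "Ck_on k S (\<lambda>x. (f x, 0) + (0, g x))"
    by (intro Ck_on_add[OF assms(1)] Ck_on_linear_compose[OF L(1) assms(1,2)]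
        Ck_on_linear_compose[OF L(2) assms(1,3)])
  then show ?thesis by simp
qed

lemma smooth_on_subset: "smooth_on S f \<Longrightarrow> T \<subseteq> S \<Longrightarrow> smooth_on T f"
  unfolding smooth_on_def using Ck_on_subset by blast

lemma smooth_on_continuous: "smooth_on S f \<Longrightarrow> continuous_on S f"
  unfolding smooth_on_def using Ck_on_continuous by blast

lemma smooth_on_cong_open:
  "open S \<Longrightarrow> (\<And>y. y \<in> S \<Longrightarrow> f y = g y) \<Longrightarrow> smooth_on S f \<longleftrightarrow> smooth_on S g"
  unfolding smooth_on_def using Ck_on_cong_open by blast

lemma smooth_on_local:
  "(\<And>x. x \<in> S \<Longrightarrow> \<exists>T. open T \<and> x \<in> T \<and> smooth_on T f) \<Longrightarrow> smooth_on S f"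
  unfolding smooth_on_def by (meson Ck_on_local)

lemma smooth_on_has_derivative:
  "smooth_on S f \<Longrightarrow> x \<in> S \<Longrightarrow> (f has_derivative frechet_derivative f (at x)) (at x)"
  unfolding smooth_on_def using Ck_on_has_derivative by blast

lemma smooth_on_frechet_derivative:
  "smooth_on S f \<Longrightarrow> smooth_on S (\<lambda>x. frechet_derivative f (at x) v)"
  unfolding smooth_on_def using Ck_on.simps(2) by blast

lemma smooth_onI_derivative:
  assumes "open S" "\<And>x. x \<in> S \<Longrightarrow> (f has_derivative D x) (at x)" "\<And>v. smooth_on S (\<lambda>x. D x v)"
  shows "smooth_on S f"
  unfolding smooth_on_def
  using Ck_on_SucI[OF assms(1,2)] assms(3) Ck_on_Suc_imp unfolding smooth_on_def by blast

lemma smooth_on_const [simp]: "smooth_on S (\<lambda>x. c)"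
  and smooth_on_id [simp]: "smooth_on S (\<lambda>x. x)"
  and smooth_on_bounded_linear: "bounded_linear L \<Longrightarrow> smooth_on S L"
  unfolding smooth_on_def by (auto intro: Ck_on_bounded_linear)

lemma smooth_on_linear_compose:
  "bounded_linear L \<Longrightarrow> open S \<Longrightarrow> smooth_on S f \<Longrightarrow> smooth_on S (\<lambda>x. L (f x))"
  unfolding smooth_on_def by (rule allI, rule Ck_on_linear_compose) auto

lemma smooth_on_add: "open S \<Longrightarrow> smooth_on S f \<Longrightarrow> smooth_on S g \<Longrightarrow> smooth_on S (\<lambda>x. f x + g x)"
  unfolding smooth_on_def by (rule allI, rule Ck_on_add) auto

lemma smooth_on_sum:
  "open S \<Longrightarrow> (\<And>i. i \<in> I \<Longrightarrow> smooth_on S (f i)) \<Longrightarrow> smooth_on S (\<lambda>x. \<Sum>i\<in>I. f i x)"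
  unfolding smooth_on_def by (rule allI, rule Ck_on_sum) auto

lemma smooth_on_bilinear:
  "bounded_bilinear B \<Longrightarrow> open S \<Longrightarrow> smooth_on S f \<Longrightarrow> smooth_on S g \<Longrightarrow>
    smooth_on S (\<lambda>x. B (f x) (g x))"
  unfolding smooth_on_def by (rule allI, rule Ck_on_bilinear) auto

lemmas smooth_on_scaleR = smooth_on_bilinear[OF bounded_bilinear_scaleR]
lemmas smooth_on_inner = smooth_on_bilinear[OF bounded_bilinear_inner]

lemma smooth_on_mult:
  fixes f g :: "'a::euclidean_space \<Rightarrow> real"
  shows "open S \<Longrightarrow> smooth_on S f \<Longrightarrow> smooth_on S g \<Longrightarrow> smooth_on S (\<lambda>x. f x * g x)"
  by (rule smooth_on_bilinear[OF bounded_bilinear_mult])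

lemma smooth_on_minus: "open S \<Longrightarrow> smooth_on S f \<Longrightarrow> smooth_on S (\<lambda>x. - f x)"
  using smooth_on_linear_compose[OF bounded_linear_minus[OF bounded_linear_ident]] by blast

lemma smooth_on_diff: "open S \<Longrightarrow> smooth_on S f \<Longrightarrow> smooth_on S g \<Longrightarrow> smooth_on S (\<lambda>x. f x - g x)"
  using smooth_on_add[OF _ _ smooth_on_minus] by fastforce

lemma smooth_on_power:
  fixes f :: "'a::euclidean_space \<Rightarrow> real"
  shows "open S \<Longrightarrow> smooth_on S f \<Longrightarrow> smooth_on S (\<lambda>x. f x ^ n)"
  by (induction n) (auto intro: smooth_on_mult)

lemma smooth_on_prod:
  fixes f :: "'i \<Rightarrow> 'a::euclidean_space \<Rightarrow> real"
  assumes "open S" "\<And>i. i \<in> I \<Longrightarrow> smooth_on S (f i)"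
  shows "smooth_on S (\<lambda>x. \<Prod>i\<in>I. f i x)"
  using assms(2) by (induction I rule: infinite_finite_induct) (auto intro!: smooth_on_mult assms(1))

lemma smooth_on_compose:
  fixes f :: "'a::euclidean_space \<Rightarrow> 'b::euclidean_space" and g :: "'b \<Rightarrow> 'c::real_normed_vector"
  shows "open S \<Longrightarrow> open T \<Longrightarrow> smooth_on S f \<Longrightarrow> smooth_on T g \<Longrightarrow> f ` S \<subseteq> T \<Longrightarrow>
    smooth_on S (\<lambda>x. g (f x))"
  unfolding smooth_on_def by (rule allI, rule Ck_on_compose) auto

lemma smooth_on_Pair:
  fixes f :: "'a::euclidean_space \<Rightarrow> 'b::real_normed_vector" and g :: "'a \<Rightarrow> 'c::real_normed_vector"
  shows "open S \<Longrightarrow> smooth_on S f \<Longrightarrow> smooth_on S g \<Longrightarrow> smooth_on S (\<lambda>x. (f x, g x))"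
  unfolding smooth_on_def by (rule allI, rule Ck_on_Pair) auto

text \<open>The direction may vary with the point here, as it does for a vector field; expansion in
  the basis reduces this to constant directions.\<close>

lemma smooth_on_derivative_along:
  fixes f :: "'a::euclidean_space \<Rightarrow> 'b::real_normed_vector"
  assumes "open S" "smooth_on S f" "smooth_on S w"
  shows "smooth_on S (\<lambda>x. frechet_derivative f (at x) (w x))"
proof -
  have sm: "smooth_on S (\<lambda>x. \<Sum>b\<in>Basis. (w x \<bullet> b) *\<^sub>R frechet_derivative f (at x) b)"
    using assms by (intro smooth_on_sum smooth_on_scaleR smooth_on_frechet_derivative
        smooth_on_linear_compose[OF bounded_linear_inner_left])
  have D: "(\<Sum>b\<in>Basis. (w x \<bullet> b) *\<^sub>R frechet_derivative f (at x) b) = frechet_derivative f (at x) (w x)"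
    if "x \<in> S" for x
  proof -
    have lin: "linear (frechet_derivative f (at x))"
      using smooth_on_has_derivative[OF assms(2) that] has_derivative_linear by blast
    have "frechet_derivative f (at x) (\<Sum>b\<in>Basis. (w x \<bullet> b) *\<^sub>R b) =
       (\<Sum>b\<in>Basis. (w x \<bullet> b) *\<^sub>R frechet_derivative f (at x) b)"
      by (simp add: linear_sum[OF lin] linear_scale[OF lin])
    then show ?thesis by (simp add: euclidean_representation)
  qed
  show ?thesis by (rule iffD1[OF smooth_on_cong_open[OF assms(1)] sm]) (rule D)
qed

lemma smooth_on_inverse: "smooth_on {x::real. x \<noteq> 0} inverse"
proof -
  have o: "open {x::real. x \<noteq> 0}" by (intro open_Collect_neq continuous_intros)
  have "Ck_on k {x::real. x \<noteq> 0} inverse" for k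
  proof (induction k)
    case 0
    show ?case unfolding Ck_on.simps by (rule continuous_on_inverse[OF continuous_on_id, simplified]) simp
  next
    case (Suc k)
    show ?case
    proof (rule Ck_on_SucI[OF o])
      show "(inverse has_derivative (\<lambda>h. - (inverse x * h * inverse x))) (at x)" if "x \<in> {x::real. x \<noteq> 0}" for x
        using that has_derivative_inverse' by blast
      show "Ck_on k {x. x \<noteq> 0} (\<lambda>x::real. - (inverse x * v * inverse x))" for v :: real
        by (rule Ck_on_linear_compose[OF bounded_linear_minus[OF bounded_linear_ident] o],
            rule Ck_on_bilinear[OF bounded_bilinear_mult o], rule Ck_on_bilinear[OF bounded_bilinear_mult o])
          (rule Suc Ck_on_const)+
    qed
  qed
  then show ?thesis unfolding smooth_on_def by blast
qed

lemma smooth_on_divide: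
  fixes f g :: "'a::euclidean_space \<Rightarrow> real"
  assumes "open S" "smooth_on S f" "smooth_on S g" "\<And>x. x \<in> S \<Longrightarrow> g x \<noteq> 0"
  shows "smooth_on S (\<lambda>x. f x / g x)"
proof -
  have "open {x::real. x \<noteq> 0}" by (intro open_Collect_neq continuous_intros)
  then have "smooth_on S (\<lambda>x. inverse (g x))"
    using assms by (intro smooth_on_compose[OF _ _ _ smooth_on_inverse]) auto
  then show ?thesis unfolding divide_inverse using assms by (intro smooth_on_mult)
qed

section \<open>Flat functions and smooth cutoffs\<close>

definition flat_exp :: "nat \<Rightarrow> real \<Rightarrow> real" where
  "flat_exp m x = (if x > 0 then exp (- (1 / x)) / x ^ m else 0)"

lemma flat_exp_tendsto_0: "(flat_exp m \<longlongrightarrow> 0) (at 0)"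
proof -
  have 1: "((\<lambda>x. x ^ m * exp (- x)) \<longlongrightarrow> 0) (at_top::real filter)"
    using tendsto_power_div_exp_0[of m] by (simp add: exp_minus divide_inverse)
  have "((\<lambda>x. (inverse x) ^ m * exp (- inverse x)) \<longlongrightarrow> 0) (at_right (0::real))"
    by (rule filterlim_compose[OF 1 filterlim_inverse_at_top_right])
  then have r: "(flat_exp m \<longlongrightarrow> 0) (at_right 0)"
    by (rule Lim_transform_eventually)
      (auto simp: eventually_at_filter flat_exp_def field_simps power_inverse)
  have l: "(flat_exp m \<longlongrightarrow> 0) (at_left 0)"
    by (rule tendsto_eventually) (auto simp: eventually_at_filter flat_exp_def)
  show ?thesis using l r by (simp add: filterlim_split_at)
qed

text \<open>The exponent \<open>m\<close> is carried along because it closes the family under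
  differentiation: smoothness then follows by an induction on the order that treats all
  \<open>m\<close> at once.\<close>

lemma flat_exp_derivative:
  "(flat_exp m has_field_derivative (flat_exp (m + 2) x - real m * flat_exp (Suc m) x)) (at x)"
proof -
  consider "x > 0" | "x < 0" | "x = 0" by linarith
  then show ?thesis
  proof cases
    case 1
    have 2: "((\<lambda>y. exp (- y) * y ^ m) has_field_derivative
        (exp (- y) * (real m * y ^ (m - 1)) - exp (- y) * y ^ m)) (at y)" for y :: real
      by (auto intro!: derivative_eq_intros)
    have "((\<lambda>x. exp (- inverse x) * inverse x ^ m) has_field_derivative
        (exp (- inverse x) * (real m * inverse x ^ (m - 1)) - exp (- inverse x) * inverse x ^ m)
         * (- (inverse x ^ Suc (Suc 0)))) (at x)"
      using DERIV_chain2[OF 2 DERIV_inverse] 1 by simp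
    moreover have "(exp (- inverse x) * (real m * inverse x ^ (m - 1)) - exp (- inverse x) * inverse x ^ m)
         * (- (inverse x ^ Suc (Suc 0))) = flat_exp (m + 2) x - real m * flat_exp (Suc m) x"
      using 1 by (cases m) (simp_all add: flat_exp_def divide_inverse power_inverse algebra_simps)
    ultimately have "((\<lambda>x. exp (- (1 / x)) / x ^ m) has_field_derivative
        (flat_exp (m + 2) x - real m * flat_exp (Suc m) x)) (at x)"
      by (simp add: divide_inverse power_inverse)
    then show ?thesis
      by (rule has_field_derivative_transform_within_open[where S="{0<..}"])
        (use 1 in \<open>auto simp: flat_exp_def\<close>)
  next
    case 2
    have "((\<lambda>x. 0) has_field_derivative 0) (at x)" by simp
    then have "(flat_exp m has_field_derivative 0) (at x)"
      by (rule has_field_derivative_transform_within_open[where S="{..<0}"])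
        (use 2 in \<open>auto simp: flat_exp_def\<close>)
    then show ?thesis using 2 by (simp add: flat_exp_def)
  next
    case 3
    \<comment> \<open>Away from 0 this difference quotient is \<open>flat_exp (Suc m)\<close>
      itself.\<close>
    have "((\<lambda>h. (flat_exp m (0 + h) - flat_exp m 0) / h) \<longlongrightarrow> 0) (at 0)"
      by (rule Lim_transform_eventually[OF flat_exp_tendsto_0[of "Suc m"]])
        (auto simp: eventually_at_filter flat_exp_def field_simps)
    then show ?thesis using 3 by (simp add: DERIV_def flat_exp_def)
  qed
qed

lemma smooth_on_flat_exp: "smooth_on S (flat_exp m)"
proof -
  have "Ck_on k UNIV (flat_exp m)" for k
  proof (induction k arbitrary: m)
    case 0
    show ?case unfolding Ck_on.simps
      by (intro continuous_at_imp_continuous_on ballI DERIV_isCont[OF flat_exp_derivative])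
  next
    case (Suc k)
    show ?case
    proof (rule Ck_on_SucI[OF open_UNIV])
      show "(flat_exp m has_derivative (*) (flat_exp (m + 2) x - real m * flat_exp (Suc m) x)) (at x)" for x
        using flat_exp_derivative[of m x] has_field_derivative_def by blast
      have "Ck_on k UNIV (\<lambda>x. (flat_exp (m + 2) x + (- real m) * flat_exp (Suc m) x) * v)" for v
        by (intro Ck_on_bilinear[OF bounded_bilinear_mult open_UNIV] Ck_on_add[OF open_UNIV] Suc Ck_on_const)
      then show "Ck_on k UNIV (\<lambda>x. (flat_exp (m + 2) x - real m * flat_exp (Suc m) x) * v)" for v by simp
    qed
  qed
  then show ?thesis unfolding smooth_on_def using Ck_on_subset by blast
qed

lemma flat_exp_0_pos: "flat_exp 0 x > 0 \<longleftrightarrow> x > 0" and flat_exp_nonneg: "flat_exp m x \<ge> 0"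
  by (auto simp: flat_exp_def)

text \<open>The quotient \<open>a / (a + b)\<close>, where \<open>a\<close> is positive exactly
  inside the radius \<open>R\<close> and \<open>b\<close> exactly outside the radius
  \<open>r\<close>. As \<open>r < R\<close>, at least one of them is positive everywhere. The
  squared distance \<open>q\<close> is used because it is smooth at the centre as well.\<close>

lemma smooth_bump_exists:
  fixes p :: "'a::euclidean_space"
  assumes "0 < r" "r < R"
  obtains \<theta> :: "'a \<Rightarrow> real" where "smooth_on UNIV \<theta>" "\<And>x. 0 \<le> \<theta> x" "\<And>x. \<theta> x \<le> 1"
    "\<And>x. x \<in> cball p r \<Longrightarrow> \<theta> x = 1" "\<And>x. x \<notin> ball p R \<Longrightarrow> \<theta> x = 0"
proof -
  define q where "q = (\<lambda>x::'a. (x - p) \<bullet> (x - p))"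
  have q: "smooth_on UNIV q" unfolding q_def
    by (intro smooth_on_inner smooth_on_diff) auto
  have qn: "q x = (dist p x)\<^sup>2" for x by (simp add: q_def dot_square_norm dist_norm norm_minus_commute)
  define a where "a = (\<lambda>x. flat_exp 0 (R\<^sup>2 - q x))"
  define b where "b = (\<lambda>x. flat_exp 0 (q x - r\<^sup>2))"
  have a: "smooth_on UNIV a" unfolding a_def
    by (rule smooth_on_compose[where T = UNIV]) (auto intro!: smooth_on_diff q smooth_on_flat_exp)
  have b: "smooth_on UNIV b" unfolding b_def
    by (rule smooth_on_compose[where T = UNIV]) (auto intro!: smooth_on_diff q smooth_on_flat_exp)
  have rR: "r\<^sup>2 < R\<^sup>2" using assms by (simp add: power_strict_mono)
  have ann: "a x \<ge> 0" "b x \<ge> 0" for x unfolding a_def b_def using flat_exp_nonneg by auto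
  have ab: "a x + b x > 0" for x
  proof (cases "R\<^sup>2 - q x > 0")
    case True
    then have "a x > 0" using flat_exp_0_pos unfolding a_def by blast
    then show ?thesis using ann[of x] by linarith
  next
    case False
    then have "q x - r\<^sup>2 > 0" using rR by linarith
    then have "b x > 0" using flat_exp_0_pos unfolding b_def by blast
    then show ?thesis using ann[of x] by linarith
  qed
  show thesis
  proof
    show "smooth_on UNIV (\<lambda>x. a x / (a x + b x))"
      using ab by (intro smooth_on_divide smooth_on_add a b) (auto simp: less_le)
    show "0 \<le> a x / (a x + b x)" "a x / (a x + b x) \<le> 1" for x
      using ann[of x] ab[of x] by (auto simp: divide_le_eq_1)
    show "a x / (a x + b x) = 1" if "x \<in> cball p r" for x
    proof -
      have "q x \<le> r\<^sup>2" using that assms unfolding qn by (simp add: power_mono)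
      then have "b x = 0" by (simp add: b_def flat_exp_def)
      then show ?thesis using ab[of x] by simp
    qed
    show "a x / (a x + b x) = 0" if "x \<notin> ball p R" for x
    proof -
      have "R\<^sup>2 \<le> q x" using that assms unfolding qn by (simp add: power_mono)
      then have "a x = 0" by (simp add: a_def flat_exp_def)
      then show ?thesis by simp
    qed
  qed
qed

text \<open>Finitely many bumps are combined as one minus the product of
  \<open>1 - \<beta> p\<close>: this stays between 0 and 1, equals 1 wherever a single bump does,
  and vanishes where all of them do.\<close>

lemma smooth_Urysohn:
  fixes K U :: "'a::euclidean_space set"
  assumes K: "compact K" and U: "open U" "K \<subseteq> U"
  obtains \<theta> :: "'a \<Rightarrow> real" where "smooth_on UNIV \<theta>" "\<And>x. 0 \<le> \<theta> x" "\<And>x. \<theta> x \<le> 1"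
    "\<And>x. x \<in> K \<Longrightarrow> \<theta> x = 1" "closure {x. \<theta> x \<noteq> 0} \<subseteq> U" "compact (closure {x. \<theta> x \<noteq> 0})"
proof -
  have "\<exists>R>0. cball p R \<subseteq> U" if "p \<in> K" for p using that U by (meson open_contains_cball subsetD)
  then obtain R where R: "\<And>p. p \<in> K \<Longrightarrow> R p > 0" "\<And>p. p \<in> K \<Longrightarrow> cball p (R p) \<subseteq> U" by metis
  have "\<exists>\<theta> :: 'a \<Rightarrow> real. smooth_on UNIV \<theta> \<and> (\<forall>x. 0 \<le> \<theta> x) \<and> (\<forall>x. \<theta> x \<le> 1) \<and>
      (\<forall>x\<in>cball p (R p / 2). \<theta> x = 1) \<and> (\<forall>x. x \<notin> ball p (R p) \<longrightarrow> \<theta> x = 0)" (is "\<exists>\<theta>. ?P p \<theta>") if "p \<in> K" for p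
  proof -
    have "0 < R p / 2" "R p / 2 < R p" using R[OF that] by auto
    from smooth_bump_exists[OF this, where p = p]
    obtain \<theta> :: "'a \<Rightarrow> real" where \<theta>: "smooth_on UNIV \<theta>" "\<And>x. 0 \<le> \<theta> x" "\<And>x. \<theta> x \<le> 1"
      "\<And>x. x \<in> cball p (R p / 2) \<Longrightarrow> \<theta> x = 1" "\<And>x. x \<notin> ball p (R p) \<Longrightarrow> \<theta> x = 0"
      by metis
    show ?thesis by (rule exI[of _ \<theta>]) (use \<theta> in blast)
  qed
  then have "\<exists>\<beta>. \<forall>p\<in>K. ?P p (\<beta> p)" by (intro bchoice ballI)
  then obtain \<beta> where *: "\<forall>p\<in>K. ?P p (\<beta> p)" by blast
  have \<beta>: "\<And>p. p \<in> K \<Longrightarrow> smooth_on UNIV (\<beta> p)"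
    "\<And>p x. p \<in> K \<Longrightarrow> 0 \<le> \<beta> p x" "\<And>p x. p \<in> K \<Longrightarrow> \<beta> p x \<le> 1"
    "\<And>p x. p \<in> K \<Longrightarrow> x \<in> cball p (R p / 2) \<Longrightarrow> \<beta> p x = 1"
    "\<And>p x. p \<in> K \<Longrightarrow> x \<notin> ball p (R p) \<Longrightarrow> \<beta> p x = 0"
    using * by blast+
  have "K \<subseteq> (\<Union>p\<in>K. ball p (R p / 2))" using R by force
  then obtain I where I: "I \<subseteq> K" "finite I" "K \<subseteq> (\<Union>p\<in>I. ball p (R p / 2))"
    using compactE_image[OF K, of K "\<lambda>p. ball p (R p / 2)"] by (metis open_ball)
  define \<theta> where "\<theta> = (\<lambda>x. 1 - (\<Prod>p\<in>I. 1 - \<beta> p x))"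
  have "{x. \<theta> x \<noteq> 0} \<subseteq> (\<Union>p\<in>I. cball p (R p))"
  proof
    fix x assume "x \<in> {x. \<theta> x \<noteq> 0}"
    then obtain p where p: "p \<in> I" "\<beta> p x \<noteq> 0" unfolding \<theta>_def
      by (metis (mono_tags, lifting) diff_self diff_zero mem_Collect_eq prod.neutral)
    then have "x \<in> ball p (R p)" using \<beta>(5) I by blast
    then show "x \<in> (\<Union>p\<in>I. cball p (R p))" using p ball_subset_cball by blast
  qed
  moreover have c: "compact (\<Union>p\<in>I. cball p (R p))" using I by (intro compact_UN) auto
  ultimately have cl: "closure {x. \<theta> x \<noteq> 0} \<subseteq> (\<Union>p\<in>I. cball p (R p))"
    by (simp add: closure_minimal compact_imp_closed)
  show thesis
  proof
    show "smooth_on UNIV \<theta>" unfolding \<theta>_def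
      using I \<beta>(1) by (intro smooth_on_diff smooth_on_prod) auto
    have pr: "0 \<le> (\<Prod>p\<in>I. 1 - \<beta> p x)" "(\<Prod>p\<in>I. 1 - \<beta> p x) \<le> 1" for x
      using I \<beta>(2,3) by (auto intro!: prod_nonneg prod_le_1)
    show "0 \<le> \<theta> x" "\<theta> x \<le> 1" for x unfolding \<theta>_def using pr[of x] by auto
    show "\<theta> x = 1" if x: "x \<in> K" for x
    proof -
      obtain p where "p \<in> I" "x \<in> cball p (R p / 2)" using I x by fastforce
      then have "p \<in> I" "1 - \<beta> p x = 0" using \<beta>(4) I by auto
      then have "(\<Prod>p\<in>I. 1 - \<beta> p x) = 0" using I(2) by (intro prod_zero) auto
      then show ?thesis by (simp add: \<theta>_def)
    qed
    show "closure {x. \<theta> x \<noteq> 0} \<subseteq> U"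
      by (rule subset_trans[OF cl]) (use R(2) I(1) in blast)
    show "compact (closure {x. \<theta> x \<noteq> 0})"
      using compact_Int_closed[OF c closed_closure[of "{x. \<theta> x \<noteq> 0}"]] cl by (simp add: Int_absorb1)
  qed
qed

section \<open>Smooth maps between manifolds\<close>

text \<open>The topological half of \<open>smooth_atlas\<close>, phrased with open maps so that it
  passes to product atlases directly. Composition of smooth maps rests on this half alone.\<close>

definition charted :: "('g::topological_space, 'e::euclidean_space) chart set \<Rightarrow> bool" where
  "charted A \<longleftrightarrow> (\<Union>(U, \<phi>)\<in>A. U) = UNIV \<and>
     (\<forall>(U, \<phi>)\<in>A. open U \<and> inj_on \<phi> U \<and> continuous_on U \<phi> \<and>
        (\<forall>W. W \<subseteq> U \<longrightarrow> open W \<longrightarrow> open (\<phi> ` W)))"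

lemma chartedD:
  assumes "charted A" "(U, \<phi>) \<in> A"
  shows "open U" "inj_on \<phi> U" "continuous_on U \<phi>" "\<And>W. W \<subseteq> U \<Longrightarrow> open W \<Longrightarrow> open (\<phi> ` W)"
  using assms unfolding charted_def by blast+

lemma charted_chart_at:
  assumes "charted A"
  obtains U \<phi> where "(U, \<phi>) \<in> A" "x \<in> U"
  using assms unfolding charted_def by blast

lemma smooth_atlas_charted:
  assumes "smooth_atlas A"
  shows "charted A"
proof -
  have "open U \<and> inj_on \<phi> U \<and> continuous_on U \<phi> \<and> (\<forall>W. W \<subseteq> U \<longrightarrow> open W \<longrightarrow> open (\<phi> ` W))"
    if "(U, \<phi>) \<in> A" for U \<phi>
  proof -
    have *: "open U" "open (\<phi> ` U)" "homeomorphism U (\<phi> ` U) \<phi> (inv_into U \<phi>)"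
      using assms that unfolding smooth_atlas_def by blast+
    have "inj_on \<phi> U" using *(3) unfolding homeomorphism_def by (metis inj_on_inverseI)
    moreover have "open (\<phi> ` W)" if "W \<subseteq> U" "open W" for W
      using homeomorphism_imp_open_map[OF *(3), of W] that *(1,2)
      by (metis openin_open_eq)
    ultimately show ?thesis using * unfolding homeomorphism_def by blast
  qed
  then show ?thesis using assms unfolding charted_def smooth_atlas_def by blast
qed

lemma charted_euclidean: "charted euclidean_atlas"
  unfolding charted_def euclidean_atlas_def by auto

lemma charted_product:
  fixes A :: "('g::topological_space, 'e::euclidean_space) chart set"
    and B :: "('h::topological_space, 'f::euclidean_space) chart set"
  assumes "charted A" "charted B"
  shows "charted (product_atlas A B)"
proof -
  have cov: "\<exists>W \<theta>. (W, \<theta>) \<in> product_atlas A B \<and> z \<in> W" for z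
  proof -
    obtain U \<phi> V \<psi> where "(U, \<phi>) \<in> A" "fst z \<in> U" "(V, \<psi>) \<in> B" "snd z \<in> V"
      using charted_chart_at[OF assms(1)] charted_chart_at[OF assms(2)] by metis
    then have "(U \<times> V, map_prod \<phi> \<psi>) \<in> product_atlas A B \<and> z \<in> U \<times> V"
      unfolding product_atlas_def by (auto simp: mem_Times_iff)
    then show ?thesis by blast
  qed
  have "open W \<and> inj_on \<theta> W \<and> continuous_on W \<theta> \<and> (\<forall>S. S \<subseteq> W \<longrightarrow> open S \<longrightarrow> open (\<theta> ` S))"
    if W: "(W, \<theta>) \<in> product_atlas A B" for W \<theta>
  proof -
    obtain U \<phi> V \<psi> where *: "(U, \<phi>) \<in> A" "(V, \<psi>) \<in> B" "W = U \<times> V" "\<theta> = map_prod \<phi> \<psi>"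
      using W unfolding product_atlas_def by blast
    note a = chartedD[OF assms(1) *(1)] and b = chartedD[OF assms(2) *(2)]
    have "open (\<theta> ` S)" if S: "S \<subseteq> W" "open S" for S
    proof (subst open_subopen, rule ballI)
      fix y assume "y \<in> \<theta> ` S"
      then obtain x where x: "x \<in> S" "y = \<theta> x" by blast
      obtain P Q where PQ: "open P" "open Q" "x \<in> P \<times> Q" "P \<times> Q \<subseteq> S"
        using open_prod_elim[OF S(2) x(1)] by metis
      have sub: "(P \<inter> U) \<times> (Q \<inter> V) \<subseteq> S" using PQ by blast
      have "open (\<phi> ` (P \<inter> U) \<times> \<psi> ` (Q \<inter> V))"
        by (rule open_Times[OF a(4) b(4)]) (use PQ a(1) b(1) in auto)
      moreover have "y \<in> \<phi> ` (P \<inter> U) \<times> \<psi> ` (Q \<inter> V)"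
      proof -
        obtain x1 x2 where "x = (x1, x2)" by (cases x)
        moreover have "x \<in> U \<times> V" using x(1) S(1) *(3) by blast
        ultimately show ?thesis using x(2) PQ(3) *(4) by auto
      qed
      moreover have "\<phi> ` (P \<inter> U) \<times> \<psi> ` (Q \<inter> V) \<subseteq> \<theta> ` S"
      proof
        fix z assume "z \<in> \<phi> ` (P \<inter> U) \<times> \<psi> ` (Q \<inter> V)"
        then obtain p q where "p \<in> P \<inter> U" "q \<in> Q \<inter> V" "z = (\<phi> p, \<psi> q)" by auto
        then show "z \<in> \<theta> ` S" using sub *(4) by (intro image_eqI[of _ _ "(p, q)"]) auto
      qed
      ultimately show "\<exists>T. open T \<and> y \<in> T \<and> T \<subseteq> \<theta> ` S" by blast
    qed
    moreover have "inj_on \<theta> W" using a b * by (simp add: map_prod_inj_on)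
    moreover have "continuous_on W \<theta>"
    proof -
      have "continuous_on W (\<lambda>z. (\<phi> (fst z), \<psi> (snd z)))"
        using * by (intro continuous_on_Pair continuous_on_compose2[OF a(3)]
            continuous_on_compose2[OF b(3)] continuous_on_fst continuous_on_snd continuous_on_id) auto
      then show ?thesis using *(4) by (simp add: map_prod_def case_prod_beta)
    qed
    ultimately show ?thesis using a b * by (auto intro: open_Times)
  qed
  moreover have "(\<Union>(W, \<theta>)\<in>product_atlas A B. W) = UNIV" using cov by fast
  ultimately show ?thesis unfolding charted_def by (intro conjI ballI) auto
qed

lemma smooth_mapD:
  assumes "smooth_map A B f" "(U, \<phi>) \<in> A" "(V, \<psi>) \<in> B"
  shows "smooth_on (\<phi> ` (U \<inter> f -` V)) (\<lambda>x. \<psi> (f (inv_into U \<phi> x)))"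
  using assms unfolding smooth_map_def comp_def by blast

lemma smooth_map_continuous: "smooth_map A B f \<Longrightarrow> continuous_on UNIV f"
  unfolding smooth_map_def by blast

text \<open>The composite is smooth near each point because it factors through a chart of
  \<open>B\<close> around the image of that point; on the open set \<open>S\<close> that chart and
  its inverse cancel.\<close>

lemma smooth_map_compose:
  fixes A :: "('g::topological_space, 'e::euclidean_space) chart set"
    and B :: "('h::topological_space, 'f::euclidean_space) chart set"
    and C :: "('k::topological_space, 'l::euclidean_space) chart set"
  assumes A: "charted A" and B: "charted B" and C: "charted C"
    and f: "smooth_map A B f" and g: "smooth_map B C g"
  shows "smooth_map A C (\<lambda>x. g (f x))"
  unfolding smooth_map_def
proof (intro conjI ballI, goal_cases)
  case 1
  show ?case
    using continuous_on_compose2[OF smooth_map_continuous[OF g] smooth_map_continuous[OF f]] by simp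
next
  case (2 c)
  obtain U \<phi> where c: "c = (U, \<phi>)" "(U, \<phi>) \<in> A" using 2 by (cases c) auto
  note a = chartedD[OF A c(2)]
  have "smooth_on (\<phi> ` (U \<inter> (\<lambda>x. g (f x)) -` W)) (\<lambda>x. \<theta> (g (f (inv_into U \<phi> x))))"
    if w: "(W, \<theta>) \<in> C" for W \<theta>
  proof (rule smooth_on_local)
    fix x assume "x \<in> \<phi> ` (U \<inter> (\<lambda>x. g (f x)) -` W)"
    then obtain u where u: "u \<in> U" "g (f u) \<in> W" "x = \<phi> u" by blast
    obtain V \<psi> where v: "(V, \<psi>) \<in> B" "f u \<in> V" using charted_chart_at[OF B] by metis
    note b = chartedD[OF B v(1)]
    have oW: "open (g -` W)" by (rule open_vimage[OF chartedD(1)[OF C w] smooth_map_continuous[OF g]])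
    then have oV: "open (V \<inter> g -` W)" using b by blast
    have ofV: "open (f -` (V \<inter> g -` W))" by (rule open_vimage[OF oV smooth_map_continuous[OF f]])
    define S where "S = \<phi> ` (U \<inter> f -` (V \<inter> g -` W))"
    have S: "open S" unfolding S_def using a ofV by blast
    have 1: "smooth_on S (\<lambda>x. \<psi> (f (inv_into U \<phi> x)))"
      by (rule smooth_on_subset[OF smooth_mapD[OF f c(2) v(1)]]) (auto simp: S_def)
    have 2: "smooth_on (\<psi> ` (V \<inter> g -` W)) (\<lambda>x. \<theta> (g (inv_into V \<psi> x)))"
      by (rule smooth_mapD[OF g v(1) w])
    have 3: "smooth_on S (\<lambda>x. \<theta> (g (inv_into V \<psi> (\<psi> (f (inv_into U \<phi> x))))))"
      by (rule smooth_on_compose[OF S _ 1 2]) (use a b oV in \<open>auto simp: S_def\<close>)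
    have 4: "smooth_on S (\<lambda>x. \<theta> (g (f (inv_into U \<phi> x))))"
      by (rule iffD1[OF smooth_on_cong_open[OF S] 3]) (use a b in \<open>auto simp: S_def\<close>)
    have "x \<in> S" using u v unfolding S_def by blast
    with S 4 show "\<exists>T. open T \<and> x \<in> T \<and> smooth_on T (\<lambda>x. \<theta> (g (f (inv_into U \<phi> x))))" by blast
  qed
  then show ?case unfolding c(1) by (auto simp: comp_def)
qed

lemma smooth_fun_chart:
  fixes f :: "'g::topological_space \<Rightarrow> 'f::euclidean_space"
  assumes "smooth_map A euclidean_atlas f" "(U, \<phi>) \<in> A"
  shows "smooth_on (\<phi> ` U) (\<lambda>x. f (inv_into U \<phi> x))"
proof -
  have "(UNIV, \<lambda>x. x) \<in> (euclidean_atlas :: ('f, 'f) chart set)" by (simp add: euclidean_atlas_def)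
  from smooth_mapD[OF assms this] show ?thesis by simp
qed

text \<open>Continuity on the manifold comes for free from smoothness in the charts, since these
  cover it by open sets.\<close>

lemma smooth_funI:
  fixes f :: "'g::topological_space \<Rightarrow> 'f::euclidean_space"
  assumes A: "charted A" and f: "\<And>U \<phi>. (U, \<phi>) \<in> A \<Longrightarrow> smooth_on (\<phi> ` U) (\<lambda>x. f (inv_into U \<phi> x))"
  shows "smooth_map A euclidean_atlas f"
proof -
  have "continuous_on (\<Union>(fst ` A)) f"
  proof (rule continuous_on_open_Union)
    fix U assume "U \<in> fst ` A"
    then obtain \<phi> where c: "(U, \<phi>) \<in> A" by auto
    note a = chartedD[OF A c(1)]
    show "open U" by (rule a)
    have "continuous_on U (\<lambda>x. f (inv_into U \<phi> (\<phi> x)))"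
      by (rule continuous_on_compose2[OF smooth_on_continuous[OF f[OF c(1)]] a(3)]) auto
    then show "continuous_on U f"
      by (rule continuous_on_eq) (use a in auto)
  qed
  moreover have "\<Union>(fst ` A) = UNIV" using A unfolding charted_def by (auto simp: case_prod_beta)
  ultimately have "continuous_on UNIV f" by simp
  then show ?thesis using f unfolding smooth_map_def euclidean_atlas_def by (auto simp: comp_def)
qed

lemma smooth_map_euclidean_iff:
  "smooth_map euclidean_atlas euclidean_atlas f \<longleftrightarrow> smooth_on UNIV f"
  unfolding smooth_map_def euclidean_atlas_def using smooth_on_continuous
  by (auto simp: comp_def inv_into_def cong: continuous_on_cong)

text \<open>Extension by zero is smooth at points outside \<open>U\<close> because the support,
  pulled back to the manifold, is compact and hence closed in a Hausdorff space: its complement is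
  an open neighbourhood of such a point on which the extension vanishes.\<close>

lemma chart_bump_extension:
  fixes A :: "('g::t2_space, 'e::euclidean_space) chart set" and g :: "'e \<Rightarrow> real"
  assumes A: "smooth_atlas A" and c: "(U, \<phi>) \<in> A" and g: "smooth_on UNIV g"
    and K: "compact (closure {x. g x \<noteq> 0})" "closure {x. g x \<noteq> 0} \<subseteq> \<phi> ` U"
  shows "smooth_fun A (\<lambda>x. if x \<in> U then g (\<phi> x) else 0)"
proof (rule smooth_funI[OF smooth_atlas_charted[OF A]])
  have ch: "charted A" using A smooth_atlas_charted by blast
  note a = chartedD[OF ch c]
  define K' where "K' = inv_into U \<phi> ` closure {x. g x \<noteq> 0}"
  have "continuous_on (\<phi> ` U) (inv_into U \<phi>)"
    using A c unfolding smooth_atlas_def homeomorphism_def by blast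
  then have "compact K'" unfolding K'_def using K continuous_on_subset compact_continuous_image by blast
  then have K'c: "closed K'" by (rule compact_imp_closed)
  fix W \<psi> assume w: "(W, \<psi>) \<in> A"
  note b = chartedD[OF ch w]
  show "smooth_on (\<psi> ` W) (\<lambda>x. if inv_into W \<psi> x \<in> U then g (\<phi> (inv_into W \<psi> x)) else 0)"
    (is "smooth_on _ ?h")
  proof (rule smooth_on_local)
    fix x assume "x \<in> \<psi> ` W"
    then obtain u where u: "u \<in> W" "x = \<psi> u" by blast
    show "\<exists>T. open T \<and> x \<in> T \<and> smooth_on T ?h"
    proof (cases "u \<in> U")
      case True
      let ?T = "\<psi> ` (W \<inter> U)"
      have T: "open ?T" using b a by blast
      have "smooth_on ?T (\<phi> \<circ> inv_into W \<psi>)" using A w c unfolding smooth_atlas_def by blast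
      then have "smooth_on ?T (\<lambda>x. g (\<phi> (inv_into W \<psi> x)))"
        by (intro smooth_on_compose[OF T open_UNIV _ g]) (auto simp: comp_def)
      then have "smooth_on ?T ?h" by (rule iffD1[OF smooth_on_cong_open[OF T], rotated]) (use b in auto)
      then show ?thesis using T True u by blast
    next
      case False
      let ?T = "\<psi> ` (W - K')"
      have T: "open ?T" using b K'c by (intro b(4)) auto
      have "?h y = 0" if y: "y \<in> ?T" for y
      proof (rule ccontr)
        assume h: "?h y \<noteq> 0"
        obtain w where w: "w \<in> W" "w \<notin> K'" "y = \<psi> w" using y by blast
        then have "inv_into W \<psi> y = w" using b by simp
        then have "w \<in> U" "g (\<phi> w) \<noteq> 0" using h by (auto split: if_splits)
        then have "\<phi> w \<in> closure {x. g x \<noteq> 0}" using closure_subset by fastforce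
        then have "inv_into U \<phi> (\<phi> w) \<in> K'" unfolding K'_def by blast
        then show False using w \<open>w \<in> U\<close> a by simp
      qed
      then have "smooth_on ?T ?h" using smooth_on_cong_open[OF T, of "\<lambda>x. 0" ?h] by simp
      moreover have "K' \<subseteq> U" unfolding K'_def using K(2) by (auto intro: inv_into_into)
      then have "x \<in> ?T" using False u by blast
      ultimately show ?thesis using T by blast
    qed
  qed
qed

section \<open>Translations and left-invariant fields on a Lie group\<close>

locale lie_grp =
  fixes A :: "('g::{topological_group_add,t2_space,second_countable_topology},
      'e::euclidean_space) chart set"
  assumes lie: "lie_group A"
begin

lemma atlas: "smooth_atlas A" and smooth_plus: "smooth_map (product_atlas A A) A (\<lambda>(x, y). x + y)"
  and smooth_uminus: "smooth_map A A (\<lambda>x. - x)"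
  using lie unfolding lie_group_def by auto

lemma charted: "charted A" and charted2: "charted (product_atlas A A)"
  using smooth_atlas_charted[OF atlas] charted_product by auto

lemma smooth_pair_const: "smooth_map A (product_atlas A A) (\<lambda>x. (a, x))"
  unfolding smooth_map_def
proof (intro conjI ballI, goal_cases)
  case 1
  show ?case by (intro continuous_intros)
next
  case (2 c)
  obtain U \<phi> where c: "c = (U, \<phi>)" "(U, \<phi>) \<in> A" using 2 by (cases c) auto
  have "smooth_on (\<phi> ` (U \<inter> Pair a -` W)) (\<lambda>x. \<theta> (a, inv_into U \<phi> x))"
    if w: "(W, \<theta>) \<in> product_atlas A A" for W \<theta>
  proof -
    obtain V1 \<psi>1 V2 \<psi>2 where v: "(V1, \<psi>1) \<in> A" "(V2, \<psi>2) \<in> A" "W = V1 \<times> V2" "\<theta> = map_prod \<psi>1 \<psi>2"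
      using w unfolding product_atlas_def by blast
    show ?thesis
    proof (cases "a \<in> V1")
      case True
      then have eq: "U \<inter> Pair a -` W = U \<inter> V2" using v by auto
      have o: "open (\<phi> ` (U \<inter> V2))"
        using chartedD[OF charted c(2)] chartedD[OF charted v(2)] by blast
      have "smooth_on (\<phi> ` (U \<inter> V2)) (\<psi>2 \<circ> inv_into U \<phi>)"
        using atlas c v unfolding smooth_atlas_def by blast
      then have "smooth_on (\<phi> ` (U \<inter> V2)) (\<lambda>x. (\<psi>1 a, \<psi>2 (inv_into U \<phi> x)))"
        by (intro smooth_on_Pair[OF o] smooth_on_const) (simp add: comp_def)
      then show ?thesis unfolding eq v(4) by simp
    next
      case False
      then have "U \<inter> Pair a -` W = {}" using v by auto
      then have "\<phi> ` (U \<inter> Pair a -` W) = {}" by simp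
      then show ?thesis by (simp only:) (rule smooth_on_local, simp)
    qed
  qed
  then show ?case unfolding c(1) by (auto simp: comp_def)
qed

lemma smooth_left_translation: "smooth_map A A (\<lambda>x. a + x)"
  using smooth_map_compose[OF charted charted2 charted smooth_pair_const smooth_plus] by simp

lemma smooth_fun_left_translation: "smooth_fun A f \<Longrightarrow> smooth_fun A (\<lambda>x. f (a + x))"
  using smooth_map_compose[OF charted charted charted_euclidean smooth_left_translation] by blast

lemma smooth_fun_add: "smooth_fun A f \<Longrightarrow> smooth_fun A g \<Longrightarrow> smooth_fun A (\<lambda>x. f x + g x)"
  and smooth_fun_mult: "smooth_fun A f \<Longrightarrow> smooth_fun A g \<Longrightarrow> smooth_fun A (\<lambda>x. f x * g x)"
  by (intro smooth_funI[OF charted] smooth_on_add smooth_on_mult smooth_fun_chart;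
      (assumption | use chartedD[OF charted] in blast))+

lemma smooth_fun_const: "smooth_fun A (\<lambda>x. c)"
  by (intro smooth_funI[OF charted]) simp

end

text \<open>A chart at the neutral element identifies the tangent space there with the model space.\<close>

locale lie_grp_chart = lie_grp A
  for A :: "('g::{topological_group_add,t2_space,second_countable_topology},
      'e::euclidean_space) chart set" +
  fixes U :: "'g set" and \<phi> :: "'g \<Rightarrow> 'e"
  assumes chart: "(U, \<phi>) \<in> A" and zero_in: "0 \<in> U"
begin

definition "\<tau> = inv_into U \<phi>"
definition "p0 = \<phi> 0"

lemma chart_facts: "open U" "inj_on \<phi> U" "continuous_on U \<phi>" "\<And>W. W \<subseteq> U \<Longrightarrow> open W \<Longrightarrow> open (\<phi> ` W)"
  using chartedD[OF charted chart] by auto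

lemma open_image: "open (\<phi> ` U)" using chart_facts by blast

lemma \<tau>_\<phi> [simp]: "x \<in> U \<Longrightarrow> \<tau> (\<phi> x) = x" and \<phi>_\<tau> [simp]: "y \<in> \<phi> ` U \<Longrightarrow> \<phi> (\<tau> y) = y"
  and \<tau>_in [simp]: "y \<in> \<phi> ` U \<Longrightarrow> \<tau> y \<in> U"
  unfolding \<tau>_def using chart_facts by (auto simp: f_inv_into_f inv_into_into)

lemma p0_in [simp]: "p0 \<in> \<phi> ` U" and \<tau>_p0 [simp]: "\<tau> p0 = 0"
  unfolding p0_def using zero_in by auto

lemma \<tau>_continuous: "continuous_on (\<phi> ` U) \<tau>"
  using atlas chart unfolding smooth_atlas_def homeomorphism_def \<tau>_def by blast

text \<open>The left-invariant field with tangent vector \<open>v\<close> at the neutral element.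
  The value 0 on non-smooth arguments is the convention of \<open>vector_field\<close>.\<close>

definition lvf :: "'e \<Rightarrow> 'g vfield" where
  "lvf v h a = (if smooth_fun A h then frechet_derivative (\<lambda>y. h (a + \<tau> y)) (at p0) v else 0)"

lemma smooth_translate:
  assumes "smooth_fun A h"
  shows "smooth_on (\<phi> ` U) (\<lambda>y. h (a + \<tau> y))"
  using smooth_fun_chart[OF smooth_fun_left_translation[OF assms] chart] unfolding \<tau>_def .

lemma lvf_has_derivative:
  assumes "smooth_fun A h"
  shows "((\<lambda>y. h (a + \<tau> y)) has_derivative (\<lambda>v. lvf v h a)) (at p0)"
  using smooth_on_has_derivative[OF smooth_translate[OF assms] p0_in, of a] assms
  unfolding lvf_def by simp

lemma lvf_eqI:
  assumes "smooth_fun A h" "((\<lambda>y. h (a + \<tau> y)) has_derivative D) (at p0)"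
  shows "lvf v h a = D v"
  using has_derivative_unique[OF lvf_has_derivative[OF assms(1)] assms(2)] by metis

text \<open>In charts, \<open>lvf v h\<close> is a partial derivative of the smooth function taking
  \<open>(x, y)\<close> to the value of \<open>h\<close> at the product, evaluated on the slice
  \<open>y = p0\<close>; so it is smooth in \<open>x\<close>.\<close>

lemma smooth_lvf:
  assumes h: "smooth_fun A h"
  shows "smooth_fun A (lvf v h)"
proof (rule smooth_funI[OF charted])
  fix W \<psi> assume w: "(W, \<psi>) \<in> A"
  note b = chartedD[OF charted w]
  let ?H = "\<lambda>z. h (inv_into W \<psi> (fst z) + \<tau> (snd z))"
  have sm: "smooth_fun (product_atlas A A) (\<lambda>z. h (case z of (x, y) \<Rightarrow> x + y))"
    by (rule smooth_map_compose[OF charted2 charted charted_euclidean smooth_plus h])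
  have ch: "(W \<times> U, map_prod \<psi> \<phi>) \<in> product_atlas A A"
    using w chart unfolding product_atlas_def by blast
  have o: "open (\<psi> ` W \<times> \<phi> ` U)" using b open_image by (intro open_Times) auto
  have inj: "inj_on (map_prod \<psi> \<phi>) (W \<times> U)" using b chart_facts by (simp add: map_prod_inj_on)
  have inv: "inv_into (W \<times> U) (map_prod \<psi> \<phi>) z = (inv_into W \<psi> (fst z), \<tau> (snd z))"
    if z: "z \<in> \<psi> ` W \<times> \<phi> ` U" for z
  proof -
    obtain a c where ac: "a \<in> W" "c \<in> U" "z = (\<psi> a, \<phi> c)" using z by auto
    have "inv_into (W \<times> U) (map_prod \<psi> \<phi>) (map_prod \<psi> \<phi> (a, c)) = (a, c)"
      by (rule inv_into_f_f[OF inj]) (use ac in simp)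
    then show ?thesis using ac b(2) by simp
  qed
  have "map_prod \<psi> \<phi> ` (W \<times> U) = \<psi> ` W \<times> \<phi> ` U" by (rule map_prod_surj_on) auto
  then have "smooth_on (\<psi> ` W \<times> \<phi> ` U)
      (\<lambda>z. h (case inv_into (W \<times> U) (map_prod \<psi> \<phi>) z of (x, y) \<Rightarrow> x + y))"
    using smooth_fun_chart[OF sm ch] by simp
  then have H: "smooth_on (\<psi> ` W \<times> \<phi> ` U) ?H"
    by (rule iffD1[OF smooth_on_cong_open[OF o], rotated]) (simp add: inv)
  have "smooth_on (\<psi> ` W) (\<lambda>x. (\<lambda>z. frechet_derivative ?H (at z) (0, v)) (x, p0))"
    by (rule smooth_on_compose[OF _ o _ smooth_on_frechet_derivative[OF H]])
      (use b in \<open>auto intro!: smooth_on_Pair\<close>)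
  moreover have "frechet_derivative ?H (at (x, p0)) (0, v) = lvf v h (inv_into W \<psi> x)"
    if "x \<in> \<psi> ` W" for x
  proof -
    have "((\<lambda>y. (x, y)) has_derivative (\<lambda>v. (0, v))) (at p0)" by (auto intro!: derivative_eq_intros)
    moreover have "(?H has_derivative frechet_derivative ?H (at (x, p0))) (at (x, p0))"
      by (rule smooth_on_has_derivative[OF H]) (use that in simp)
    ultimately have "((\<lambda>y. ?H (x, y)) has_derivative (\<lambda>v. frechet_derivative ?H (at (x, p0)) (0, v))) (at p0)"
      by (rule has_derivative_compose)
    then have "((\<lambda>y. h (inv_into W \<psi> x + \<tau> y)) has_derivative (\<lambda>v. frechet_derivative ?H (at (x, p0)) (0, v))) (at p0)"
      by simp
    from lvf_eqI[OF h this] show ?thesis by simp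
  qed
  ultimately show "smooth_on (\<psi> ` W) (\<lambda>x. lvf v h (inv_into W \<psi> x))"
    by (subst smooth_on_cong_open[OF b(4)[OF order_refl b(1)], of _ "\<lambda>x. frechet_derivative ?H (at (x, p0)) (0, v)"])
      simp_all
qed

lemma lvf_linear: "linear (\<lambda>v. lvf v h a)"
proof (cases "smooth_fun A h")
  case True
  then show ?thesis using lvf_has_derivative has_derivative_linear by blast
next
  case False
  then show ?thesis by (simp add: lvf_def linear_iff)
qed

lemma lvf_in_lie_algebra: "lvf v \<in> lie_algebra A"
proof -
  have 1: "lvf v (\<lambda>x. f x + g x) a = lvf v f a + lvf v g a" if f: "smooth_fun A f" and g: "smooth_fun A g" for f g a
    by (rule lvf_eqI[OF smooth_fun_add[OF f g] has_derivative_add[OF lvf_has_derivative lvf_has_derivative]]) fact+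
  have 2: "lvf v (\<lambda>x. f x * g x) a = lvf v f a * g a + f a * lvf v g a"
    if f: "smooth_fun A f" and g: "smooth_fun A g" for f g a
    using lvf_eqI[OF smooth_fun_mult[OF f g] has_derivative_mult[OF lvf_has_derivative[OF f] lvf_has_derivative[OF g]], of v]
    by (simp add: algebra_simps)
  have 3: "lvf v (\<lambda>x. c * f x) a = c * lvf v f a" if f: "smooth_fun A f" for f a c
    by (rule lvf_eqI[OF smooth_fun_mult[OF smooth_fun_const f] has_derivative_mult_right[OF lvf_has_derivative]]) fact+
  have 4: "lvf v (\<lambda>x. f (b + x)) a = lvf v f (b + a)" if f: "smooth_fun A f" for f a b
    using lvf_has_derivative[OF f, of "b + a"]
    by (intro lvf_eqI[OF smooth_fun_left_translation[OF f]]) (simp add: add.assoc)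
  have "vector_field A (lvf v)" unfolding vector_field_def
    using 1 2 3 smooth_lvf by (auto simp: lvf_def fun_eq_iff)
  then show ?thesis unfolding lie_algebra_def using 4 by (auto simp: fun_eq_iff)
qed

text \<open>Fields act on globally smooth functions only. These functions agree with the linear
  coordinates of the chart near the neutral element, so that a field can be recovered there from its
  action.\<close>

lemma cutoff_coordinates:
  obtains r and C :: "'e \<Rightarrow> 'g \<Rightarrow> real" where "r > 0" "ball p0 r \<subseteq> \<phi> ` U" "\<And>w. smooth_fun A (C w)"
    "\<And>w y. y \<in> ball p0 r \<Longrightarrow> C w (\<tau> y) = y \<bullet> w"
proof -
  obtain R where R: "R > 0" "cball p0 R \<subseteq> \<phi> ` U"
    using open_image p0_in open_contains_cball by meson
  have "0 < R / 2" "R / 2 < R" using R by auto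
  from smooth_bump_exists[OF this, where p = p0]
  obtain \<theta> :: "'e \<Rightarrow> real" where \<theta>: "smooth_on UNIV \<theta>"
      "\<And>x. x \<in> cball p0 (R / 2) \<Longrightarrow> \<theta> x = 1" "\<And>x. x \<notin> ball p0 R \<Longrightarrow> \<theta> x = 0"
    by metis
  define C where "C = (\<lambda>w x. if x \<in> U then \<theta> (\<phi> x) * (\<phi> x \<bullet> w) else 0)"
  show thesis
  proof
    show "R / 2 > 0" using R by simp
    show "ball p0 (R / 2) \<subseteq> \<phi> ` U" 
      by (rule order_trans[OF _ R(2)]) (use R in auto)
    fix w
    have "{x. \<theta> x * (x \<bullet> w) \<noteq> 0} \<subseteq> cball p0 R"
    proof
      fix x assume "x \<in> {x. \<theta> x * (x \<bullet> w) \<noteq> 0}"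
      then have "x \<in> ball p0 R" using \<theta>(3)[of x] by auto
      then show "x \<in> cball p0 R" using ball_subset_cball by blast
    qed
    then have cl: "closure {x. \<theta> x * (x \<bullet> w) \<noteq> 0} \<subseteq> cball p0 R" by (simp add: closure_minimal)
    then have "compact (closure {x. \<theta> x * (x \<bullet> w) \<noteq> 0})"
      using compact_Int_closed[OF compact_cball closed_closure[of "{x. \<theta> x * (x \<bullet> w) \<noteq> 0}"], of p0 R]
      by (simp add: Int_absorb1)
    then show "smooth_fun A (C w)" unfolding C_def
      by (intro chart_bump_extension[OF atlas chart, of "\<lambda>x. \<theta> x * (x \<bullet> w)"])
        (use cl R \<theta> in \<open>auto intro!: smooth_on_mult smooth_on_inner\<close>)
    fix y assume y: "y \<in> ball p0 (R / 2)"
    then have "y \<in> \<phi> ` U" "\<theta> y = 1" using R \<theta>(2) by auto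
    then show "C w (\<tau> y) = y \<bullet> w" unfolding C_def by simp
  qed
qed

lemma lvf_inject:
  assumes "lvf v = vf_zero"
  shows "v = 0"
proof -
  obtain r C where C: "r > 0" "ball p0 r \<subseteq> \<phi> ` U" "\<And>w. smooth_fun A (C w)"
    "\<And>w y. y \<in> ball p0 r \<Longrightarrow> C w (\<tau> y) = y \<bullet> w" using cutoff_coordinates by blast
  have "((\<lambda>y. y \<bullet> v) has_derivative (\<lambda>w. w \<bullet> v)) (at p0)" by (auto intro!: derivative_eq_intros)
  then have "((\<lambda>y. C v (0 + \<tau> y)) has_derivative (\<lambda>w. w \<bullet> v)) (at p0)"
    by (rule has_derivative_transform_within_open[of _ _ _ _ "ball p0 r"]) (use C in auto)
  from lvf_eqI[OF C(3) this, of v] show ?thesis using assms by (simp add: vf_zero_def)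
qed

text \<open>Sending \<open>v\<close> to the coefficients of \<open>lvf v\<close> in the basis
  \<open>X\<close> is linear and, by \<open>lvf_inject\<close>, injective. Source and target both
  have dimension \<open>s + 1\<close>, so it is bijective and \<kappa> is its inverse. The dimension
  count replaces a proof that every invariant derivation comes from a tangent vector.\<close>

lemma lie_algebra_basis_tangent:
  assumes B: "lie_algebra_basis A s X" and e: "bij_betw e {..s} (Basis :: 'e set)"
  obtains \<kappa> where "linear \<kappa>" "bij \<kappa>" "\<And>j. j \<le> s \<Longrightarrow> lvf (\<kappa> (e j)) = X j"
proof -
  have X: "X j \<in> lie_algebra A" if "j \<le> s" for j using B that unfolding lie_algebra_basis_def by blast
  have ind: "c j = 0" if "vf_lincomb s c X = vf_zero" "j \<le> s" for c j
    using B that unfolding lie_algebra_basis_def by blast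
  have "\<forall>v. \<exists>c. lvf v = vf_lincomb s c X"
    using B lvf_in_lie_algebra unfolding lie_algebra_basis_def by blast
  then obtain c where c: "\<And>v. lvf v = vf_lincomb s (c v) X" by metis
  have uniq: "a j = b j" if "vf_lincomb s a X = vf_lincomb s b X" "j \<le> s" for a b j
  proof -
    have "vf_lincomb s (\<lambda>j. a j - b j) X = vf_zero"
      using that(1) unfolding vf_lincomb_def vf_zero_def
      by (simp add: fun_eq_iff left_diff_distrib sum_subtractf)
    from ind[OF this that(2)] show ?thesis by simp
  qed
  have add: "c (v + w) j = c v j + c w j" if "j \<le> s" for v w j
  proof (rule uniq[OF _ that])
    show "vf_lincomb s (c (v + w)) X = vf_lincomb s (\<lambda>j. c v j + c w j) X"
      using c[of "v + w"] c[of v] c[of w] linear_add[OF lvf_linear]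
      unfolding vf_lincomb_def by (simp add: fun_eq_iff distrib_right sum.distrib)
  qed
  have scale: "c (k *\<^sub>R v) j = k * c v j" if "j \<le> s" for k v j
  proof (rule uniq[OF _ that])
    show "vf_lincomb s (c (k *\<^sub>R v)) X = vf_lincomb s (\<lambda>j. k * c v j) X"
      using c[of "k *\<^sub>R v"] c[of v] linear_scale[OF lvf_linear]
      unfolding vf_lincomb_def by (simp add: fun_eq_iff sum_distrib_left mult.assoc)
  qed
  define T where "T = (\<lambda>v. \<Sum>j\<le>s. c v j *\<^sub>R e j)"
  have lT: "linear T" unfolding T_def
    by (rule linearI) (simp_all add: add scale scaleR_left_distrib sum.distrib scaleR_sum_right)
  have eB: "e j \<in> Basis" if "j \<le> s" for j using e that unfolding bij_betw_def by auto
  have ei: "e i \<bullet> e j = (if i = j then 1 else 0)" if "i \<le> s" "j \<le> s" for i j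
    using inner_Basis[OF eB[OF that(1)] eB[OF that(2)]] inj_on_eq_iff[of e "{..s}" i j] e that
    by (simp add: bij_betw_def)
  have Tj: "T v \<bullet> e j = c v j" if "j \<le> s" for v j
    unfolding T_def using that by (simp add: inner_sum_left ei if_distrib cong: if_cong)
  have "inj T"
  proof (rule injI)
    fix v w assume "T v = T w"
    then have cc: "c v j = c w j" if "j \<le> s" for j using Tj[OF that, of v] Tj[OF that, of w] by simp
    have "lvf v = lvf w" unfolding c[of v] c[of w] vf_lincomb_def
      using cc by (intro ext sum.cong) auto
    then have "lvf (v - w) = vf_zero"
      using linear_diff[OF lvf_linear] by (simp add: fun_eq_iff vf_zero_def)
    then show "v = w" using lvf_inject by fastforce
  qed
  then obtain \<kappa> where \<kappa>: "linear \<kappa>" "\<kappa> \<circ> T = id" "T \<circ> \<kappa> = id"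
    using linear_injective_isomorphism[OF lT] by (auto simp: fun_eq_iff)
  show thesis
  proof
    show "linear \<kappa>" by fact
    show "bij \<kappa>" using \<kappa> by (metis o_bij)
    fix j assume j: "j \<le> s"
    have "c (\<kappa> (e j)) i = (if i = j then 1 else 0)" if "i \<le> s" for i
      using Tj[OF that, of "\<kappa> (e j)"] \<kappa>(3) ei[OF j that] by (auto simp: fun_eq_iff)
    then have "(\<Sum>i\<le>s. c (\<kappa> (e j)) i * X i f x) = (\<Sum>i\<le>s. if i = j then X i f x else 0)" for f x
      by (intro sum.cong) auto
    then have "vf_lincomb s (c (\<kappa> (e j))) X = X j"
      using j unfolding vf_lincomb_def by (simp add: fun_eq_iff)
    then show "lvf (\<kappa> (e j)) = X j" using c by metis
  qed
qed

end

section \<open>The model group\<close>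

definition divpow :: "real \<Rightarrow> nat \<Rightarrow> real" where
  "divpow t n = t ^ n / fact n"

lemma divpow_0 [simp]: "divpow t 0 = 1" and divpow_0_left: "divpow 0 n = (if n = 0 then 1 else 0)"
  by (auto simp: divpow_def)

text \<open>The binomial theorem, in the form that makes \<open>shear\<close> a one-parameter
  group.\<close>

lemma divpow_add: "divpow (t + r) n = (\<Sum>k\<le>n. divpow t k * divpow r (n - k))"
proof -
  have "divpow (t + r) n = (\<Sum>k\<le>n. (real (n choose k) * t ^ k * r ^ (n - k)) / fact n)"
    unfolding divpow_def binomial_ring by (simp add: sum_divide_distrib)
  also have "\<dots> = (\<Sum>k\<le>n. divpow t k * divpow r (n - k))"
    unfolding divpow_def by (intro sum.cong refl) (simp add: binomial_fact field_simps)
  finally show ?thesis .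
qed

text \<open>Coordinates: the point \<open>x\<close> stands for \<open>exp(x\<^sub>1 X\<^sub>1 + \<dots> + x\<^sub>s X\<^sub>s) exp(x\<^sub>0 X\<^sub>0)\<close>.
  Conjugation by \<open>exp(t X\<^sub>0)\<close> is the linear map \<open>shear t\<close>.\<close>

locale filiform_model =
  fixes e :: "nat \<Rightarrow> 'e::euclidean_space" and s :: nat
  assumes e_basis: "bij_betw e {..s} Basis" and s_pos: "1 \<le> s"
begin

lemma e_in_Basis [simp]: "j \<le> s \<Longrightarrow> e j \<in> Basis"
  using e_basis unfolding bij_betw_def by auto

lemma e_inner: "i \<le> s \<Longrightarrow> j \<le> s \<Longrightarrow> e i \<bullet> e j = (if i = j then 1 else 0)"
  using inner_Basis[of "e i" "e j"] inj_on_eq_iff[of e "{..s}" i j] e_basis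
  by (simp add: bij_betw_def)

lemma Basis_eq: "Basis = e ` {..s}"
  using e_basis unfolding bij_betw_def by auto

lemma coord_eqI: "(\<And>j. j \<le> s \<Longrightarrow> x \<bullet> e j = y \<bullet> e j) \<Longrightarrow> x = y"
  by (rule euclidean_eqI) (auto simp: Basis_eq)

lemma coord_sum: "j \<le> s \<Longrightarrow> (\<Sum>i\<le>s. c i *\<^sub>R e i) \<bullet> e j = c j"
  by (simp add: inner_sum_left e_inner if_distrib cong: if_cong)

text \<open>This is exp(t ad \<open>X 0\<close>) in coordinates: ad \<open>X 0\<close> moves
  \<open>e i\<close> to \<open>e (Suc i)\<close> for \<open>1 \<le> i < s\<close> and kills
  \<open>e 0\<close> and \<open>e s\<close>, so its powers produce the divided powers below the
  diagonal.\<close>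

definition shear :: "real \<Rightarrow> 'e \<Rightarrow> 'e" where
  "shear t v = (\<Sum>j\<le>s. (if j = 0 then v \<bullet> e 0 else (\<Sum>i=1..j. divpow t (j - i) * (v \<bullet> e i))) *\<^sub>R e j)"

lemma shear_e0 [simp]: "shear t v \<bullet> e 0 = v \<bullet> e 0"
  unfolding shear_def by (subst coord_sum) auto

lemma shear_ej: "1 \<le> j \<Longrightarrow> j \<le> s \<Longrightarrow> shear t v \<bullet> e j = (\<Sum>i=1..j. divpow t (j - i) * (v \<bullet> e i))"
  unfolding shear_def by (subst coord_sum) auto

lemma shear_coord:
  "j \<le> s \<Longrightarrow> shear t v \<bullet> e j = (if j = 0 then v \<bullet> e 0 else (\<Sum>i=1..j. divpow t (j - i) * (v \<bullet> e i)))"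
  unfolding shear_def by (rule coord_sum)

lemma linear_shear: "linear (shear t)"
proof (rule linearI)
  show "shear t (v + w) = shear t v + shear t w" for v w
    by (rule coord_eqI) (simp add: inner_add_left shear_coord distrib_left sum.distrib)
  show "shear t (c *\<^sub>R v) = c *\<^sub>R shear t v" for c v
    by (rule coord_eqI) (simp add: shear_coord sum_distrib_left mult.left_commute)
qed

lemmas shear_add = linear_add[OF linear_shear] and shear_scale = linear_scale[OF linear_shear]
  and shear_diff = linear_diff[OF linear_shear] and shear_minus = linear_neg[OF linear_shear]
  and shear_zero [simp] = linear_0[OF linear_shear]

lemma bounded_linear_shear: "bounded_linear (shear t)"
  using linear_shear by (simp add: linear_conv_bounded_linear)

lemma shear_basis0 [simp]: "shear t (e 0) = e 0"
proof (rule coord_eqI)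
  fix j assume j: "j \<le> s"
  have "(\<Sum>i=1..j. divpow t (j - i) * (e 0 \<bullet> e i)) = 0"
    using j by (intro sum.neutral) (auto simp: e_inner)
  then show "shear t (e 0) \<bullet> e j = e 0 \<bullet> e j" using j by (simp add: shear_coord e_inner)
qed

lemma shear_basis_coord:
  assumes "1 \<le> i" "i \<le> s" "j \<le> s"
  shows "shear t (e i) \<bullet> e j = (if i \<le> j then divpow t (j - i) else 0)"
proof (cases "j = 0")
  case True
  then show ?thesis using assms by (simp add: e_inner)
next
  case False
  have "(\<Sum>k=1..j. divpow t (j - k) * (e i \<bullet> e k)) = (\<Sum>k=1..j. if k = i then divpow t (j - i) else 0)"
    using assms by (intro sum.cong) (auto simp: e_inner)
  then show ?thesis using assms False by (simp add: shear_ej)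
qed

lemma shear_0 [simp]: "shear 0 v = v"
proof (rule coord_eqI)
  fix j assume j: "j \<le> s"
  have "(\<Sum>i=1..j. divpow 0 (j - i) * (v \<bullet> e i)) = (\<Sum>i=1..j. if i = j then v \<bullet> e j else 0)"
    by (intro sum.cong) (auto simp: divpow_0_left)
  then show "shear 0 v \<bullet> e j = v \<bullet> e j" using j by (simp add: shear_coord)
qed

text \<open>After the two summations are exchanged, the inner sum is the convolution in
  \<open>divpow_add\<close>.\<close>

lemma shear_shear: "shear t (shear r v) = shear (t + r) v"
proof (rule coord_eqI)
  fix j assume j: "j \<le> s"
  show "shear t (shear r v) \<bullet> e j = shear (t + r) v \<bullet> e j"
  proof (cases "j = 0")
    case False
    have inner: "(\<Sum>i\<in>{i\<in>{1..j}. k \<le> i}. divpow t (j - i) * (divpow r (i - k) * c)) = divpow (t + r) (j - k) * c"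
      if "k \<in> {1..j}" for k c
    proof -
      have "(\<Sum>i\<in>{i\<in>{1..j}. k \<le> i}. divpow t (j - i) * (divpow r (i - k) * c))
          = (\<Sum>m\<le>j - k. divpow r m * divpow t (j - k - m) * c)"
        by (rule sum.reindex_bij_witness[of _ "\<lambda>m. k + m" "\<lambda>i. i - k"]) (use that in auto)
      then show ?thesis by (simp add: add.commute[of t r] divpow_add sum_distrib_right)
    qed
    have "shear t (shear r v) \<bullet> e j
        = (\<Sum>i=1..j. \<Sum>k=1..i. divpow t (j - i) * (divpow r (i - k) * (v \<bullet> e k)))"
      using j False by (simp add: shear_ej sum_distrib_left)
    also have "\<dots> = (\<Sum>i=1..j. \<Sum>k\<in>{k\<in>{1..j}. k \<le> i}. divpow t (j - i) * (divpow r (i - k) * (v \<bullet> e k)))"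
      by (intro sum.cong) auto
    also have "\<dots> = (\<Sum>k=1..j. \<Sum>i\<in>{i\<in>{1..j}. k \<le> i}. divpow t (j - i) * (divpow r (i - k) * (v \<bullet> e k)))"
      by (rule sum.swap_restrict) auto
    also have "\<dots> = (\<Sum>k=1..j. divpow (t + r) (j - k) * (v \<bullet> e k))"
      by (intro sum.cong refl inner)
    finally show ?thesis using j False by (simp add: shear_ej)
  qed simp
qed

text \<open>Moving exp(x_0 \<open>X 0\<close>) past the abelian factor of \<open>y\<close> shears
  that factor. Since \<open>shear\<close> fixes \<open>e 0\<close>, the same formula also adds the
  \<open>e 0\<close> coordinates, and left translation is affine in \<open>y\<close>.\<close>

definition mul :: "'e \<Rightarrow> 'e \<Rightarrow> 'e" where
  "mul x y = x + shear (x \<bullet> e 0) y"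

definition minv :: "'e \<Rightarrow> 'e" where
  "minv x = - shear (- (x \<bullet> e 0)) x"

lemma mul_e0 [simp]: "mul x y \<bullet> e 0 = x \<bullet> e 0 + y \<bullet> e 0"
  by (simp add: mul_def inner_add_left)

lemma minv_e0 [simp]: "minv x \<bullet> e 0 = - (x \<bullet> e 0)"
  by (simp add: minv_def)

lemma mul_assoc: "mul (mul x y) z = mul x (mul y z)"
  by (simp add: mul_def inner_add_left shear_add shear_shear add.assoc)

lemma mul_0_left [simp]: "mul 0 x = x" and mul_0_right [simp]: "mul x 0 = x"
  by (simp_all add: mul_def)

lemma mul_minv [simp]: "mul x (minv x) = 0"
  by (simp add: mul_def minv_def shear_minus shear_shear)

lemma minv_mul [simp]: "mul (minv x) x = 0"
  unfolding mul_def[of "minv x"] minv_e0 by (simp add: minv_def)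

lemma minv_mul_cancel [simp]: "mul (minv x) (mul x y) = y" "mul x (mul (minv x) y) = y"
  by (simp_all flip: mul_assoc)

lemma mul_scale_basis0: "mul x (r *\<^sub>R e 0) = x + r *\<^sub>R e 0"
  by (simp add: mul_def shear_scale)

lemma smooth_shear: "smooth_on UNIV (\<lambda>z. shear (fst z) (snd z))"
  unfolding shear_def divpow_def
proof (intro smooth_on_sum smooth_on_scaleR smooth_on_const open_UNIV)
  fix j
  have f: "smooth_on UNIV (\<lambda>z :: real \<times> 'e. fst z)" and g: "smooth_on UNIV (\<lambda>z :: real \<times> 'e. snd z \<bullet> e i)" for i
    by (auto intro!: smooth_on_bounded_linear bounded_linear_fst bounded_linear_compose[OF bounded_linear_inner_left bounded_linear_snd])
  have "smooth_on UNIV (\<lambda>z :: real \<times> 'e. \<Sum>i = 1..j. fst z ^ (j - i) / fact (j - i) * (snd z \<bullet> e i))"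
    by (intro smooth_on_sum smooth_on_mult smooth_on_divide smooth_on_power f g open_UNIV smooth_on_const) simp
  then show "smooth_on UNIV (\<lambda>z :: real \<times> 'e. if j = 0 then snd z \<bullet> e 0
      else \<Sum>i = 1..j. fst z ^ (j - i) / fact (j - i) * (snd z \<bullet> e i))"
    using g by (cases "j = 0") (simp_all only: if_True if_False simp_thms)
qed

lemma smooth_on_shear:
  fixes f :: "'a::euclidean_space \<Rightarrow> real"
  assumes "open S" "smooth_on S f" "smooth_on S g"
  shows "smooth_on S (\<lambda>x. shear (f x) (g x))"
  using smooth_on_compose[OF assms(1) open_UNIV smooth_on_Pair[OF assms] smooth_shear] by simp

lemma smooth_on_inner_const: "open S \<Longrightarrow> smooth_on S f \<Longrightarrow> smooth_on S (\<lambda>x. f x \<bullet> c)"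
  for f :: "'a::euclidean_space \<Rightarrow> 'b::euclidean_space"
  by (intro smooth_on_inner smooth_on_const)

lemma smooth_on_mul:
  assumes "open S" "smooth_on S f" "smooth_on S g"
  shows "smooth_on S (\<lambda>x. mul (f x) (g x))"
  unfolding mul_def using assms by (intro smooth_on_add smooth_on_shear smooth_on_inner_const)

lemma smooth_on_minv:
  assumes "open S" "smooth_on S f"
  shows "smooth_on S (\<lambda>x. minv (f x))"
  unfolding minv_def using assms by (intro smooth_on_minus smooth_on_shear smooth_on_inner_const)

lemma continuous_on_mul:
  fixes f g :: "'a::topological_space \<Rightarrow> 'e"
  assumes "continuous_on S f" "continuous_on S g"
  shows "continuous_on S (\<lambda>x. mul (f x) (g x))"
proof -
  have "continuous_on UNIV (\<lambda>z. mul (fst z) (snd z))"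
    by (intro smooth_on_continuous smooth_on_mul)
      (auto intro: smooth_on_bounded_linear bounded_linear_fst bounded_linear_snd)
  from continuous_on_compose2[OF this continuous_on_Pair[OF assms]] show ?thesis by simp
qed

lemma continuous_on_minv:
  fixes f :: "'a::topological_space \<Rightarrow> 'e"
  assumes "continuous_on S f"
  shows "continuous_on S (\<lambda>x. minv (f x))"
  by (rule continuous_on_compose2[OF smooth_on_continuous[OF smooth_on_minv[OF open_UNIV smooth_on_id]] assms]) simp

lemma mul_has_derivative: "(mul x has_derivative shear (x \<bullet> e 0)) (at y)"
proof -
  have "((\<lambda>y. x + shear (x \<bullet> e 0) y) has_derivative (\<lambda>w. 0 + shear (x \<bullet> e 0) w)) (at y)"
    by (intro has_derivative_add has_derivative_const bounded_linear_imp_has_derivative bounded_linear_shear)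
  then show ?thesis by (simp add: mul_def[abs_def])
qed

end

section \<open>Closed one-forms on a ball\<close>

text \<open>A product rule that requires derivatives of \<open>L\<close> only for each fixed
  argument \<open>w\<close>, not of \<open>L\<close> as an operator-valued map; finite dimension
  closes the gap through a basis expansion.\<close>

lemma has_derivative_linear_family:
  fixes L :: "'a::euclidean_space \<Rightarrow> 'a \<Rightarrow> 'b::real_normed_vector"
  assumes S: "open S" "x0 \<in> S" and lin: "\<And>x. x \<in> S \<Longrightarrow> linear (L x)"
    and d: "\<And>w. ((\<lambda>x. L x w) has_derivative L' w) (at x0)" and W: "(W has_derivative W') (at x0)"
  shows "((\<lambda>x. L x (W x)) has_derivative (\<lambda>h. L' (W x0) h + L x0 (W' h))) (at x0)"
proof -
  have eq: "L x w = (\<Sum>b\<in>Basis. (w \<bullet> b) *\<^sub>R L x b)" if "x \<in> S" for x w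
  proof -
    have "L x (\<Sum>b\<in>Basis. (w \<bullet> b) *\<^sub>R b) = (\<Sum>b\<in>Basis. (w \<bullet> b) *\<^sub>R L x b)"
      using lin[OF that] by (simp add: linear_sum linear_scale)
    then show ?thesis by (simp add: euclidean_representation)
  qed
  have "((\<lambda>x. \<Sum>b\<in>Basis. (w \<bullet> b) *\<^sub>R L x b) has_derivative (\<lambda>h. \<Sum>b\<in>Basis. (w \<bullet> b) *\<^sub>R L' b h)) (at x0)" for w
    by (intro has_derivative_sum has_derivative_scaleR_right d)
  then have "((\<lambda>x. L x w) has_derivative (\<lambda>h. \<Sum>b\<in>Basis. (w \<bullet> b) *\<^sub>R L' b h)) (at x0)" for w
    by (rule has_derivative_transform_within_open[OF _ S]) (simp add: eq[symmetric])
  then have L': "L' w = (\<lambda>h. \<Sum>b\<in>Basis. (w \<bullet> b) *\<^sub>R L' b h)" for w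
    using has_derivative_unique[OF d] by blast
  have "((\<lambda>x. \<Sum>b\<in>Basis. (W x \<bullet> b) *\<^sub>R L x b) has_derivative
      (\<lambda>h. \<Sum>b\<in>Basis. (W x0 \<bullet> b) *\<^sub>R L' b h + (W' h \<bullet> b) *\<^sub>R L x0 b)) (at x0)"
    by (intro has_derivative_sum has_derivative_scaleR d has_derivative_inner_left W)
  moreover have "(\<Sum>b\<in>Basis. (W x0 \<bullet> b) *\<^sub>R L' b h + (W' h \<bullet> b) *\<^sub>R L x0 b) = L' (W x0) h + L x0 (W' h)" for h
    unfolding L'[of "W x0"] eq[OF S(2), of "W' h"] by (simp add: sum.distrib)
  ultimately have "((\<lambda>x. \<Sum>b\<in>Basis. (W x \<bullet> b) *\<^sub>R L x b) has_derivative (\<lambda>h. L' (W x0) h + L x0 (W' h))) (at x0)"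
    by simp
  then show ?thesis by (rule has_derivative_transform_within_open[OF _ S]) (simp add: eq[symmetric])
qed

text \<open>The primitive is the integral of \<beta> along the segment from \<open>p\<close> to
  \<open>x\<close>. Differentiation under the integral sign and closedness turn the integrand into a
  total derivative in the segment parameter.\<close>

lemma Poincare_ball:
  fixes \<beta> :: "'a::euclidean_space \<Rightarrow> 'a \<Rightarrow> real"
  assumes r: "r > 0" and lin: "\<And>x. x \<in> ball p r \<Longrightarrow> linear (\<beta> x)"
    and sm: "\<And>w. smooth_on (ball p r) (\<lambda>x. \<beta> x w)"
    and closed: "\<And>x v w. x \<in> ball p r \<Longrightarrow>
      frechet_derivative (\<lambda>x. \<beta> x w) (at x) v = frechet_derivative (\<lambda>x. \<beta> x v) (at x) w"
  obtains H where "H p = 0" "\<And>x. x \<in> ball p r \<Longrightarrow> (H has_derivative \<beta> x) (at x)"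
    "smooth_on (ball p r) H"
proof -
  let ?B = "ball p r"
  define c where "c = (\<lambda>x t. p + t *\<^sub>R (x - p))"
  define D where "D = (\<lambda>w x. frechet_derivative (\<lambda>x. \<beta> x w) (at x))"
  have c: "c x t \<in> ?B" if "x \<in> ?B" "t \<in> cbox 0 1" for x t
  proof -
    have "norm (t *\<^sub>R (x - p)) \<le> norm (x - p)" using that(2) by (simp add: mult_left_le_one_le)
    then show ?thesis using that(1) unfolding c_def by (auto simp: dist_norm norm_minus_commute)
  qed
  have D: "((\<lambda>x. \<beta> x w) has_derivative D w x) (at x)" if "x \<in> ?B" for w x
    unfolding D_def using smooth_on_has_derivative[OF sm that] .
  have linD: "linear (D w x)" if "x \<in> ?B" for w x using D[OF that] has_derivative_linear by blast
  have bexp: "\<beta> x w = (\<Sum>b\<in>Basis. (w \<bullet> b) * \<beta> x b)" if "x \<in> ?B" for x w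
  proof -
    have "\<beta> x (\<Sum>b\<in>Basis. (w \<bullet> b) *\<^sub>R b) = (\<Sum>b\<in>Basis. (w \<bullet> b) * \<beta> x b)"
      using lin[OF that] by (simp add: linear_sum linear_scale)
    then show ?thesis by (simp add: euclidean_representation)
  qed
  have Dexp: "D w x v = (\<Sum>b\<in>Basis. (v \<bullet> b) * D w x b)" if "x \<in> ?B" for x v w
  proof -
    have "D w x (\<Sum>b\<in>Basis. (v \<bullet> b) *\<^sub>R b) = (\<Sum>b\<in>Basis. (v \<bullet> b) * D w x b)"
      using linD[OF that] by (simp add: linear_sum linear_scale)
    then show ?thesis by (simp add: euclidean_representation)
  qed
  have cc: "continuous_on (?B \<times> cbox 0 1) (\<lambda>z. c (fst z) (snd z))"
    unfolding c_def by (intro continuous_intros)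
  have cim: "(\<lambda>z. c (fst z) (snd z)) ` (?B \<times> cbox 0 1) \<subseteq> ?B" using c by auto
  have cb: "continuous_on (?B \<times> cbox 0 1) (\<lambda>z. \<beta> (c (fst z) (snd z)) w)" for w
    by (rule continuous_on_compose2[OF smooth_on_continuous[OF sm] cc cim])
  have cD: "continuous_on (?B \<times> cbox 0 1) (\<lambda>z. D w (c (fst z) (snd z)) v)" for v w
    unfolding D_def
    by (rule continuous_on_compose2[OF smooth_on_continuous[OF smooth_on_frechet_derivative[OF sm]] cc cim])
  define f where "f = (\<lambda>x t. \<beta> (c x t) (x - p))"
  define f' where "f' = (\<lambda>x t w. t * D w (c x t) (x - p) + \<beta> (c x t) w)"
  have f': "((\<lambda>x. f x t) has_derivative f' x t) (at x)" if x: "x \<in> ?B" and t: "t \<in> cbox 0 1" for x t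
  proof -
    note y = c[OF x t]
    have ct: "((\<lambda>x. c x t) has_derivative (\<lambda>h. t *\<^sub>R h)) (at x)"
      unfolding c_def by (auto intro!: derivative_eq_intros)
    have bw: "((\<lambda>x. \<beta> (c x t) w) has_derivative (\<lambda>h. D w (c x t) (t *\<^sub>R h))) (at x)" for w
      using has_derivative_compose[OF ct D[OF y]] .
    have Wd: "((\<lambda>x. x - p) has_derivative (\<lambda>h. h)) (at x)" by (auto intro!: derivative_eq_intros)
    have op: "open ((\<lambda>x. c x t) -` ?B)"
      by (intro open_vimage) (auto simp: c_def intro!: continuous_intros)
    have "((\<lambda>x. \<beta> (c x t) (x - p)) has_derivative (\<lambda>h. D (x - p) (c x t) (t *\<^sub>R h) + \<beta> (c x t) h)) (at x)"
      by (rule has_derivative_linear_family[OF op _ _ bw Wd]) (use y lin in auto)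
    \<comment> \<open>Closedness enters here: it exchanges the direction \<open>h\<close> of
      differentiation with the direction \<open>x - p\<close> of the segment.\<close>
    moreover have "D (x - p) (c x t) (t *\<^sub>R h) = t * D h (c x t) (x - p)" for h
      using linear_scale[OF linD[OF y]] closed[OF y] unfolding D_def by simp
    ultimately show ?thesis unfolding f_def f'_def by simp
  qed
  have blf: "bounded_linear (f' x t)" if "x \<in> ?B" "t \<in> cbox 0 1" for x t
    using f'[OF that] has_derivative_bounded_linear by blast
  define F' where "F' = (\<lambda>x t. Blinfun (f' x t))"
  have F': "blinfun_apply (F' x t) = f' x t" if "x \<in> ?B" "t \<in> cbox 0 1" for x t
    unfolding F'_def using blf[OF that] by (simp add: bounded_linear_Blinfun_apply)
  have contF: "continuous_on (?B \<times> cbox 0 1) (\<lambda>(x, t). F' x t)"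
  proof (rule continuous_on_blinfun_componentwise)
    fix i :: 'a assume "i \<in> Basis"
    have "continuous_on (?B \<times> cbox 0 1)
        (\<lambda>z. snd z * (\<Sum>b\<in>Basis. ((fst z - p) \<bullet> b) * D i (c (fst z) (snd z)) b) + \<beta> (c (fst z) (snd z)) i)"
      by (intro continuous_on_add continuous_on_mult continuous_on_sum cb cD) (intro continuous_intros)+
    then show "continuous_on (?B \<times> cbox 0 1) (\<lambda>z. blinfun_apply (case z of (x, t) \<Rightarrow> F' x t) i)"
      by (rule continuous_on_eq) (auto simp: F' f'_def Dexp[OF c, symmetric] split: prod.splits)
  qed
  define H where "H = (\<lambda>x. integral (cbox 0 1) (f x))"
  have px: "continuous_on (cbox 0 1 :: real set) (Pair x)" "Pair x ` cbox 0 1 \<subseteq> ?B \<times> cbox 0 1" if "x \<in> ?B" for x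
    using that by (auto intro!: continuous_intros)
  have contf: "continuous_on (cbox 0 1) (f x)" if "x \<in> ?B" for x
  proof -
    have "continuous_on (cbox 0 1) (\<lambda>t. \<Sum>b\<in>Basis. ((x - p) \<bullet> b) * \<beta> (c x t) b)"
      using continuous_on_compose2[OF cb px[OF that]]
      by (intro continuous_on_sum continuous_on_mult continuous_on_const) simp
    then show ?thesis
      by (rule continuous_on_eq) (simp add: f_def bexp[OF c[OF that], symmetric])
  qed
  have HD: "(H has_derivative \<beta> x) (at x)" if x: "x \<in> ?B" for x
  proof -
    have 0: "((\<lambda>x. f x t) has_derivative blinfun_apply (F' x t)) (at x within ?B)"
      if "x \<in> ?B" "t \<in> cbox 0 1" for x t
      using has_derivative_at_withinI[OF f'[OF that]] by (simp only: F'[OF that])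
    have "f x integrable_on cbox 0 1" if "x \<in> ?B" for x
      using contf[OF that] by (rule integrable_continuous)
    from leibniz_rule[OF 0 this contF x convex_ball]
    have "((\<lambda>x. integral (cbox 0 1) (f x)) has_derivative blinfun_apply (integral (cbox 0 1) (F' x))) (at x within ?B)" .
    then have 1: "(H has_derivative blinfun_apply (integral (cbox 0 1) (F' x))) (at x)"
      by (simp only: H_def at_within_open[OF x open_ball])
    have "blinfun_apply (integral (cbox 0 1) (F' x)) w = \<beta> x w" for w
    proof -
      have "continuous_on (cbox 0 1) (F' x)"
        using continuous_on_compose2[OF contF px[OF x]] by simp
      then have "F' x integrable_on cbox 0 1" by (rule integrable_continuous)
      then have "blinfun_apply (integral (cbox 0 1) (F' x)) w = integral (cbox 0 1) (\<lambda>t. F' x t w)"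
        by (rule blinfun_apply_integral)
      also have "\<dots> = integral {0..1} (\<lambda>t. f' x t w)"
        unfolding cbox_interval by (rule Henstock_Kurzweil_Integration.integral_cong) (simp add: F'[OF x])
      also have "\<dots> = \<beta> x w"
      proof -
        \<comment> \<open>The antiderivative of the integrand is
          \<open>t * \<beta> (c x t) w\<close>, which is 0 at \<open>t = 0\<close> and
          \<open>\<beta> x w\<close> at \<open>t = 1\<close>.\<close>
        have "((\<lambda>t. f' x t w) has_integral (1 * \<beta> (c x 1) w - 0 * \<beta> (c x 0) w)) {0..1}"
        proof (rule fundamental_theorem_of_calculus)
          fix t :: real assume t: "t \<in> {0..1}"
          then have y: "c x t \<in> ?B" using c[OF x] by simp
          have "((\<lambda>t. c x t) has_derivative (\<lambda>h. h *\<^sub>R (x - p))) (at t)"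
            unfolding c_def by (auto intro!: derivative_eq_intros)
          from has_derivative_compose[OF this D[OF y]]
          have "((\<lambda>t. \<beta> (c x t) w) has_derivative (\<lambda>h. D w (c x t) (h *\<^sub>R (x - p)))) (at t)" .
          then have "((\<lambda>t. t * \<beta> (c x t) w) has_derivative
              (\<lambda>h. t * D w (c x t) (h *\<^sub>R (x - p)) + h * \<beta> (c x t) w)) (at t)"
            by (auto intro!: derivative_eq_intros)
          then have "((\<lambda>t. t * \<beta> (c x t) w) has_derivative (\<lambda>h. h *\<^sub>R f' x t w)) (at t)"
            unfolding f'_def linear_scale[OF linD[OF y]] by (simp add: algebra_simps)
          then show "((\<lambda>t. t * \<beta> (c x t) w) has_vector_derivative f' x t w) (at t within {0..1})"
            unfolding has_vector_derivative_def using has_derivative_at_withinI by blast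
        qed simp
        then show ?thesis by (simp add: c_def integral_unique)
      qed
      finally show ?thesis .
    qed
    then have "blinfun_apply (integral (cbox 0 1) (F' x)) = \<beta> x" by blast
    with 1 show ?thesis by simp
  qed
  show thesis
  proof
    have "f p t = 0" if "t \<in> cbox 0 1" for t
      using linear_0[OF lin, of "c p t"] c[of p t] r that unfolding f_def by simp
    then show "H p = 0" unfolding H_def
      by (metis Henstock_Kurzweil_Integration.integral_cong integral_0)
    show "smooth_on ?B H" by (rule smooth_onI_derivative[OF _ HD sm]) auto
  qed (rule HD)
qed

section \<open>Left-invariant frames and the Maurer--Cartan form in a chart\<close>

lemma has_derivative_snd_slice:
  fixes H :: "'a::euclidean_space \<times> 'b::euclidean_space \<Rightarrow> 'c::real_normed_vector"
  assumes "smooth_on O' H" "(x, y) \<in> O'"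
  shows "((\<lambda>y. H (x, y)) has_derivative (\<lambda>v. frechet_derivative H (at (x, y)) (0, v))) (at y)"
proof -
  have "((\<lambda>y. (x, y)) has_derivative (\<lambda>v. (0, v))) (at y)" by (auto intro!: derivative_eq_intros)
  from has_derivative_compose[OF this smooth_on_has_derivative[OF assms]] show ?thesis .
qed

context lie_grp_chart
begin

definition mu :: "'e \<times> 'e \<Rightarrow> 'e" where "mu z = \<phi> (\<tau> (fst z) + \<tau> (snd z))"

definition mu_dom :: "('e \<times> 'e) set" where
  "mu_dom = map_prod \<phi> \<phi> ` ((U \<times> U) \<inter> (\<lambda>(x, y). x + y) -` U)"

lemma mu_dom_iff: "(x, y) \<in> mu_dom \<longleftrightarrow> x \<in> \<phi> ` U \<and> y \<in> \<phi> ` U \<and> \<tau> x + \<tau> y \<in> U"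
  unfolding mu_dom_def using \<tau>_\<phi> by (auto simp: image_iff) force

lemma product_chart: "(U \<times> U, map_prod \<phi> \<phi>) \<in> product_atlas A A"
  using chart unfolding product_atlas_def by blast

lemma open_mu_dom: "open mu_dom" unfolding mu_dom_def
proof (rule chartedD(4)[OF charted2 product_chart])
  have "open ((\<lambda>(x, y). x + y) -` U)"
    by (rule open_vimage[OF chart_facts(1) smooth_map_continuous[OF smooth_plus]])
  then show "open ((U \<times> U) \<inter> (\<lambda>(x, y). x + y) -` U)"
    using chart_facts(1) by (intro open_Int open_Times)
qed auto

lemma smooth_mu: "smooth_on mu_dom mu"
proof -
  have inj: "inj_on (map_prod \<phi> \<phi>) (U \<times> U)" using chart_facts by (simp add: map_prod_inj_on)
  have inv: "inv_into (U \<times> U) (map_prod \<phi> \<phi>) z = (\<tau> (fst z), \<tau> (snd z))" if z: "z \<in> mu_dom" for z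
  proof -
    obtain a c where ac: "a \<in> U" "c \<in> U" "z = (\<phi> a, \<phi> c)" using z unfolding mu_dom_def by auto
    have "inv_into (U \<times> U) (map_prod \<phi> \<phi>) (map_prod \<phi> \<phi> (a, c)) = (a, c)"
      by (rule inv_into_f_f[OF inj]) (use ac in simp)
    then show ?thesis using ac by simp
  qed
  have "smooth_on mu_dom (\<lambda>z. \<phi> (case inv_into (U \<times> U) (map_prod \<phi> \<phi>) z of (x, y) \<Rightarrow> x + y))"
    using smooth_mapD[OF smooth_plus product_chart chart] unfolding mu_dom_def .
  then show ?thesis
    by (rule iffD1[OF smooth_on_cong_open[OF open_mu_dom], rotated]) (simp add: inv mu_def)
qed

definition iota :: "'e \<Rightarrow> 'e" where "iota x = \<phi> (- \<tau> x)"

definition iota_dom :: "'e set" where "iota_dom = \<phi> ` (U \<inter> uminus -` U)"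

lemma iota_dom_iff: "x \<in> iota_dom \<longleftrightarrow> x \<in> \<phi> ` U \<and> - \<tau> x \<in> U"
  unfolding iota_dom_def using \<tau>_\<phi> by (auto simp: image_iff)

lemma open_iota_dom: "open iota_dom"
proof -
  have "open (uminus -` U)"
    by (rule open_vimage[OF chart_facts(1) smooth_map_continuous[OF smooth_uminus]])
  then show ?thesis unfolding iota_dom_def using chart_facts(4)[of "U \<inter> uminus -` U"] chart_facts(1) by blast
qed

lemma smooth_iota: "smooth_on iota_dom iota"
  using smooth_mapD[OF smooth_uminus chart chart] unfolding iota_dom_def iota_def \<tau>_def
  by (simp add: vimage_def)

lemma p0_iota_dom [simp]: "p0 \<in> iota_dom" using iota_dom_iff zero_in by simp

lemma mu_p0_right [simp]: "x \<in> \<phi> ` U \<Longrightarrow> mu (x, p0) = x"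
  and mu_p0_left [simp]: "x \<in> \<phi> ` U \<Longrightarrow> mu (p0, x) = x"
  by (simp_all add: mu_def del: image_eqI)

lemma p0_mu_dom [simp]: "x \<in> \<phi> ` U \<Longrightarrow> (x, p0) \<in> mu_dom" "x \<in> \<phi> ` U \<Longrightarrow> (p0, x) \<in> mu_dom"
  by (simp_all add: mu_dom_iff)

text \<open>\<open>frame x\<close> is the differential of \<open>y \<mapsto> x y\<close> at the neutral element, \<open>mc x\<close> that of
  \<open>y \<mapsto> x\<^sup>- y\<close> at \<open>x\<close>.\<close>

definition frame :: "'e \<Rightarrow> 'e \<Rightarrow> 'e" where
  "frame x v = frechet_derivative mu (at (x, p0)) (0, v)"

definition mc :: "'e \<Rightarrow> 'e \<Rightarrow> 'e" where
  "mc x w = frechet_derivative mu (at (iota x, x)) (0, w)"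

lemma frame_has_derivative: "x \<in> \<phi> ` U \<Longrightarrow> ((\<lambda>y. mu (x, y)) has_derivative frame x) (at p0)"
  using has_derivative_snd_slice[OF smooth_mu p0_mu_dom(1)] by (simp add: frame_def[abs_def])

lemma iota_pair: "x \<in> iota_dom \<Longrightarrow> (iota x, x) \<in> mu_dom" "x \<in> iota_dom \<Longrightarrow> mu (iota x, x) = p0"
  using zero_in by (auto simp: mu_dom_iff iota_dom_iff iota_def mu_def p0_def)

lemma mc_has_derivative: "x \<in> iota_dom \<Longrightarrow> ((\<lambda>y. mu (iota x, y)) has_derivative mc x) (at x)"
  using has_derivative_snd_slice[OF smooth_mu iota_pair(1)] by (simp add: mc_def[abs_def])

lemma linear_frame: "x \<in> \<phi> ` U \<Longrightarrow> linear (frame x)"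
  using frame_has_derivative has_derivative_linear by blast

lemma linear_mc: "x \<in> iota_dom \<Longrightarrow> linear (mc x)"
  using mc_has_derivative has_derivative_linear by blast

lemma smooth_frame: "smooth_on (\<phi> ` U) (\<lambda>x. frame x v)"
proof -
  have "smooth_on (\<phi> ` U) (\<lambda>x. (\<lambda>z. frechet_derivative mu (at z) (0, v)) (x, p0))"
    by (rule smooth_on_compose[OF open_image open_mu_dom _ smooth_on_frechet_derivative[OF smooth_mu]])
      (auto intro!: smooth_on_Pair open_image simp: mu_dom_iff)
  then show ?thesis by (simp add: frame_def)
qed

lemma smooth_mc: "smooth_on iota_dom (\<lambda>x. mc x w)"
proof -
  have "smooth_on iota_dom (\<lambda>x. (\<lambda>z. frechet_derivative mu (at z) (0, w)) (iota x, x))"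
    by (rule smooth_on_compose[OF open_iota_dom open_mu_dom _ smooth_on_frechet_derivative[OF smooth_mu]])
      (auto intro!: smooth_on_Pair open_iota_dom smooth_iota iota_pair)
  then show ?thesis by (simp add: mc_def)
qed

lemma mu_assoc:
  assumes "(a, x) \<in> mu_dom" "(x, y) \<in> mu_dom" "(a, mu (x, y)) \<in> mu_dom"
  shows "mu (a, mu (x, y)) = mu (mu (a, x), y)"
  using assms by (simp add: mu_dom_iff mu_def add.assoc)

text \<open>Left invariance of the frame, obtained by differentiating the associative law in its
  last argument at the neutral element.\<close>

lemma mu_frame:
  assumes ax: "(a, x) \<in> mu_dom" and D: "((\<lambda>y. mu (a, y)) has_derivative D) (at x)"
  shows "D (frame x v) = frame (mu (a, x)) v"
proof -
  have x: "x \<in> \<phi> ` U" and m: "mu (a, x) \<in> \<phi> ` U" using ax by (auto simp: mu_dom_iff mu_def)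
  have "((\<lambda>y. mu (a, mu (x, y))) has_derivative (\<lambda>v. D (frame x v))) (at p0)"
    by (rule has_derivative_compose[OF frame_has_derivative[OF x]]) (use D x in simp)
  moreover
  \<comment> \<open>A neighbourhood of \<open>p0\<close> on which every product in the associative
    law stays inside the chart.\<close>
  define S where "S = {y. (x, y) \<in> mu_dom} \<inter> {y\<in>{y. (x, y) \<in> mu_dom}. (a, mu (x, y)) \<in> mu_dom}"
  have o1: "open {y. (x, y) \<in> mu_dom}"
    using open_vimage[OF open_mu_dom, of "Pair x"] by (simp add: vimage_def continuous_on_Pair)
  have c1: "continuous_on {y. (x, y) \<in> mu_dom} (\<lambda>y. (a, mu (x, y)))"
    by (intro continuous_intros continuous_on_compose2[OF smooth_on_continuous[OF smooth_mu]]) auto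
  have "open S" unfolding S_def
    using continuous_open_preimage[OF c1 o1 open_mu_dom] o1 by (auto simp: vimage_def Int_def)
  moreover have "p0 \<in> S" using ax x unfolding S_def by simp
  ultimately have "((\<lambda>y. mu (mu (a, x), y)) has_derivative (\<lambda>v. D (frame x v))) (at p0)"
    by (rule has_derivative_transform_within_open) (use ax mu_assoc in \<open>auto simp: S_def\<close>)
  from has_derivative_unique[OF this frame_has_derivative[OF m]] show ?thesis by metis
qed

lemma frame_p0 [simp]: "frame p0 v = v"
proof -
  have "((\<lambda>y. y) has_derivative frame p0) (at p0)"
    by (rule has_derivative_transform_within_open[OF frame_has_derivative[OF p0_in] open_image p0_in]) simp
  from has_derivative_unique[OF this has_derivative_ident] show ?thesis by metis
qed

text \<open>Left invariance applied with the inverse of \<open>x\<close> as left factor, which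
  carries the frame at \<open>x\<close> to the identity at \<open>p0\<close>.\<close>

lemma mc_frame: "x \<in> iota_dom \<Longrightarrow> mc x (frame x v) = v"
  using mu_frame[OF iota_pair(1) mc_has_derivative, of x v] by (simp add: iota_pair)

lemma frame_mc:
  assumes "x \<in> iota_dom"
  shows "frame x (mc x w) = w"
proof -
  have x: "x \<in> \<phi> ` U" using assms iota_dom_iff by blast
  have "inj (frame x)" by (metis assms injI mc_frame)
  then have "surj (frame x)" using linear_injective_imp_surjective[OF linear_frame[OF x]] by blast
  then show ?thesis by (metis assms mc_frame surjD)
qed

lemma lvf_chart:
  assumes h: "smooth_fun A h" and x: "x \<in> \<phi> ` U" and D: "((\<lambda>y. h (\<tau> y)) has_derivative D) (at x)"
  shows "lvf v h (\<tau> x) = D (frame x v)"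
proof (rule lvf_eqI[OF h])
  have 1: "((\<lambda>y. h (\<tau> (mu (x, y)))) has_derivative (\<lambda>v. D (frame x v))) (at p0)"
    by (rule has_derivative_compose[OF frame_has_derivative[OF x]]) (use D x in simp)
  have o: "open {y. (x, y) \<in> mu_dom}"
    using open_vimage[OF open_mu_dom, of "Pair x"] by (simp add: vimage_def continuous_on_Pair)
  show "((\<lambda>y. h (\<tau> x + \<tau> y)) has_derivative (\<lambda>v. D (frame x v))) (at p0)"
    by (rule has_derivative_transform_within_open[OF 1 o])
      (use x in \<open>auto simp: mu_def mu_dom_iff\<close>)
qed

text \<open>Applied to the cutoff coordinates, a field yields the components of its frame vector,
  and a second field yields their directional derivatives. The algebraic bracket of derivations thus
  becomes the usual commutator of vector fields, valid on the ball where the cutoffs are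
  linear.\<close>

lemma frame_bracket:
  obtains r where "r > 0" "ball p0 r \<subseteq> \<phi> ` U"
    "\<And>v w u x. vf_bracket (lvf v) (lvf w) = lvf u \<Longrightarrow> x \<in> ball p0 r \<Longrightarrow>
      frechet_derivative (\<lambda>x. frame x w) (at x) (frame x v) -
      frechet_derivative (\<lambda>x. frame x v) (at x) (frame x w) = frame x u"
proof -
  obtain r C where C: "r > 0" "ball p0 r \<subseteq> \<phi> ` U" "\<And>w. smooth_fun A (C w)"
    "\<And>w y. y \<in> ball p0 r \<Longrightarrow> C w (\<tau> y) = y \<bullet> w" using cutoff_coordinates by blast
  have 1: "lvf v (C d) (\<tau> x) = frame x v \<bullet> d" if x: "x \<in> ball p0 r" for v d x
  proof (rule lvf_chart[OF C(3)])
    show "x \<in> \<phi> ` U" using C x by blast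
    have "((\<lambda>y. y \<bullet> d) has_derivative (\<lambda>w. w \<bullet> d)) (at x)" by (auto intro!: derivative_eq_intros)
    then show "((\<lambda>y. C d (\<tau> y)) has_derivative (\<lambda>w. w \<bullet> d)) (at x)"
      by (rule has_derivative_transform_within_open[OF _ open_ball x]) (simp add: C(4))
  qed
  have 2: "lvf v (lvf w (C d)) (\<tau> x) = frechet_derivative (\<lambda>x. frame x w) (at x) (frame x v) \<bullet> d"
    if x: "x \<in> ball p0 r" for v w d x
  proof (rule lvf_chart[OF smooth_lvf[OF C(3)]])
    show xU: "x \<in> \<phi> ` U" using C x by blast
    have "((\<lambda>y. frame y w \<bullet> d) has_derivative (\<lambda>h. frechet_derivative (\<lambda>x. frame x w) (at x) h \<bullet> d)) (at x)"
      by (intro has_derivative_inner_left smooth_on_has_derivative[OF smooth_frame xU])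
    then show "((\<lambda>y. lvf w (C d) (\<tau> y)) has_derivative
        (\<lambda>h. frechet_derivative (\<lambda>x. frame x w) (at x) h \<bullet> d)) (at x)"
      by (rule has_derivative_transform_within_open[OF _ open_ball x]) (simp add: 1)
  qed
  show thesis
  proof
    fix v w u x assume b: "vf_bracket (lvf v) (lvf w) = lvf u" and x: "x \<in> ball p0 r"
    have "(frechet_derivative (\<lambda>x. frame x w) (at x) (frame x v) -
      frechet_derivative (\<lambda>x. frame x v) (at x) (frame x w)) \<bullet> d = frame x u \<bullet> d" for d
    proof -
      have "vf_bracket (lvf v) (lvf w) (C d) (\<tau> x) = lvf u (C d) (\<tau> x)" using b by simp
      then show ?thesis unfolding vf_bracket_def 1[OF x] 2[OF x] by (simp add: inner_diff_left)
    qed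
    then show "frechet_derivative (\<lambda>x. frame x w) (at x) (frame x v) -
      frechet_derivative (\<lambda>x. frame x v) (at x) (frame x w) = frame x u"
      by (metis vector_eq_rdot)
  qed (use C in auto)
qed

end

lemma (in filiform_model) coord_expand: "(\<Sum>j\<le>s. (v \<bullet> e j) *\<^sub>R e j) = v"
  by (rule coord_eqI) (simp add: coord_sum)

section \<open>Local isomorphism with the model group\<close>

text \<open>\<open>\<kappa>\<close> identifies \<open>e 0, \<dots>, e s\<close> with the values of \<open>X 0, \<dots>, X s\<close> at the neutral element.\<close>

locale filiform_chart = lie_grp_chart A U \<phi> + filiform_model e s
  for A :: "('g::{topological_group_add,t2_space,second_countable_topology},
      'e::euclidean_space) chart set"
    and U :: "'g set" and \<phi> :: "'g \<Rightarrow> 'e" and e :: "nat \<Rightarrow> 'e" and s :: nat +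
  fixes X :: "nat \<Rightarrow> 'g vfield" and \<kappa> :: "'e \<Rightarrow> 'e"
  assumes linear_\<kappa>: "linear \<kappa>" and bij_\<kappa>: "bij \<kappa>"
    and lvf_\<kappa>: "\<And>j. j \<le> s \<Longrightarrow> lvf (\<kappa> (e j)) = X j"
    and bracket_0: "\<And>j. 2 \<le> j \<Longrightarrow> j \<le> s \<Longrightarrow> vf_bracket (X 0) (X (j - 1)) = X j"
    and bracket_0_s: "vf_bracket (X 0) (X s) = vf_zero"
    and bracket_pos: "\<And>i j. 1 \<le> i \<Longrightarrow> i \<le> s \<Longrightarrow> 1 \<le> j \<Longrightarrow> j \<le> s \<Longrightarrow> vf_bracket (X i) (X j) = vf_zero"
begin

definition MC :: "'e \<Rightarrow> 'e \<Rightarrow> 'e" where "MC x w = inv \<kappa> (mc x w)"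

lemma linear_inv_\<kappa>: "linear (inv \<kappa>)"
  using linear_\<kappa> bij_\<kappa> by (metis bij_betw_def inj_linear_imp_inv_linear)

lemma inv_\<kappa> [simp]: "inv \<kappa> (\<kappa> v) = v" "\<kappa> (inv \<kappa> v) = v"
  using bij_\<kappa> by (simp_all add: bij_is_inj bij_is_surj surj_f_inv_f)

lemma bounded_linear_\<kappa>: "bounded_linear \<kappa>" and bounded_linear_inv_\<kappa>: "bounded_linear (inv \<kappa>)"
  using linear_\<kappa> linear_inv_\<kappa> by (simp_all add: linear_conv_bounded_linear)

lemma linear_MC: "x \<in> iota_dom \<Longrightarrow> linear (MC x)"
  unfolding MC_def[abs_def] using linear_compose[OF linear_mc linear_inv_\<kappa>] by (simp add: comp_def)

lemma smooth_MC: "smooth_on iota_dom (\<lambda>x. MC x w)"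
  unfolding MC_def by (intro smooth_on_linear_compose[OF bounded_linear_inv_\<kappa>] open_iota_dom smooth_mc)

lemma MC_frame: "x \<in> iota_dom \<Longrightarrow> MC x (frame x (\<kappa> v)) = v"
  by (simp add: MC_def mc_frame)

lemma frame_MC: "x \<in> iota_dom \<Longrightarrow> frame x (\<kappa> (MC x w)) = w"
  by (simp add: MC_def frame_mc)

text \<open>The bracket of \<open>X 0\<close> with \<open>X j\<close> in coordinates. The value 0 at
  \<open>j = s\<close> encodes that \<open>X s\<close> is central.\<close>

definition br :: "nat \<Rightarrow> 'e" where "br j = (if j < s then e (Suc j) else 0)"

lemma lvf_0: "lvf 0 = vf_zero"
  using linear_0[OF lvf_linear] by (simp add: fun_eq_iff vf_zero_def)

lemma bracket_0_br: "1 \<le> j \<Longrightarrow> j \<le> s \<Longrightarrow> vf_bracket (lvf (\<kappa> (e 0))) (lvf (\<kappa> (e j))) = lvf (\<kappa> (br j))"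
  using bracket_0[of "Suc j"] bracket_0_s s_pos
  by (cases "j = s") (simp_all add: lvf_\<kappa> br_def linear_0[OF linear_\<kappa>] lvf_0)

lemma bracket_pos_br: "1 \<le> i \<Longrightarrow> i \<le> s \<Longrightarrow> 1 \<le> j \<Longrightarrow> j \<le> s \<Longrightarrow>
    vf_bracket (lvf (\<kappa> (e i))) (lvf (\<kappa> (e j))) = lvf (\<kappa> 0)"
  using bracket_pos by (simp add: lvf_\<kappa> linear_0[OF linear_\<kappa>] lvf_0)

text \<open>Cartan's formula on pairs of basis fields: \<open>closed_coeff r G\<close> says that the form
  \<open>w \<mapsto> G x \<bullet> MC x w\<close> is closed on the ball of radius \<open>r\<close>.\<close>

definition closed_coeff :: "real \<Rightarrow> ('e \<Rightarrow> 'e) \<Rightarrow> bool" where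
  "closed_coeff r G \<longleftrightarrow> smooth_on (ball p0 r) G \<and>
     (\<forall>x\<in>ball p0 r. \<forall>j\<in>{1..s}.
        (\<forall>i\<in>{1..s}. frechet_derivative G (at x) (frame x (\<kappa> (e i))) \<bullet> e j =
           frechet_derivative G (at x) (frame x (\<kappa> (e j))) \<bullet> e i) \<and>
        frechet_derivative G (at x) (frame x (\<kappa> (e 0))) \<bullet> e j -
          frechet_derivative G (at x) (frame x (\<kappa> (e j))) \<bullet> e 0 = G x \<bullet> br j)"

text \<open>On the invariant frame \<open>MC\<close> has constant values, so the exterior derivative
  of the form involves only derivatives of \<open>G\<close> and one bracket term, which cancel by
  \<open>closed_coeff\<close>. Closedness extends from pairs of frame vectors to all vectors by
  bilinearity, since the frame spans, and \<open>Poincare_ball\<close> applies.\<close>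

lemma MC_primitive:
  obtains r where "r > 0" "ball p0 r \<subseteq> iota_dom" "ball p0 r \<subseteq> \<phi> ` U"
    "\<And>G. closed_coeff r G \<Longrightarrow> \<exists>H. H p0 = 0 \<and> smooth_on (ball p0 r) H \<and>
        (\<forall>x\<in>ball p0 r. (H has_derivative (\<lambda>w. G x \<bullet> MC x w)) (at x))"
proof -
  obtain r1 where r1: "r1 > 0" "ball p0 r1 \<subseteq> \<phi> ` U"
    and fb: "\<And>v w u x. vf_bracket (lvf v) (lvf w) = lvf u \<Longrightarrow> x \<in> ball p0 r1 \<Longrightarrow>
      frechet_derivative (\<lambda>x. frame x w) (at x) (frame x v) -
      frechet_derivative (\<lambda>x. frame x v) (at x) (frame x w) = frame x u"
    using frame_bracket by blast
  obtain r2 where r2: "r2 > 0" "ball p0 r2 \<subseteq> iota_dom"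
    using open_iota_dom p0_iota_dom open_contains_ball by meson
  define r where "r = min r1 r2"
  have r: "r > 0" "ball p0 r \<subseteq> iota_dom" "ball p0 r \<subseteq> \<phi> ` U" "ball p0 r \<subseteq> ball p0 r1"
    unfolding r_def using r1 r2 by (auto simp: subset_iff)
  show thesis
  proof (rule that[OF r(1-3)])
    fix G :: "'e \<Rightarrow> 'e"
    assume "closed_coeff r G"
    then have G: "smooth_on (ball p0 r) G"
      and pos: "\<And>x i j. x \<in> ball p0 r \<Longrightarrow> 1 \<le> i \<Longrightarrow> i \<le> s \<Longrightarrow> 1 \<le> j \<Longrightarrow> j \<le> s \<Longrightarrow>
         frechet_derivative G (at x) (frame x (\<kappa> (e i))) \<bullet> e j = frechet_derivative G (at x) (frame x (\<kappa> (e j))) \<bullet> e i"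
      and zer: "\<And>x j. x \<in> ball p0 r \<Longrightarrow> 1 \<le> j \<Longrightarrow> j \<le> s \<Longrightarrow>
         frechet_derivative G (at x) (frame x (\<kappa> (e 0))) \<bullet> e j - frechet_derivative G (at x) (frame x (\<kappa> (e j))) \<bullet> e 0 = G x \<bullet> br j"
      unfolding closed_coeff_def by auto
    define \<beta> where "\<beta> = (\<lambda>x w. G x \<bullet> MC x w)"
    have lin: "linear (\<beta> x)" if "x \<in> ball p0 r" for x
      unfolding \<beta>_def using linear_MC[of x] r(2) that
      by (intro linearI) (auto simp: linear_add linear_scale inner_add_right)
    have sm: "smooth_on (ball p0 r) (\<lambda>x. \<beta> x w)" for w
      unfolding \<beta>_def by (intro smooth_on_inner G smooth_on_subset[OF smooth_MC r(2)] open_ball)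
    define D\<beta> where "D\<beta> = (\<lambda>w x. frechet_derivative (\<lambda>x. \<beta> x w) (at x))"
    have D\<beta>: "((\<lambda>x. \<beta> x w) has_derivative D\<beta> w x) (at x)" if "x \<in> ball p0 r" for w x
      unfolding D\<beta>_def using smooth_on_has_derivative[OF sm that] .
    have basis: "D\<beta> (frame x (\<kappa> b)) x (frame x (\<kappa> a)) - D\<beta> (frame x (\<kappa> a)) x (frame x (\<kappa> b)) =
        frechet_derivative G (at x) (frame x (\<kappa> a)) \<bullet> b - frechet_derivative G (at x) (frame x (\<kappa> b)) \<bullet> a - G x \<bullet> c"
      if x: "x \<in> ball p0 r" and br: "vf_bracket (lvf (\<kappa> a)) (lvf (\<kappa> b)) = lvf (\<kappa> c)" for x a b c
    proof -
      have xU: "x \<in> \<phi> ` U" "x \<in> iota_dom" using r x by auto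
      define Df where "Df = (\<lambda>v. frechet_derivative (\<lambda>x. frame x v) (at x))"
      \<comment> \<open>By \<open>MC_frame\<close> the form takes the value
        \<open>G y \<bullet> b\<close> on the frame vector of \<open>b\<close>; both expressions are
        differentiated and compared.\<close>
      have one: "D\<beta> (frame x (\<kappa> b)) x h + \<beta> x (Df (\<kappa> b) h) = frechet_derivative G (at x) h \<bullet> b" for b h
      proof -
        have "((\<lambda>y. \<beta> y (frame y (\<kappa> b))) has_derivative (\<lambda>h. D\<beta> (frame x (\<kappa> b)) x h + \<beta> x (Df (\<kappa> b) h))) (at x)"
          unfolding Df_def
          by (rule has_derivative_linear_family[OF open_ball x lin D\<beta>[OF x] smooth_on_has_derivative[OF smooth_frame xU(1)]])
        then have p: "((\<lambda>y. G y \<bullet> b) has_derivative (\<lambda>h. D\<beta> (frame x (\<kappa> b)) x h + \<beta> x (Df (\<kappa> b) h))) (at x)"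
          by (rule has_derivative_transform_within_open[OF _ open_ball x]) (use r(2) in \<open>auto simp: \<beta>_def MC_frame\<close>)
        have q: "((\<lambda>y. G y \<bullet> b) has_derivative (\<lambda>h. frechet_derivative G (at x) h \<bullet> b)) (at x)"
          by (intro has_derivative_inner_left smooth_on_has_derivative[OF G x])
        show ?thesis using fun_cong[OF has_derivative_unique[OF p q], of h] by simp
      qed
      have d: "Df (\<kappa> b) (frame x (\<kappa> a)) - Df (\<kappa> a) (frame x (\<kappa> b)) = frame x (\<kappa> c)"
        unfolding Df_def using fb[OF br] r(4) x by blast
      have "\<beta> x (Df (\<kappa> b) (frame x (\<kappa> a))) - \<beta> x (Df (\<kappa> a) (frame x (\<kappa> b))) =
          \<beta> x (Df (\<kappa> b) (frame x (\<kappa> a)) - Df (\<kappa> a) (frame x (\<kappa> b)))"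
        by (rule linear_diff[OF lin[OF x], symmetric])
      also have "\<dots> = G x \<bullet> c" unfolding d by (simp add: \<beta>_def MC_frame xU(2))
      finally have "\<beta> x (Df (\<kappa> b) (frame x (\<kappa> a))) - \<beta> x (Df (\<kappa> a) (frame x (\<kappa> b))) = G x \<bullet> c" .
      then show ?thesis using one[of b "frame x (\<kappa> a)"] one[of a "frame x (\<kappa> b)"] by linarith
    qed
    have sym: "D\<beta> (frame x (\<kappa> (e j))) x (frame x (\<kappa> (e i))) = D\<beta> (frame x (\<kappa> (e i))) x (frame x (\<kappa> (e j)))"
      if x: "x \<in> ball p0 r" and ij: "i \<le> s" "j \<le> s" for x i j
    proof -
      have p: "D\<beta> (frame x (\<kappa> (e j))) x (frame x (\<kappa> (e i))) = D\<beta> (frame x (\<kappa> (e i))) x (frame x (\<kappa> (e j)))"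
        if "1 \<le> i" "i \<le> s" "1 \<le> j" "j \<le> s" for i j
        using basis[OF x bracket_pos_br[OF that]] pos[OF x that] by simp
      have z: "D\<beta> (frame x (\<kappa> (e j))) x (frame x (\<kappa> (e 0))) = D\<beta> (frame x (\<kappa> (e 0))) x (frame x (\<kappa> (e j)))"
        if "1 \<le> j" "j \<le> s" for j
        using basis[OF x bracket_0_br[OF that]] zer[OF x that] by simp
      consider "i = 0" "j = 0" | "i = 0" "1 \<le> j" | "1 \<le> i" "j = 0" | "1 \<le> i" "1 \<le> j" by linarith
      then show ?thesis using p[of i j] z[of i] z[of j] ij by cases auto
    qed
    have linD: "linear (D\<beta> w x)" if "x \<in> ball p0 r" for w x
      using D\<beta>[OF that] has_derivative_linear by blast
    \<comment> \<open>Linearity in the argument of the form, as opposed to the direction of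
      differentiation, is inherited from \<beta> through uniqueness of derivatives.\<close>
    have linD2: "linear (\<lambda>w. D\<beta> w x h)" if x: "x \<in> ball p0 r" for x h
    proof (rule linearI)
      show "D\<beta> (v + w) x h = D\<beta> v x h + D\<beta> w x h" for v w
      proof -
        have "((\<lambda>x. \<beta> x v + \<beta> x w) has_derivative (\<lambda>h. D\<beta> v x h + D\<beta> w x h)) (at x)"
          by (intro has_derivative_add D\<beta> x)
        then have "((\<lambda>x. \<beta> x (v + w)) has_derivative (\<lambda>h. D\<beta> v x h + D\<beta> w x h)) (at x)"
          by (rule has_derivative_transform_within_open[OF _ open_ball x]) (simp add: linear_add[OF lin])
        from has_derivative_unique[OF this D\<beta>[OF x]] show ?thesis by metis
      qed
      show "D\<beta> (c *\<^sub>R v) x h = c *\<^sub>R D\<beta> v x h" for c v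
      proof -
        have "((\<lambda>x. c * \<beta> x v) has_derivative (\<lambda>h. c * D\<beta> v x h)) (at x)"
          by (intro has_derivative_mult_right D\<beta> x)
        then have "((\<lambda>x. \<beta> x (c *\<^sub>R v)) has_derivative (\<lambda>h. c * D\<beta> v x h)) (at x)"
          by (rule has_derivative_transform_within_open[OF _ open_ball x]) (simp add: linear_scale[OF lin])
        from has_derivative_unique[OF this D\<beta>[OF x]] show ?thesis by (metis real_scaleR_def)
      qed
    qed
    have closed: "D\<beta> w x v = D\<beta> v x w" if x: "x \<in> ball p0 r" for x v w
    proof -
      have xU: "x \<in> \<phi> ` U" "x \<in> iota_dom" using r x by auto
      have ex: "w = (\<Sum>j\<le>s. (MC x w \<bullet> e j) *\<^sub>R frame x (\<kappa> (e j)))" for w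
      proof -
        have "frame x (\<kappa> (\<Sum>j\<le>s. (MC x w \<bullet> e j) *\<^sub>R e j)) = (\<Sum>j\<le>s. (MC x w \<bullet> e j) *\<^sub>R frame x (\<kappa> (e j)))"
          by (simp add: linear_sum[OF linear_\<kappa>] linear_scale[OF linear_\<kappa>]
              linear_sum[OF linear_frame[OF xU(1)]] linear_scale[OF linear_frame[OF xU(1)]])
        moreover have "(\<Sum>j\<le>s. (MC x w \<bullet> e j) *\<^sub>R e j) = MC x w"
          by (rule coord_expand)
        ultimately show ?thesis using frame_MC[OF xU(2)] by metis
      qed
      define a where "a = (\<lambda>j. MC x v \<bullet> e j)"
      define b where "b = (\<lambda>j. MC x w \<bullet> e j)"
      define f where "f = (\<lambda>j. frame x (\<kappa> (e j)))"
      have v: "v = (\<Sum>j\<le>s. a j *\<^sub>R f j)" and w: "w = (\<Sum>j\<le>s. b j *\<^sub>R f j)"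
        unfolding a_def b_def f_def by (rule ex)+
      have exp: "D\<beta> (\<Sum>j\<le>s. b j *\<^sub>R f j) x (\<Sum>i\<le>s. a i *\<^sub>R f i) = (\<Sum>j\<le>s. \<Sum>i\<le>s. b j * (a i * D\<beta> (f j) x (f i)))" for a b
      proof -
        have 1: "D\<beta> (\<Sum>j\<le>s. b j *\<^sub>R f j) x h = (\<Sum>j\<le>s. b j * D\<beta> (f j) x h)" for h
          by (simp add: linear_sum[OF linD2[OF x]] linear_scale[OF linD2[OF x]])
        have 2: "D\<beta> v x (\<Sum>i\<le>s. a i *\<^sub>R f i) = (\<Sum>i\<le>s. a i * D\<beta> v x (f i))" for v
          by (simp add: linear_sum[OF linD[OF x]] linear_scale[OF linD[OF x]])
        show ?thesis unfolding 1 by (simp only: 2 sum_distrib_left)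
      qed
      have "D\<beta> w x v = (\<Sum>j\<le>s. \<Sum>i\<le>s. b j * (a i * D\<beta> (f j) x (f i)))"
        unfolding v w by (rule exp)
      also have "\<dots> = (\<Sum>i\<le>s. \<Sum>j\<le>s. a i * (b j * D\<beta> (f i) x (f j)))"
      proof (subst sum.swap, intro sum.cong refl)
        fix i j assume "i \<in> {..s}" "j \<in> {..s}"
        then show "b j * (a i * D\<beta> (f j) x (f i)) = a i * (b j * D\<beta> (f i) x (f j))"
          using sym[OF x, of i j] by (simp add: f_def)
      qed
      also have "\<dots> = D\<beta> v x w" unfolding v w by (rule exp[symmetric])
      finally show ?thesis .
    qed
    obtain H where "H p0 = 0" "\<And>x. x \<in> ball p0 r \<Longrightarrow> (H has_derivative \<beta> x) (at x)" "smooth_on (ball p0 r) H"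
      using Poincare_ball[OF r(1) lin sm closed[unfolded D\<beta>_def]] by metis
    then show "\<exists>H. H p0 = 0 \<and> smooth_on (ball p0 r) H \<and>
        (\<forall>x\<in>ball p0 r. (H has_derivative (\<lambda>w. G x \<bullet> MC x w)) (at x))"
      unfolding \<beta>_def by blast
  qed
qed

lemma divpow_has_derivative:
  "((\<lambda>t. divpow t n) has_real_derivative (if n = 0 then 0 else divpow t (n - 1))) (at t)"
proof (cases n)
  case (Suc m)
  have "((\<lambda>t. t ^ Suc m / fact (Suc m)) has_real_derivative (real (Suc m) * t ^ m / fact (Suc m))) (at t)"
    using DERIV_cdivide[OF DERIV_pow[of "Suc m" t UNIV], of "fact (Suc m)"] by simp
  moreover have "real (Suc m) * t ^ m / fact (Suc m) = t ^ m / fact m"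
    by (simp add: divide_simps)
  ultimately show ?thesis using Suc by (simp add: divpow_def)
qed simp

text \<open>Canonical coordinates of the second kind: first integrate \<open>dt\<close>, then the remaining coordinates,
  whose differentials have coefficients that are polynomials in \<open>t\<close>.\<close>

lemma canonical_coordinates:
  obtains r F where "r > 0" "ball p0 r \<subseteq> iota_dom" "ball p0 r \<subseteq> \<phi> ` U" "smooth_on (ball p0 r) F" "F p0 = 0"
    "\<And>x. x \<in> ball p0 r \<Longrightarrow> (F has_derivative (\<lambda>w. shear (F x \<bullet> e 0) (MC x w))) (at x)"
proof -
  obtain r where r: "r > 0" "ball p0 r \<subseteq> iota_dom" "ball p0 r \<subseteq> \<phi> ` U"
    and prim: "\<And>G. closed_coeff r G \<Longrightarrow> \<exists>H. H p0 = 0 \<and> smooth_on (ball p0 r) H \<and>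
        (\<forall>x\<in>ball p0 r. (H has_derivative (\<lambda>w. G x \<bullet> MC x w)) (at x))"
    using MC_primitive by blast
  have br0: "e 0 \<bullet> br j = 0" if "1 \<le> j" for j using that by (simp add: br_def e_inner)
  have "\<exists>H. H p0 = 0 \<and> smooth_on (ball p0 r) H \<and>
        (\<forall>x\<in>ball p0 r. (H has_derivative (\<lambda>w. e 0 \<bullet> MC x w)) (at x))"
  proof (rule prim)
    have D: "frechet_derivative (\<lambda>x. e 0) (at x) = (\<lambda>h. 0)" for x :: 'e
      using frechet_derivative_at[OF has_derivative_const] by metis
    show "closed_coeff r (\<lambda>x. e 0)" unfolding closed_coeff_def D by (simp add: br0)
  qed
  then obtain t where t: "t p0 = 0" "smooth_on (ball p0 r) t"
    "\<And>x. x \<in> ball p0 r \<Longrightarrow> (t has_derivative (\<lambda>w. e 0 \<bullet> MC x w)) (at x)" by blast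
  have tf: "e 0 \<bullet> MC x (frame x (\<kappa> (e j))) = (if j = 0 then 1 else 0)" if "x \<in> ball p0 r" "j \<le> s" for x j
    using that r(2) by (auto simp: MC_frame e_inner)
  \<comment> \<open>\<open>G J x\<close> is row \<open>J\<close> of the matrix of
    \<open>shear (t x)\<close>, so that its product with \<open>MC\<close> is component
    \<open>J\<close> of the sheared form.\<close>
  define G where "G = (\<lambda>J x. \<Sum>k=1..J. divpow (t x) (J - k) *\<^sub>R e k)"
  have Ge: "G J x \<bullet> e j = (if 1 \<le> j \<and> j \<le> J then divpow (t x) (J - j) else 0)" if "J \<le> s" "j \<le> s" for J j x
  proof -
    have "G J x \<bullet> e j = (\<Sum>k=1..J. if k = j then divpow (t x) (J - j) else 0)"
      unfolding G_def inner_sum_left using that by (intro sum.cong) (auto simp: e_inner)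
    then show ?thesis by auto
  qed
  have Gb: "G J x \<bullet> b = shear (t x) b \<bullet> e J" if "1 \<le> J" "J \<le> s" for J x b
    unfolding G_def inner_sum_left shear_ej[OF that] by (simp add: inner_commute)
  have "\<exists>H. H p0 = 0 \<and> smooth_on (ball p0 r) H \<and>
        (\<forall>x\<in>ball p0 r. (H has_derivative (\<lambda>w. G J x \<bullet> MC x w)) (at x))" if J: "1 \<le> J" "J \<le> s" for J
  proof (rule prim)
    have smG: "smooth_on (ball p0 r) (G J)" unfolding G_def divpow_def
      by (intro smooth_on_sum smooth_on_scaleR smooth_on_divide smooth_on_power t smooth_on_const open_ball) simp
    have "(\<forall>i\<in>{1..s}. \<forall>j\<in>{1..s}. frechet_derivative (G J) (at x) (frame x (\<kappa> (e i))) \<bullet> e j =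
           frechet_derivative (G J) (at x) (frame x (\<kappa> (e j))) \<bullet> e i) \<and>
        (\<forall>j\<in>{1..s}. frechet_derivative (G J) (at x) (frame x (\<kappa> (e 0))) \<bullet> e j -
          frechet_derivative (G J) (at x) (frame x (\<kappa> (e j))) \<bullet> e 0 = G J x \<bullet> br j)"
      if x: "x \<in> ball p0 r" for x
    proof (intro conjI ballI)
    define D where "D = frechet_derivative (G J) (at x)"
    have D: "(G J has_derivative D) (at x)" unfolding D_def by (rule smooth_on_has_derivative[OF smG x])
    have D1: "(G J has_derivative (\<lambda>w. \<Sum>k=1..J. ((if J - k = 0 then 0 else divpow (t x) (J - k - 1)) * (e 0 \<bullet> MC x w)) *\<^sub>R e k)) (at x)"
      unfolding G_def
      by (intro has_derivative_sum has_derivative_scaleR_left has_derivative_compose[OF t(3)[OF x]]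
          divpow_has_derivative[unfolded has_field_derivative_def])
    have D': "D w = (\<Sum>k=1..J. ((if J - k = 0 then 0 else divpow (t x) (J - k - 1)) * (e 0 \<bullet> MC x w)) *\<^sub>R e k)" for w
      using fun_cong[OF has_derivative_unique[OF D D1], of w] by simp
    \<comment> \<open>The coefficients depend on \<open>t\<close> alone, and \<open>t\<close> is
      constant along the fields of positive index.\<close>
    have Dj: "D (frame x (\<kappa> (e j))) = 0" if "1 \<le> j" "j \<le> s" for j
      unfolding D' using tf[OF x that(2)] that(1) by simp
    show "frechet_derivative (G J) (at x) (frame x (\<kappa> (e i))) \<bullet> e j =
        frechet_derivative (G J) (at x) (frame x (\<kappa> (e j))) \<bullet> e i"
      if "i \<in> {1..s}" "j \<in> {1..s}" for i j
      unfolding D_def[symmetric] using that by (simp add: Dj)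
    fix j assume "j \<in> {1..s}"
    then have j: "1 \<le> j" "j \<le> s" by auto
    show "frechet_derivative (G J) (at x) (frame x (\<kappa> (e 0))) \<bullet> e j -
        frechet_derivative (G J) (at x) (frame x (\<kappa> (e j))) \<bullet> e 0 = G J x \<bullet> br j"
      unfolding D_def[symmetric]
    proof -
      \<comment> \<open>Differentiation along \<open>X 0\<close> lowers each divided power by one
        degree, which is the same as pairing with \<open>e (Suc j)\<close> instead of
        \<open>e j\<close>. For \<open>j = J\<close> both sides are 0.\<close>
      have "D (frame x (\<kappa> (e 0))) \<bullet> e j
          = (\<Sum>k=1..J. if k = j then (if J - j = 0 then 0 else divpow (t x) (J - j - 1)) else 0)"
        unfolding D' inner_sum_left using tf[OF x, of 0] J j by (intro sum.cong) (auto simp: e_inner)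
      also have "\<dots> = (if j < J then divpow (t x) (J - j - 1) else 0)" using j by auto
      also have "\<dots> = G J x \<bullet> br j" using j J Ge[of J "Suc j"] by (auto simp: br_def)
      finally show "D (frame x (\<kappa> (e 0))) \<bullet> e j - D (frame x (\<kappa> (e j))) \<bullet> e 0 = G J x \<bullet> br j"
        by (simp add: Dj[OF j])
    qed
    qed
    then show "closed_coeff r (G J)" unfolding closed_coeff_def using smG by blast
  qed
  then have "\<exists>H. \<forall>J. 1 \<le> J \<longrightarrow> J \<le> s \<longrightarrow> H J p0 = 0 \<and> smooth_on (ball p0 r) (H J) \<and>
        (\<forall>x\<in>ball p0 r. (H J has_derivative (\<lambda>w. G J x \<bullet> MC x w)) (at x))" by metis
  then obtain H where H: "\<And>J. 1 \<le> J \<Longrightarrow> J \<le> s \<Longrightarrow> H J p0 = 0" "\<And>J. 1 \<le> J \<Longrightarrow> J \<le> s \<Longrightarrow> smooth_on (ball p0 r) (H J)"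
     "\<And>J x. 1 \<le> J \<Longrightarrow> J \<le> s \<Longrightarrow> x \<in> ball p0 r \<Longrightarrow> (H J has_derivative (\<lambda>w. G J x \<bullet> MC x w)) (at x)"
    by blast
  define c where "c = (\<lambda>J. if J = 0 then t else H J)"
  define F where "F = (\<lambda>x. \<Sum>J\<le>s. c J x *\<^sub>R e J)"
  have F0: "F x \<bullet> e 0 = t x" for x unfolding F_def by (subst coord_sum) (auto simp: c_def)
  have cD: "(c J has_derivative (\<lambda>w. shear (t x) (MC x w) \<bullet> e J)) (at x)" if "J \<le> s" "x \<in> ball p0 r" for J x
  proof (cases "J = 0")
    case True
    have eq: "(\<lambda>w. e 0 \<bullet> MC x w) = (\<lambda>w. shear (t x) (MC x w) \<bullet> e 0)"
      by (rule ext) (subst inner_commute, rule shear_e0[symmetric])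
    show ?thesis using t(3)[OF that(2)] unfolding eq by (simp add: True c_def)
  next
    case False
    then show ?thesis using H(3)[of J x] that Gb[of J x] by (simp add: c_def)
  qed
  show thesis
  proof (rule that[OF r])
    show "smooth_on (ball p0 r) F" unfolding F_def
      using t(2) H(2) by (intro smooth_on_sum smooth_on_scaleR smooth_on_const open_ball) (auto simp: c_def)
    show "F p0 = 0" unfolding F_def using t(1) H(1) by (auto simp: c_def intro!: sum.neutral)
    show "(F has_derivative (\<lambda>w. shear (F x \<bullet> e 0) (MC x w))) (at x)" if x: "x \<in> ball p0 r" for x
    proof -
      have "(F has_derivative (\<lambda>w. \<Sum>J\<le>s. (shear (t x) (MC x w) \<bullet> e J) *\<^sub>R e J)) (at x)"
        unfolding F_def by (intro has_derivative_sum has_derivative_scaleR_left cD x) auto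
      moreover have "(\<Sum>J\<le>s. (v \<bullet> e J) *\<^sub>R e J) = v" for v
        by (rule coord_expand)
      ultimately show ?thesis by (simp add: F0)
    qed
  qed
qed

end

section \<open>Inversion and homomorphism property of the canonical coordinates\<close>

context filiform_chart
begin

lemma shear_inverse [simp]: "shear (- t) (shear t v) = v" "shear t (shear (- t) v) = v"
  by (simp_all add: shear_shear)

text \<open>The derivative of \<open>F\<close> at \<open>p0\<close> is \<open>inv \<kappa>\<close>,
  so the inverse function theorem applies. For fixed \<open>x\<close>, left invariance shows that
  the two sides of the homomorphism law have the same derivative in \<open>y\<close>; they agree at
  \<open>y = p0\<close> and hence on a ball.\<close>

lemma local_isomorphism:
  obtains W N F g where "open W" "W \<subseteq> \<phi> ` U" "p0 \<in> W" "open N" "homeomorphism W N F g"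
    "smooth_on W F" "smooth_on N g" "F p0 = 0" "(F has_derivative inv \<kappa>) (at p0)"
    "\<exists>d>0. ball p0 d \<subseteq> W \<and> (\<forall>x\<in>ball p0 d. \<forall>y\<in>ball p0 d. (x, y) \<in> mu_dom \<and> mu (x, y) \<in> W \<and>
       F (mu (x, y)) = mul (F x) (F y))"
proof -
  obtain r F where r: "r > 0" "ball p0 r \<subseteq> iota_dom" "ball p0 r \<subseteq> \<phi> ` U" and F: "smooth_on (ball p0 r) F" "F p0 = 0"
    and DF: "\<And>x. x \<in> ball p0 r \<Longrightarrow> (F has_derivative (\<lambda>w. shear (F x \<bullet> e 0) (MC x w))) (at x)"
    using canonical_coordinates by blast
  let ?B = "ball p0 r"
  define DF' where "DF' = (\<lambda>x w. shear (F x \<bullet> e 0) (MC x w))"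
  have DF: "(F has_derivative DF' x) (at x)" if "x \<in> ?B" for x unfolding DF'_def using DF[OF that] .
  have DFinv: "DF' x (frame x (\<kappa> (shear (- (F x \<bullet> e 0)) v))) = v" if "x \<in> ?B" for x v
    unfolding DF'_def using that r(2) by (subst MC_frame) auto
  have MCp0: "MC p0 w = inv \<kappa> w" for w
    using mc_frame[OF p0_iota_dom, of w] by (simp add: MC_def)
  have DFp0: "DF' p0 = inv \<kappa>" unfolding DF'_def using F(2) MCp0 by simp
  have bl: "bounded_linear (DF' x)" if "x \<in> ?B" for x
    using DF[OF that] has_derivative_bounded_linear by blast
  define f' where "f' = (\<lambda>x. Blinfun (DF' x))"
  have f': "blinfun_apply (f' x) = DF' x" if "x \<in> ?B" for x
    unfolding f'_def using bl[OF that] by (simp add: bounded_linear_Blinfun_apply)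
  have contf: "continuous_on ?B f'"
  proof (rule continuous_on_blinfun_componentwise)
    fix i :: 'e
    have "continuous_on ?B (\<lambda>x. frechet_derivative F (at x) i)"
      by (rule smooth_on_continuous[OF smooth_on_frechet_derivative[OF F(1)]])
    then show "continuous_on ?B (\<lambda>x. blinfun_apply (f' x) i)"
      by (rule continuous_on_eq) (use DF frechet_derivative_at f' in metis)
  qed
  have inv: "Blinfun \<kappa> o\<^sub>L f' p0 = id_blinfun"
    using r(1) by (intro blinfun_eqI)
      (simp add: f' DFp0 bounded_linear_Blinfun_apply[OF bounded_linear_\<kappa>])
  have fD: "(F has_derivative blinfun_apply (f' x)) (at x)" if "x \<in> ?B" for x
    using DF[OF that] by (simp add: f'[OF that])
  have p0B: "p0 \<in> ?B" using r(1) by simp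
  obtain W N g g' where W: "open W" "W \<subseteq> ?B" "p0 \<in> W" and N: "open N" "F p0 \<in> N" and hom: "homeomorphism W N F g"
    and g: "\<And>y. y \<in> N \<Longrightarrow> (g has_derivative (g' y)) (at y)"
      "\<And>y. y \<in> N \<Longrightarrow> g' y = inv (blinfun_apply (f' (g y)))"
      "\<And>y. y \<in> N \<Longrightarrow> bij (blinfun_apply (f' (g y)))"
    by (rule inverse_function_theorem[OF open_ball fD contf p0B inv]) blast+
  have gW: "g y \<in> W" "F (g y) = y" if "y \<in> N" for y using hom that unfolding homeomorphism_def by auto
  have gD: "(g has_derivative (\<lambda>z. frame (g y) (\<kappa> (shear (- (y \<bullet> e 0)) z)))) (at y)" if y: "y \<in> N" for y
  proof -
    have B: "g y \<in> ?B" using gW[OF y] W by blast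
    have "g' y z = frame (g y) (\<kappa> (shear (- (y \<bullet> e 0)) z))" for z
    proof -
      have "bij (DF' (g y))" "g' y = inv (DF' (g y))" using g(2,3)[OF y] f'[OF B] by auto
      then show ?thesis using DFinv[OF B, of z] gW[OF y] by (metis bij_inv_eq_iff)
    qed
    then have "g' y = (\<lambda>z. frame (g y) (\<kappa> (shear (- (y \<bullet> e 0)) z)))" by blast
    then show ?thesis using g(1)[OF y] by simp
  qed
  \<comment> \<open>Bootstrapping: the derivative of \<open>g\<close> is given by smooth maps
    composed with \<open>g\<close>, so each order of differentiability of \<open>g\<close> yields
    the next.\<close>
  have smg: "smooth_on N g"
    unfolding smooth_on_def
  proof
    show "Ck_on k N g" for k
    proof (induction k)
      case 0
      show ?case using hom unfolding homeomorphism_def by simp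
    next
      case (Suc k)
      show ?case
      proof (rule Ck_on_SucI[OF N(1) gD])
        fix z
        have "smooth_on N (\<lambda>y. shear (- (y \<bullet> e 0)) z)"
          using N(1) by (intro smooth_on_shear smooth_on_minus smooth_on_inner_const) auto
        then have "Ck_on k N (\<lambda>y. \<kappa> (shear (- (y \<bullet> e 0)) z))"
          using smooth_on_linear_compose[OF bounded_linear_\<kappa> N(1)] unfolding smooth_on_def by blast
        moreover have "Ck_on k N (\<lambda>y. frame (g y) b)" for b
          by (rule Ck_on_compose[OF N(1) open_image Suc]) (use smooth_frame in \<open>simp add: smooth_on_def\<close>,
              use gW(1) W(2) r(3) in blast)
        ultimately have "Ck_on k N (\<lambda>y. \<Sum>b\<in>Basis. (\<kappa> (shear (- (y \<bullet> e 0)) z) \<bullet> b) *\<^sub>R frame (g y) b)"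
          by (intro Ck_on_sum[OF N(1)] Ck_on_bilinear[OF bounded_bilinear_scaleR N(1)]
              Ck_on_bilinear[OF bounded_bilinear_inner N(1)] Ck_on_const)
        then show "Ck_on k N (\<lambda>y. frame (g y) (\<kappa> (shear (- (y \<bullet> e 0)) z)))"
        proof (rule iffD1[OF Ck_on_cong_open[OF N(1)], rotated])
          fix y assume "y \<in> N"
          then have lf: "linear (frame (g y))" using gW W r by (intro linear_frame) blast
          have 1: "frame (g y) (\<Sum>b\<in>Basis. (v \<bullet> b) *\<^sub>R b) = (\<Sum>b\<in>Basis. (v \<bullet> b) *\<^sub>R frame (g y) b)" for v
            by (simp add: linear_sum[OF lf] linear_scale[OF lf])
          show "(\<Sum>b\<in>Basis. (\<kappa> (shear (- (y \<bullet> e 0)) z) \<bullet> b) *\<^sub>R frame (g y) b)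
              = frame (g y) (\<kappa> (shear (- (y \<bullet> e 0)) z))"
            unfolding 1[symmetric] euclidean_representation ..
        qed
      qed
    qed
  qed
  have "open (mu -` W \<inter> mu_dom)"
    using continuous_open_preimage[OF smooth_on_continuous[OF smooth_mu] open_mu_dom W(1)]
    by (simp add: Int_commute)
  moreover have "(p0, p0) \<in> mu -` W \<inter> mu_dom" using W(3) by simp
  ultimately obtain P Q where PQ: "open P" "open Q" "p0 \<in> P" "p0 \<in> Q" "P \<times> Q \<subseteq> mu -` W \<inter> mu_dom"
    by (metis open_prod_elim mem_Sigma_iff)
  have "open (P \<inter> Q \<inter> W)" "p0 \<in> P \<inter> Q \<inter> W" using PQ W by auto
  then obtain d where d: "d > 0" "ball p0 d \<subseteq> P \<inter> Q \<inter> W" using open_contains_ball by meson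
  have md: "(x, y) \<in> mu_dom" "mu (x, y) \<in> W" if "x \<in> ball p0 d" "y \<in> ball p0 d" for x y
  proof -
    have "(x, y) \<in> mu -` W \<inter> mu_dom" using that d(2) PQ(5) by blast
    then show "(x, y) \<in> mu_dom" "mu (x, y) \<in> W" by auto
  qed
  have hom2: "F (mu (x, y)) = mul (F x) (F y)" if x: "x \<in> ball p0 d" and y: "y \<in> ball p0 d" for x y
  proof -
    have p0d: "p0 \<in> ball p0 d" using d by simp
    have xU: "x \<in> \<phi> ` U" using md[OF x p0d] by (simp add: mu_dom_iff)
    have D1: "((\<lambda>y. F (mu (x, y))) has_derivative (\<lambda>w. shear (F (mu (x, y)) \<bullet> e 0) (MC y w))) (at y)"
      if y: "y \<in> ball p0 d" for y
    proof -
      have yB: "y \<in> iota_dom" "y \<in> ?B" using y d(2) W(2) r(2) by blast+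
      have mB: "mu (x, y) \<in> ?B" using md[OF x y] W by blast
      define D where "D = (\<lambda>v. frechet_derivative mu (at (x, y)) (0, v))"
      have D: "((\<lambda>y. mu (x, y)) has_derivative D) (at y)"
        unfolding D_def by (rule has_derivative_snd_slice[OF smooth_mu md(1)[OF x y]])
      have "DF' (mu (x, y)) (D w) = shear (F (mu (x, y)) \<bullet> e 0) (MC y w)" for w
      proof -
        have "D w = frame (mu (x, y)) (\<kappa> (MC y w))"
          using mu_frame[OF md(1)[OF x y] D, of "\<kappa> (MC y w)"] frame_MC[OF yB(1)] by simp
        then show ?thesis unfolding DF'_def using mB r(2) by (simp add: MC_frame subset_iff)
      qed
      with has_derivative_compose[OF D DF[OF mB]] show ?thesis by simp
    qed
    have D2: "((\<lambda>y. mul (F x) (F y)) has_derivative (\<lambda>w. shear (F x \<bullet> e 0) (shear (F y \<bullet> e 0) (MC y w)))) (at y)"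
      if y: "y \<in> ball p0 d" for y
    proof -
      have "y \<in> ?B" using y d(2) W(2) by blast
      from has_derivative_compose[OF DF[OF this] mul_has_derivative] show ?thesis unfolding DF'_def .
    qed
    \<comment> \<open>The \<open>e 0\<close> coordinates are compared before the rest because the
      derivative of the left-hand side is a shear whose parameter is its own \<open>e 0\<close>
      coordinate. Shears do not change that coordinate, so this comparison needs no prior knowledge
      of the parameter.\<close>
    have eq0: "F (mu (x, y)) \<bullet> e 0 = F x \<bullet> e 0 + F y \<bullet> e 0" if y: "y \<in> ball p0 d" for y
    proof -
      have "((\<lambda>y. F (mu (x, y)) \<bullet> e 0 - mul (F x) (F y) \<bullet> e 0) has_derivative (\<lambda>w. 0)) (at y within ball p0 d)"
        if y: "y \<in> ball p0 d" for y
      proof -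
        have "((\<lambda>y. F (mu (x, y)) \<bullet> e 0 - mul (F x) (F y) \<bullet> e 0) has_derivative
            (\<lambda>w. shear (F (mu (x, y)) \<bullet> e 0) (MC y w) \<bullet> e 0 - shear (F x \<bullet> e 0) (shear (F y \<bullet> e 0) (MC y w)) \<bullet> e 0)) (at y)"
          by (intro has_derivative_diff has_derivative_inner_left D1 D2 y)
        then show ?thesis by (simp add: has_derivative_at_withinI)
      qed
      from has_derivative_zero_constant[OF convex_ball this]
      obtain c where c: "\<And>y. y \<in> ball p0 d \<Longrightarrow> F (mu (x, y)) \<bullet> e 0 - mul (F x) (F y) \<bullet> e 0 = c" by blast
      have "c = 0" using c[OF p0d] xU F(2) by simp
      then show ?thesis using c[OF y] by simp
    qed
    have "((\<lambda>y. F (mu (x, y)) - mul (F x) (F y)) has_derivative (\<lambda>w. 0)) (at y within ball p0 d)"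
      if y: "y \<in> ball p0 d" for y
    proof -
      have "((\<lambda>y. F (mu (x, y)) - mul (F x) (F y)) has_derivative
          (\<lambda>w. shear (F (mu (x, y)) \<bullet> e 0) (MC y w) - shear (F x \<bullet> e 0) (shear (F y \<bullet> e 0) (MC y w)))) (at y)"
        by (intro has_derivative_diff D1 D2 y)
      then show ?thesis by (simp add: has_derivative_at_withinI eq0[OF y] shear_shear)
    qed
    from has_derivative_zero_constant[OF convex_ball this]
    obtain c where c: "\<And>y. y \<in> ball p0 d \<Longrightarrow> F (mu (x, y)) - mul (F x) (F y) = c" by blast
    have "c = 0" using c[OF p0d] xU F(2) by simp
    then show ?thesis using c[OF y] by simp
  qed
  show thesis
  proof (rule that)
    show "open W" "p0 \<in> W" "open N" "homeomorphism W N F g" "smooth_on N g" "F p0 = 0" by fact+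
    show "W \<subseteq> \<phi> ` U" using W r by blast
    show "smooth_on W F" using smooth_on_subset[OF F(1) W(2)] .
    show "(F has_derivative inv \<kappa>) (at p0)" using DF[OF p0B] by (simp add: DFp0)
    show "\<exists>d>0. ball p0 d \<subseteq> W \<and> (\<forall>x\<in>ball p0 d. \<forall>y\<in>ball p0 d. (x, y) \<in> mu_dom \<and> mu (x, y) \<in> W \<and>
       F (mu (x, y)) = mul (F x) (F y))"
      using d md hom2 by (intro exI[of _ d]) auto
  qed
qed

end

section \<open>From local to global isomorphism\<close>

definition double :: "'g::group_add \<Rightarrow> 'g" where "double g = g + g"

text \<open>In a noncommutative group doubling is additive on commuting pairs. The doubled elements
  commute again, which is why the induction carries both facts.\<close>

lemma double_pow_add:
  fixes g h :: "'g::group_add"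
  assumes "g + h = h + g"
  shows "(double ^^ k) (g + h) = (double ^^ k) g + (double ^^ k) h \<and>
    (double ^^ k) g + (double ^^ k) h = (double ^^ k) h + (double ^^ k) g"
  using assms
proof (induction k)
  case (Suc k)
  let ?g = "(double ^^ k) g" and ?h = "(double ^^ k) h"
  have c: "?g + ?h = ?h + ?g" and s: "(double ^^ k) (g + h) = ?g + ?h" using Suc by auto
  have "?g + ?h + (?g + ?h) = ?g + (?h + ?g) + ?h" by (simp add: add.assoc)
  also have "\<dots> = ?g + (?g + ?h) + ?h" by (simp only: c)
  finally have 1: "?g + ?h + (?g + ?h) = (?g + ?g) + (?h + ?h)" by (simp add: add.assoc)
  have "?h + ?g + (?h + ?g) = ?h + (?g + ?h) + ?g" by (simp add: add.assoc)
  also have "\<dots> = ?h + (?h + ?g) + ?g" by (simp only: c)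
  finally have 2: "?h + ?g + (?h + ?g) = (?h + ?h) + (?g + ?g)" by (simp add: add.assoc)
  have 3: "(?g + ?g) + (?h + ?h) = (?h + ?h) + (?g + ?g)" by (metis 1 2 c)
  have D: "(double ^^ Suc k) x = (double ^^ k) x + (double ^^ k) x" for x :: 'g
    by (simp add: double_def)
  show ?case unfolding D s using 1 3 by blast
qed simp

lemma group_idempotent_zero: "(x :: 'g::group_add) = x + x \<Longrightarrow> x = 0"
  by (metis add.right_neutral add_left_cancel)

text \<open>The extension is found by repeated doubling.\<close>

lemma local_hom_extension:
  fixes h :: "'v::real_normed_vector \<Rightarrow> 'g::group_add"
  assumes d: "d > 0" and h: "\<And>x y. norm x < d \<Longrightarrow> norm y < d \<Longrightarrow> h (x + y) = h x + h y"
  obtains H where "\<And>x y. H (x + y) = H x + H y" "\<And>x. norm x < d \<Longrightarrow> H x = h x"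
proof -
  \<comment> \<open>The value of \<open>h\<close> at \<open>x\<close> divided by
    \<open>2 ^ k\<close>, doubled \<open>k\<close> times. It does not depend on \<open>k\<close>
    once that quotient lies in the ball.\<close>
  define v where "v = (\<lambda>k x. (double ^^ k) (h ((1 / 2 ^ k) *\<^sub>R x)))"
  have sm: "norm ((1 / 2 ^ k) *\<^sub>R x) < d \<longleftrightarrow> norm x < 2 ^ k * d" for k and x :: 'v
    by (simp add: field_simps)
  have step: "v (Suc k) x = v k x" if "norm x < 2 ^ k * d" for k x
  proof -
    let ?u = "(1 / 2 ^ Suc k) *\<^sub>R x"
    have "2 ^ Suc k * d = 2 * (2 ^ k * d)" "0 < 2 ^ k * d" using d by simp_all
    then have "norm x < 2 ^ Suc k * d" using that by linarith
    then have u: "norm ?u < d" using sm[of "Suc k" x] by blast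
    have "?u + ?u = (1 / 2 ^ k) *\<^sub>R x" by (simp flip: scaleR_left_distrib)
    then have "double (h ?u) = h ((1 / 2 ^ k) *\<^sub>R x)" unfolding double_def using h[OF u u] by simp
    then show ?thesis unfolding v_def by (simp add: funpow_swap1)
  qed
  have mono: "2 ^ k * d \<le> 2 ^ (k + j) * d" for k j using d by (simp add: power_add)
  have steps: "v (k + j) x = v k x" if "norm x < 2 ^ k * d" for k j x
  proof (induction j)
    case (Suc j)
    have "norm x < 2 ^ (k + j) * d" using that mono[of k j] by linarith
    then show ?case using step Suc by simp
  qed simp
  have ex: "\<exists>k. norm x < 2 ^ k * d" for x
    using real_arch_pow[of 2 "norm x / d"] d by (auto simp: field_simps)
  define H where "H = (\<lambda>x. v (LEAST k. norm x < 2 ^ k * d) x)"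
  have Hv: "H x = v k x" if "norm x < 2 ^ k * d" for k x
  proof -
    let ?l = "LEAST k. norm x < 2 ^ k * d"
    have l: "norm x < 2 ^ ?l * d" using that by (rule LeastI)
    have "?l \<le> k" using that by (rule Least_le)
    then have "v k x = v ?l x" using steps[OF l, of "k - ?l"] by simp
    then show ?thesis by (simp add: H_def)
  qed
  show thesis
  proof
    fix x y :: 'v
    obtain k where k: "norm x + norm y < 2 ^ k * d"
      using real_arch_pow[of 2 "(norm x + norm y) / d"] d by (auto simp: field_simps)
    have n: "norm x < 2 ^ k * d" "norm y < 2 ^ k * d" "norm (x + y) < 2 ^ k * d"
      using k norm_ge_zero[of x] norm_ge_zero[of y] norm_triangle_ineq[of x y] by linarith+
    let ?u = "(1 / 2 ^ k) *\<^sub>R x" and ?w = "(1 / 2 ^ k) *\<^sub>R y"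
    have u: "norm ?u < d" and w: "norm ?w < d" using n sm by blast+
    \<comment> \<open>The two values commute because vector addition does; this is what
      \<open>double_pow_add\<close> asks for.\<close>
    have "h ?u + h ?w = h (?u + ?w)" using h[OF u w] by simp
    also have "\<dots> = h ?w + h ?u" using h[OF w u] by (simp add: add.commute)
    finally have c: "h ?u + h ?w = h ?w + h ?u" .
    have "v k (x + y) = (double ^^ k) (h ?u + h ?w)" unfolding v_def using h[OF u w] by (simp add: scaleR_right_distrib)
    also have "\<dots> = v k x + v k y" unfolding v_def using double_pow_add[OF c] by blast
    finally show "H (x + y) = H x + H y" using Hv n by simp
  next
    fix x :: 'v assume "norm x < d"
    then show "H x = h x" using Hv[of x 0] by (simp add: v_def)
  qed
qed

text \<open>Plays the role of uniform continuity for maps into a group without a metric, with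
  \<open>D (p, q)\<close> the quotient of the values at \<open>p\<close> and \<open>q\<close>. If it
  failed, offending pairs at distance tending to 0 would accumulate at a point of the
  diagonal.\<close>

lemma diagonal_neighbourhood:
  fixes K :: "'a::metric_space set" and D :: "'a \<times> 'a \<Rightarrow> 'b::topological_space"
  assumes K: "compact K" and D: "continuous_on (K \<times> K) D" and S: "open S" "\<And>p. p \<in> K \<Longrightarrow> D (p, p) \<in> S"
  obtains \<eta> where "\<eta> > 0" "\<And>p q. p \<in> K \<Longrightarrow> q \<in> K \<Longrightarrow> dist p q < \<eta> \<Longrightarrow> D (p, q) \<in> S"
proof (rule ccontr)
  assume no: "\<not> thesis"
  have "\<exists>p q. p \<in> K \<and> q \<in> K \<and> dist p q < inverse (real (Suc n)) \<and> D (p, q) \<notin> S" for n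
    using no that[of "inverse (real (Suc n))"] by fastforce
  then obtain p q where pq: "\<And>n. p n \<in> K" "\<And>n. q n \<in> K" "\<And>n. dist (p n) (q n) < inverse (real (Suc n))"
    "\<And>n. D (p n, q n) \<notin> S" by metis
  obtain z r where z: "z \<in> K" "strict_mono r" "(p \<circ> r) \<longlonglongrightarrow> z"
    using K pq(1) unfolding compact_def by metis
  have d0: "(\<lambda>n. dist ((p \<circ> r) n) ((q \<circ> r) n)) \<longlonglongrightarrow> 0"
  proof (rule tendsto_sandwich[OF _ _ tendsto_const])
    show "(\<lambda>n. inverse (real (Suc (r n)))) \<longlonglongrightarrow> 0"
      using LIMSEQ_subseq_LIMSEQ[OF LIMSEQ_inverse_real_of_nat z(2)] by (simp add: comp_def)
    show "\<forall>\<^sub>F n in sequentially. dist ((p \<circ> r) n) ((q \<circ> r) n) \<le> inverse (real (Suc (r n)))"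
      by (intro always_eventually allI) (use pq(3) in \<open>simp add: less_imp_le\<close>)
  qed auto
  have "(q \<circ> r) \<longlonglongrightarrow> z"
  proof (rule iffD2[OF tendsto_dist_iff], rule tendsto_sandwich[OF _ _ tendsto_const])
    show "(\<lambda>n. dist ((p \<circ> r) n) ((q \<circ> r) n) + dist ((p \<circ> r) n) z) \<longlonglongrightarrow> 0"
      using tendsto_add[OF d0 iffD1[OF tendsto_dist_iff z(3)]] by simp
    show "\<forall>\<^sub>F n in sequentially. dist ((q \<circ> r) n) z \<le> dist ((p \<circ> r) n) ((q \<circ> r) n) + dist ((p \<circ> r) n) z"
      by (intro always_eventually allI) (metis dist_commute dist_triangle)
  qed auto
  then have "(\<lambda>n. (p (r n), q (r n))) \<longlonglongrightarrow> (z, z)" using z(3) by (intro tendsto_Pair) (simp_all add: comp_def)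
  then have "(\<lambda>n. D (p (r n), q (r n))) \<longlonglongrightarrow> D (z, z)"
    using D[unfolded continuous_on_sequentially, rule_format, of "(z, z)" "\<lambda>n. (p (r n), q (r n))"] z(1) pq(1,2)
    by (simp add: comp_def)
  then have "\<forall>\<^sub>F n in sequentially. D (p (r n), q (r n)) \<in> S"
    using S z(1) by (auto dest: topological_tendstoD)
  then show False using pq(4) by (auto simp: eventually_sequentially)
qed

lemma open_left_translate:
  fixes S :: "'g::topological_group_add set"
  assumes "open S"
  shows "open ((+) a ` S)"
proof -
  have "(+) a ` S = (\<lambda>x. - a + x) -` S"
    by (force simp: image_iff simp flip: add.assoc)
  moreover have "open ((\<lambda>x. - a + x) -` S)" by (intro open_vimage assms continuous_intros)
  ultimately show ?thesis by simp
qed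

context filiform_model
begin

text \<open>Projection along \<open>e 0\<close> onto the abelian ideal spanned by
  \<open>e 1\<close>, ..., \<open>e s\<close>; not the projection to the horizontal layer.\<close>

definition horiz :: "'e \<Rightarrow> 'e" where "horiz x = x - (x \<bullet> e 0) *\<^sub>R e 0"

lemma horiz_e0 [simp]: "horiz x \<bullet> e 0 = 0"
  by (simp add: horiz_def inner_diff_left e_inner)

lemma horiz_add: "horiz (x + y) = horiz x + horiz y"
  by (simp add: horiz_def inner_add_left algebra_simps)

lemma horiz_id: "x \<bullet> e 0 = 0 \<Longrightarrow> horiz x = x"
  by (simp add: horiz_def)

lemma horiz_mul: "horiz (mul x y) = horiz x + shear (x \<bullet> e 0) (horiz y)"
  by (simp add: horiz_def mul_def inner_add_left shear_diff shear_scale algebra_simps)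

lemma norm_e0 [simp]: "norm (e 0) = 1" by simp

lemma norm_horiz_le: "norm (horiz x) \<le> 2 * norm x"
proof -
  have "norm (horiz x) \<le> norm x + norm ((x \<bullet> e 0) *\<^sub>R e 0)" unfolding horiz_def by (rule norm_triangle_ineq4)
  also have "norm ((x \<bullet> e 0) *\<^sub>R e 0) \<le> norm x" by (simp add: Basis_le_norm)
  finally show ?thesis by simp
qed

lemma mul_horiz: "mul (horiz x) (r *\<^sub>R e 0) = horiz x + r *\<^sub>R e 0"
  by (rule mul_scale_basis0)

text \<open>The global homomorphism is assembled from its restrictions to the abelian normal subgroup
  and to the one-parameter group in direction \<open>e 0\<close>.\<close>

lemma global_hom:
  fixes \<sigma> :: "'e \<Rightarrow> 'g::group_add"
  assumes d: "d > 0" and \<sigma>: "\<And>x y. norm x < d \<Longrightarrow> norm y < d \<Longrightarrow> \<sigma> (mul x y) = \<sigma> x + \<sigma> y"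
  obtains \<Psi> where "\<And>x y. \<Psi> (mul x y) = \<Psi> x + \<Psi> y" "\<And>x. norm x < d / 2 \<Longrightarrow> \<Psi> x = \<sigma> x"
proof -
  \<comment> \<open>The radius \<open>d / 2\<close> absorbs the factor 2 of
    \<open>norm_horiz_le\<close>.\<close>
  have "\<sigma> (horiz (x + y)) = \<sigma> (horiz x) + \<sigma> (horiz y)" if "norm x < d / 2" "norm y < d / 2" for x y
  proof -
    have "norm (horiz x) < d" "norm (horiz y) < d"
      using norm_horiz_le[of x] norm_horiz_le[of y] that by linarith+
    from \<sigma>[OF this] show ?thesis by (simp add: mul_def horiz_add)
  qed
  then obtain a where a: "\<And>x y. a (x + y) = a x + a y" "\<And>x. norm x < d / 2 \<Longrightarrow> a x = \<sigma> (horiz x)"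
    using local_hom_extension[of "d / 2" "\<lambda>x. \<sigma> (horiz x)"] d by (metis half_gt_zero)
  have "\<sigma> ((t + r) *\<^sub>R e 0) = \<sigma> (t *\<^sub>R e 0) + \<sigma> (r *\<^sub>R e 0)" if "norm t < d" "norm r < d" for t r :: real
    using \<sigma>[of "t *\<^sub>R e 0" "r *\<^sub>R e 0"] that by (simp add: mul_scale_basis0 scaleR_left_distrib)
  then obtain \<gamma> where \<gamma>: "\<And>t r. \<gamma> (t + r) = \<gamma> t + \<gamma> r" "\<And>t :: real. norm t < d \<Longrightarrow> \<gamma> t = \<sigma> (t *\<^sub>R e 0)"
    using local_hom_extension[of d "\<lambda>t. \<sigma> (t *\<^sub>R e 0)"] d by metis
  \<comment> \<open>The relation by which \<gamma> acts on the values of \<open>a\<close> as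
    \<open>shear\<close> acts on the ideal. It holds near 0, then for all \<open>u\<close> by
    doubling \<open>u\<close>, and finally for all \<open>t\<close> by doubling
    \<open>t\<close>.\<close>
  define C where "C = (\<lambda>t u. \<gamma> t + a u = a (shear t u) + \<gamma> t)"
  have C_small: "C t u" if u: "u \<bullet> e 0 = 0" and n: "norm t < d" "norm u < d / 2" "norm (shear t u) < d / 2" for t u
  proof -
    have su: "shear t u \<bullet> e 0 = 0" using u by simp
    have te: "norm (t *\<^sub>R e 0) < d" using n by simp
    have "\<gamma> t + a u = \<sigma> (t *\<^sub>R e 0) + \<sigma> u" using a(2)[OF n(2)] \<gamma>(2)[OF n(1)] u by (simp add: horiz_id)
    also have "\<dots> = \<sigma> (mul (t *\<^sub>R e 0) u)" using \<sigma>[OF te] n d by simp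
    also have "mul (t *\<^sub>R e 0) u = mul (shear t u) (t *\<^sub>R e 0)"
      by (subst mul_scale_basis0) (simp add: mul_def e_inner)
    also have "\<sigma> (mul (shear t u) (t *\<^sub>R e 0)) = \<sigma> (shear t u) + \<sigma> (t *\<^sub>R e 0)"
      using \<sigma>[OF _ te] n d by simp
    also have "\<dots> = a (shear t u) + \<gamma> t" using a(2)[OF n(3)] \<gamma>(2)[OF n(1)] su by (simp add: horiz_id)
    finally show ?thesis unfolding C_def .
  qed
  have C_dbl: "C t (u + u)" if "C t u" for t u
  proof -
    have *: "\<gamma> t + a u = a (shear t u) + \<gamma> t" using that unfolding C_def .
    have "\<gamma> t + (a u + a u) = a (shear t u) + (\<gamma> t + a u)" by (metis * add.assoc)
    also have "\<dots> = a (shear t u) + a (shear t u) + \<gamma> t" by (simp add: * add.assoc)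
    finally show ?thesis unfolding C_def by (simp add: a(1) shear_add)
  qed
  have C_pow: "C t ((2 ^ k) *\<^sub>R u)" if "C t u" for t u k
  proof (induction k)
    case (Suc k)
    have "(2 ^ Suc k) *\<^sub>R u = (2 ^ k) *\<^sub>R u + (2 ^ k) *\<^sub>R u" by (simp flip: scaleR_left_distrib)
    then show ?case using C_dbl[OF Suc] by simp
  qed (use that in simp)
  have C_t: "C t u" if t: "norm t < d" and u: "u \<bullet> e 0 = 0" for t u
  proof -
    obtain k where k: "(norm u + norm (shear t u)) / (d / 2) < 2 ^ k" using real_arch_pow[of 2] by force
    then have k': "norm u + norm (shear t u) < 2 ^ k * (d / 2)" using d by (simp add: field_simps)
    let ?u = "(1 / 2 ^ k) *\<^sub>R u"
    have "norm u < 2 ^ k * (d / 2)" "norm (shear t u) < 2 ^ k * (d / 2)"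
      using k' norm_ge_zero[of u] norm_ge_zero[of "shear t u"] by linarith+
    then have "norm ?u < d / 2" "norm (shear t ?u) < d / 2"
      by (simp_all add: shear_scale field_simps)
    then have "C t ?u" using C_small[OF _ t] u by simp
    from C_pow[OF this, of k] show ?thesis by simp
  qed
  \<comment> \<open>Doubling \<open>t\<close> uses the relation at \<open>u\<close> and again at
    \<open>shear t u\<close>, so it has to be assumed for all \<open>u\<close>
    simultaneously.\<close>
  have Q_dbl: "\<forall>u. u \<bullet> e 0 = 0 \<longrightarrow> C (t + t) u" if "\<forall>u. u \<bullet> e 0 = 0 \<longrightarrow> C t u" for t
  proof (intro allI impI)
    fix u assume u: "u \<bullet> e 0 = 0"
    have 1: "\<gamma> t + a u = a (shear t u) + \<gamma> t" and 2: "\<gamma> t + a (shear t u) = a (shear t (shear t u)) + \<gamma> t"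
      using that u unfolding C_def by auto
    have "\<gamma> t + \<gamma> t + a u = \<gamma> t + (a (shear t u) + \<gamma> t)" by (simp add: 1 add.assoc)
    also have "\<dots> = a (shear t (shear t u)) + (\<gamma> t + \<gamma> t)" by (simp add: 2 flip: add.assoc)
    finally show "C (t + t) u" unfolding C_def \<gamma>(1) by (simp only: shear_shear)
  qed
  have Q_pow: "\<forall>u. u \<bullet> e 0 = 0 \<longrightarrow> C (2 ^ k * t) u" if "norm t < d" for k t
  proof (induction k)
    case (Suc k)
    then show ?case using Q_dbl[OF Suc] by (simp add: algebra_simps)
  qed (use C_t[OF that] in simp)
  have Cc: "C t u" if "u \<bullet> e 0 = 0" for t u
  proof -
    obtain k where k: "norm t / d < 2 ^ k" using real_arch_pow[of 2] by force
    then have "norm (t / 2 ^ k) < d" using d by (simp add: field_simps norm_divide)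
    from Q_pow[OF this, of k] show ?thesis using that by simp
  qed
  show thesis
  proof
    define \<Psi> where "\<Psi> = (\<lambda>x. a (horiz x) + \<gamma> (x \<bullet> e 0))"
    show "a (horiz (mul x y)) + \<gamma> (mul x y \<bullet> e 0) = a (horiz x) + \<gamma> (x \<bullet> e 0) + (a (horiz y) + \<gamma> (y \<bullet> e 0))" for x y
    proof -
      have "\<gamma> (x \<bullet> e 0) + a (horiz y) = a (shear (x \<bullet> e 0) (horiz y)) + \<gamma> (x \<bullet> e 0)"
        using Cc[of "horiz y" "x \<bullet> e 0"] unfolding C_def by simp
      then show ?thesis by (simp add: horiz_mul a(1) \<gamma>(1) add.assoc) (simp flip: add.assoc)
    qed
    show "a (horiz x) + \<gamma> (x \<bullet> e 0) = \<sigma> x" if x: "norm x < d / 2" for x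
    proof -
      have h: "norm (horiz x) < d" using norm_horiz_le[of x] x by linarith
      have t: "norm (x \<bullet> e 0) < d" using Basis_le_norm[of "e 0" x] x d by simp
      have "a (horiz x) = a (horiz x + 0)" by simp
      have "x = horiz x + (x \<bullet> e 0) *\<^sub>R e 0" by (simp add: horiz_def)
      have "a x = a (horiz x) + a ((x \<bullet> e 0) *\<^sub>R e 0)" using a(1)[of "horiz x" "(x \<bullet> e 0) *\<^sub>R e 0"] by (simp add: horiz_def)
      moreover have "a x = \<sigma> (horiz x)" by (rule a(2)[OF x])
      moreover have "a ((x \<bullet> e 0) *\<^sub>R e 0) = 0"
      proof -
        have "norm ((x \<bullet> e 0) *\<^sub>R e 0) < d / 2" using Basis_le_norm[of "e 0" x] x by simp
        then have "a ((x \<bullet> e 0) *\<^sub>R e 0) = \<sigma> 0" using a(2) by (simp add: horiz_def e_inner)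
        also have "\<sigma> 0 = 0" by (rule group_idempotent_zero) (use \<sigma>[of 0 0] d in simp)
        finally show ?thesis .
      qed
      ultimately have "a (horiz x) = \<sigma> (horiz x)" by simp
      then have "a (horiz x) + \<gamma> (x \<bullet> e 0) = \<sigma> (mul (horiz x) ((x \<bullet> e 0) *\<^sub>R e 0))"
        using \<sigma>[OF h, of "(x \<bullet> e 0) *\<^sub>R e 0"] \<gamma>(2)[OF t] t by simp
      then show ?thesis by (simp add: mul_horiz) (simp add: horiz_def)
    qed
  qed
qed

text \<open>Discrete monodromy: along a sufficiently fine grid on a homotopy, lift each edge to a small
  element of the model group. Products of lifts around grid squares are trivial.\<close>

lemma monodromy_trivial:
  fixes \<Psi> :: "'e \<Rightarrow> 'g::{topological_group_add,t2_space}"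
  assumes hom: "\<And>x y. \<Psi> (mul x y) = \<Psi> x + \<Psi> y"
    and cont: "continuous_on UNIV \<Psi>" and d: "d > 0" and inj: "inj_on \<Psi> (ball 0 d)"
    and op: "\<And>S. open S \<Longrightarrow> S \<subseteq> ball 0 d \<Longrightarrow> open (\<Psi> ` S)"
    and sc: "simply_connected (UNIV :: 'g set)" and k: "\<Psi> k = 0"
  shows "k = 0"
proof -
  have \<Psi>0: "\<Psi> 0 = 0" by (rule group_idempotent_zero) (use hom[of 0 0] in simp)
  have \<Psi>inv: "\<Psi> (minv x) = - \<Psi> x" for x
    using hom[of "minv x" x] \<Psi>0 by (simp add: eq_neg_iff_add_eq_0)
  have o: "open ((\<lambda>z. mul (fst z) (snd z)) -` ball 0 d)"
    by (intro open_vimage open_ball continuous_on_mul continuous_intros)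
  have z: "(0, 0) \<in> (\<lambda>z. mul (fst z) (snd z)) -` ball 0 d" using d by simp
  obtain P Q where PQ': "open P" "open Q" "(0, 0) \<in> P \<times> Q" "P \<times> Q \<subseteq> (\<lambda>z. mul (fst z) (snd z)) -` ball 0 d"
    using open_prod_elim[OF o z] by metis
  then have PQ: "open P" "open Q" "0 \<in> P" "0 \<in> Q" "P \<times> Q \<subseteq> (\<lambda>z. mul (fst z) (snd z)) -` ball 0 d"
    by auto
  have "open (P \<inter> Q \<inter> ball 0 d)" "0 \<in> P \<inter> Q \<inter> ball 0 d" using PQ d by auto
  then obtain c where c: "c > 0" "ball 0 c \<subseteq> P \<inter> Q \<inter> ball 0 d" using open_contains_ball by meson
  have cd: "mul x y \<in> ball 0 d" if "x \<in> ball 0 c" "y \<in> ball 0 c" for x y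
  proof -
    have "(x, y) \<in> P \<times> Q" using that c by blast
    then show ?thesis using PQ(5) by auto
  qed
  define S where "S = \<Psi> ` ball 0 c"
  have S: "open S" "0 \<in> S" unfolding S_def using op[of "ball 0 c"] c \<Psi>0 by (auto intro: image_eqI[of _ _ 0])
  define l where "l = inv_into (ball 0 d) \<Psi>"
  have l: "l (\<Psi> x) = x" if "x \<in> ball 0 d" for x unfolding l_def using inj that by simp
  \<comment> \<open>The radius \<open>c\<close> was chosen so that products of two elements of
    \<open>ball 0 c\<close> remain in \<open>ball 0 d\<close>, where \<open>l\<close> inverts
    \<Psi>; hence \<open>l\<close> is multiplicative on \<open>S\<close>.\<close>
  have lS: "l (g + h) = mul (l g) (l h)" if gh: "g \<in> S" "h \<in> S" for g h
  proof -
    obtain x y where xy: "x \<in> ball 0 c" "y \<in> ball 0 c" "g = \<Psi> x" "h = \<Psi> y" using gh unfolding S_def by blast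
    have "l (\<Psi> (mul x y)) = mul x y" using l cd xy by blast
    moreover have "l (\<Psi> x) = x" "l (\<Psi> y) = y" using l xy(1,2) c(2) by blast+
    ultimately show ?thesis using xy hom by simp
  qed
  \<comment> \<open>The segment from 0 to \<open>k\<close> is mapped to a loop in the group because
    \<open>k\<close> lies in the kernel. Contracting this loop is the only use of simple
    connectedness.\<close>
  define p where "p = (\<lambda>t::real. \<Psi> (t *\<^sub>R k))"
  have "path p" unfolding p_def path_def
    by (rule continuous_on_compose2[OF cont]) (auto intro!: continuous_intros)
  moreover have "pathstart p = 0" "pathfinish p = 0" using \<Psi>0 k by (simp_all add: p_def pathstart_def pathfinish_def)
  ultimately have "homotopic_loops UNIV p (\<lambda>t. 0)"
    using sc unfolding simply_connected_def by (simp add: path_def pathstart_def pathfinish_def)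
  then obtain H where H: "continuous_on ({0..1::real} \<times> {0..1::real}) H"
    "\<And>x. x \<in> {0..1} \<Longrightarrow> H (0, x) = p x" "\<And>x. x \<in> {0..1} \<Longrightarrow> H (1, x) = 0"
    "\<And>t. t \<in> {0..1} \<Longrightarrow> H (t, 1) = H (t, 0)"
    unfolding homotopic_loops by (auto simp: pathstart_def pathfinish_def)
  let ?K = "{0..1::real} \<times> {0..1::real}"
  have cK: "compact ?K" by (intro compact_Times) auto
  obtain \<eta>1 where \<eta>1: "\<eta>1 > 0" "\<And>u v. u \<in> ?K \<Longrightarrow> v \<in> ?K \<Longrightarrow> dist u v < \<eta>1 \<Longrightarrow> - H u + H v \<in> S"
  proof -
    have ch: "continuous_on (?K \<times> ?K) (\<lambda>z. - H (fst z) + H (snd z))"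
      by (intro continuous_intros continuous_on_compose2[OF H(1)]) auto
    show thesis
    proof (rule diagonal_neighbourhood[OF cK ch S(1)])
      show "- H (fst (p, p)) + H (snd (p, p)) \<in> S" for p using S(2) by simp
      fix \<eta> :: real
      assume "\<eta> > 0" and h: "\<And>p q. p \<in> ?K \<Longrightarrow> q \<in> ?K \<Longrightarrow> dist p q < \<eta> \<Longrightarrow> - H (fst (p, q)) + H (snd (p, q)) \<in> S"
      show thesis by (rule that[OF \<open>\<eta> > 0\<close>]) (use h in simp)
    qed
  qed
  obtain \<eta>2 where \<eta>2: "\<eta>2 > 0" "\<And>u v. u \<in> {0..1} \<Longrightarrow> v \<in> {0..1} \<Longrightarrow> dist u v < \<eta>2 \<Longrightarrow>
      mul (minv (u *\<^sub>R k)) (v *\<^sub>R k) \<in> ball 0 c"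
  proof -
    have ch: "continuous_on ({0..1} \<times> {0..1}) (\<lambda>z. mul (minv (fst z *\<^sub>R k)) (snd z *\<^sub>R k))"
      by (intro continuous_on_mul continuous_on_minv continuous_intros)
    show thesis
    proof (rule diagonal_neighbourhood[OF compact_Icc ch open_ball[of 0 c]])
      show "mul (minv (fst (p, p) *\<^sub>R k)) (snd (p, p) *\<^sub>R k) \<in> ball 0 c" for p using c(1) by simp
      fix \<eta> :: real
      assume "\<eta> > 0" and h: "\<And>p q. p \<in> {0..1} \<Longrightarrow> q \<in> {0..1} \<Longrightarrow> dist p q < \<eta> \<Longrightarrow>
        mul (minv (fst (p, q) *\<^sub>R k)) (snd (p, q) *\<^sub>R k) \<in> ball 0 c"
      show thesis by (rule that[OF \<open>\<eta> > 0\<close>]) (use h in simp)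
    qed
  qed
  \<comment> \<open>Half of \<open>\<eta>1\<close>, since two corners of a grid square may differ by
    one mesh width in each of the two variables.\<close>
  obtain m where m: "inverse (real (Suc m)) < min (\<eta>1 / 2) \<eta>2"
    using reals_Archimedean[of "min (\<eta>1 / 2) \<eta>2"] \<eta>1 \<eta>2 by auto
  define n where "n = Suc m"
  have n: "n > 0" "1 / real n < \<eta>1 / 2" "1 / real n < \<eta>2" using m unfolding n_def by (auto simp: inverse_eq_divide)
  have fr: "real i / real n \<in> {0..1}" if "i \<le> n" for i using that n by (simp add: divide_le_eq_1)
  have dS: "\<bar>real i / real n - real i' / real n\<bar> \<le> 1 / real n" if "i' = i \<or> i' = Suc i" for i i'
    using that n(1) by (auto simp: diff_divide_distrib[symmetric])
  define g where "g = (\<lambda>j i. H (real j / real n, real i / real n))"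
  have near: "- g j i + g j' i' \<in> S" if "j' = j \<or> j' = Suc j" "i' = i \<or> i' = Suc i" "j' \<le> n" "i' \<le> n" for j i j' i'
  proof -
    let ?u = "(real j / real n, real i / real n)" and ?v = "(real j' / real n, real i' / real n)"
    have "dist ?u ?v \<le> \<bar>real j / real n - real j' / real n\<bar> + \<bar>real i / real n - real i' / real n\<bar>"
      unfolding dist_Pair_Pair dist_real_def using sqrt_sum_squares_le_sum_abs by (simp add: real_sqrt_abs2)
    also have "\<dots> < \<eta>1" using dS[OF that(1)] dS[OF that(2)] n(2) by linarith
    finally have "dist ?u ?v < \<eta>1" .
    moreover have "?u \<in> ?K" "?v \<in> ?K" using that fr[of j] fr[of i] fr[of j'] fr[of i'] by auto
    ultimately show ?thesis unfolding g_def by (intro \<eta>1(2))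
  qed
  define eh where "eh = (\<lambda>j i. l (- g j i + g j (Suc i)))"
  define ev where "ev = (\<lambda>j i. l (- g j i + g (Suc j) i))"
  have sq: "mul (eh j i) (ev j (Suc i)) = mul (ev j i) (eh (Suc j) i)" if "j < n" "i < n" for i j
  proof -
    have "mul (eh j i) (ev j (Suc i)) = l ((- g j i + g j (Suc i)) + (- g j (Suc i) + g (Suc j) (Suc i)))"
      unfolding eh_def ev_def using that by (intro lS[symmetric] near) auto
    also have "(- g j i + g j (Suc i)) + (- g j (Suc i) + g (Suc j) (Suc i)) = - g j i + g (Suc j) (Suc i)"
      by (simp add: add.assoc)
    also have "\<dots> = (- g j i + g (Suc j) i) + (- g (Suc j) i + g (Suc j) (Suc i))"
      by (simp add: add.assoc)
    also have "l \<dots> = mul (ev j i) (eh (Suc j) i)"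
      unfolding eh_def ev_def using that by (intro lS near) auto
    finally show ?thesis .
  qed
  \<comment> \<open>The product of the lifts of the first \<open>m\<close> horizontal edges in row
    \<open>j\<close> of the grid.\<close>
  define R where "R = (\<lambda>j m. rec_nat 0 (\<lambda>i r. mul r (eh j i)) m)"
  have R0: "R j 0 = 0" and RS: "R j (Suc i) = mul (R j i) (eh j i)" for j i unfolding R_def by simp_all
  have row: "mul (R j i) (ev j i) = mul (ev j 0) (R (Suc j) i)" if "j < n" "i \<le> n" for j i
    using that(2)
  proof (induction i)
    case (Suc i)
    have "mul (R j (Suc i)) (ev j (Suc i)) = mul (R j i) (mul (ev j i) (eh (Suc j) i))"
      using sq[of j i] that Suc by (simp add: RS mul_assoc)
    also have "\<dots> = mul (ev j 0) (R (Suc j) (Suc i))" using Suc by (simp add: RS flip: mul_assoc)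
    finally show ?case .
  qed (simp add: R0)
  have gn: "g j n = g j 0" if "j \<le> n" for j unfolding g_def using H(4)[OF fr[OF that]] n(1) by simp
  \<comment> \<open>The rows are loops, so the vertical edges at both ends of a row have the same
    lift. The products over adjacent rows are then conjugate, and triviality passes from row
    \<open>Suc j\<close> down to row \<open>j\<close>.\<close>
  have conj: "R (Suc j) n = 0 \<Longrightarrow> R j n = 0" if "j < n" for j
  proof -
    assume "R (Suc j) n = 0"
    moreover have "ev j n = ev j 0" unfolding ev_def using gn that by simp
    ultimately have "mul (R j n) (ev j 0) = ev j 0" using row[of j n] that by simp
    then have "mul (mul (R j n) (ev j 0)) (minv (ev j 0)) = mul (ev j 0) (minv (ev j 0))" by simp
    then show "R j n = 0" by (simp add: mul_assoc)
  qed
  have l0: "l 0 = 0" using l[of 0] \<Psi>0 d by simp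
  have top: "R n i = 0" if "i \<le> n" for i
    using that
  proof (induction i)
    case (Suc i)
    have "g n i = 0" "g n (Suc i) = 0" unfolding g_def using H(3)[OF fr[of i]] H(3)[OF fr[of "Suc i"]] Suc n(1) by auto
    then show ?case using Suc by (simp add: RS eh_def l0)
  qed (simp add: R0)
  have "R (n - j) n = 0" if "j \<le> n" for j
    using that
  proof (induction j)
    case (Suc j)
    have "Suc (n - Suc j) = n - j" using Suc by simp
    then show ?case using conj[of "n - Suc j"] Suc by simp
  qed (simp add: top)
  then have R00: "R 0 n = 0" by (metis diff_self_eq_0 order_refl)
  \<comment> \<open>In row 0 the lifts are the small quotients of consecutive points on the segment
    to \<open>k\<close>, so their product telescopes. At \<open>i = n\<close> it equals
    \<open>k\<close>.\<close>
  have "R 0 i = (real i / real n) *\<^sub>R k" if "i \<le> n" for i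
    using that
  proof (induction i)
    case (Suc i)
    let ?u = "real i / real n" and ?v = "real (Suc i) / real n"
    have b: "mul (minv (?u *\<^sub>R k)) (?v *\<^sub>R k) \<in> ball 0 c"
      using dS[of "Suc i" i] n(3) Suc fr[of i] fr[of "Suc i"] by (intro \<eta>2(2)) (auto simp: dist_real_def)
    then have bd: "mul (minv (?u *\<^sub>R k)) (?v *\<^sub>R k) \<in> ball 0 d" using c(2) by blast
    have "- g 0 i + g 0 (Suc i) = \<Psi> (mul (minv (?u *\<^sub>R k)) (?v *\<^sub>R k))"
      unfolding g_def using H(2)[OF fr[of i]] H(2)[OF fr[of "Suc i"]] Suc by (simp add: p_def hom \<Psi>inv)
    then have "eh 0 i = mul (minv (?u *\<^sub>R k)) (?v *\<^sub>R k)" unfolding eh_def using l[OF bd] by simp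
    then show ?case using Suc by (simp add: RS)
  qed (simp add: R0)
  from this[of n] show ?thesis using R00 n(1) by simp
qed

text \<open>Continuity spreads from the ball by translation, and injectivity is triviality of the
  kernel, supplied by \<open>monodromy_trivial\<close>. The range is an open subgroup whose
  complement, a union of cosets, is open as well, so connectedness gives surjectivity.\<close>

lemma global_isomorphism:
  fixes \<sigma> :: "'e \<Rightarrow> 'g::{topological_group_add,t2_space}"
  assumes conn: "connected (UNIV :: 'g set)" and sc: "simply_connected (UNIV :: 'g set)"
    and d: "d > 0" and \<sigma>: "\<And>x y. norm x < d \<Longrightarrow> norm y < d \<Longrightarrow> \<sigma> (mul x y) = \<sigma> x + \<sigma> y"
    and cont: "continuous_on (ball 0 d) \<sigma>" and inj: "inj_on \<sigma> (ball 0 d)"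
    and op: "\<And>S. open S \<Longrightarrow> S \<subseteq> ball 0 d \<Longrightarrow> open (\<sigma> ` S)"
  obtains \<Psi> where "bij \<Psi>" "continuous_on UNIV \<Psi>" "\<And>x y. \<Psi> (mul x y) = \<Psi> x + \<Psi> y" "\<And>x. norm x < d / 2 \<Longrightarrow> \<Psi> x = \<sigma> x"
proof -
  obtain \<Psi> where hom: "\<And>x y. \<Psi> (mul x y) = \<Psi> x + \<Psi> y" and loc: "\<And>x. norm x < d / 2 \<Longrightarrow> \<Psi> x = \<sigma> x"
    using global_hom[OF d \<sigma>] by blast
  have \<Psi>0: "\<Psi> 0 = 0" by (rule group_idempotent_zero) (use hom[of 0 0] in simp)
  have \<Psi>inv: "\<Psi> (minv x) = - \<Psi> x" for x
    using hom[of "minv x" x] \<Psi>0 by (simp add: eq_neg_iff_add_eq_0)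
  let ?B = "ball (0::'e) (d / 2)"
  have B: "?B \<subseteq> ball 0 d" using d by auto
  have op2: "open (\<Psi> ` S)" if "open S" "S \<subseteq> ?B" for S
  proof -
    have "\<Psi> ` S = \<sigma> ` S" by (rule image_cong) (use loc that(2) in auto)
    then show ?thesis using op[OF that(1)] that(2) B by auto
  qed
  have contB: "continuous_on ?B \<Psi>"
    by (rule continuous_on_eq[OF continuous_on_subset[OF cont B]]) (simp add: loc)
  have c: "continuous_on UNIV \<Psi>"
  proof (rule continuous_at_imp_continuous_on, rule ballI)
    fix x
    have o: "open ((\<lambda>y. mul (minv x) y) -` ?B)"
      by (intro open_vimage open_ball continuous_on_mul continuous_intros)
    have "continuous_on ((\<lambda>y. mul (minv x) y) -` ?B) (\<lambda>y. \<Psi> x + \<Psi> (mul (minv x) y))"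
      by (intro continuous_on_add continuous_on_const continuous_on_compose2[OF contB] continuous_on_mul continuous_on_id) auto
    then have "continuous_on ((\<lambda>y. mul (minv x) y) -` ?B) \<Psi>"
      by (rule continuous_on_eq) (simp flip: hom)
    then show "isCont \<Psi> x" using o d by (simp add: continuous_on_eq_continuous_at)
  qed
  have i: "inj_on \<Psi> ?B"
    using inj_on_subset[OF inj B] by (metis (no_types, lifting) inj_on_cong loc mem_ball_0)
  have ker: "k = 0" if "\<Psi> k = 0" for k
    by (rule monodromy_trivial[OF hom c _ i op2 sc that]) (use d in simp)
  have "inj \<Psi>"
  proof (rule injI)
    fix x y assume "\<Psi> x = \<Psi> y"
    then have "\<Psi> (mul (minv x) y) = 0" by (simp add: hom \<Psi>inv)
    then have "mul (minv x) y = 0" by (rule ker)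
    then have "mul x (mul (minv x) y) = mul x 0" by simp
    then show "x = y" by simp
  qed
  moreover have "surj \<Psi>"
  proof -
    have o: "open (\<Psi> ` ?B)" by (rule op2) auto
    have z: "0 \<in> \<Psi> ` ?B" using \<Psi>0 d by (intro image_eqI[of _ _ 0]) auto
    have "open (range \<Psi>)"
    proof (subst open_subopen, rule ballI)
      fix g assume "g \<in> range \<Psi>"
      then obtain x where x: "g = \<Psi> x" by blast
      have "(+) g ` (\<Psi> ` ?B) \<subseteq> range \<Psi>" using x by (auto simp flip: hom)
      moreover have "g \<in> (+) g ` (\<Psi> ` ?B)" by (rule image_eqI[of _ _ 0]) (simp, rule z)
      ultimately show "\<exists>T. open T \<and> g \<in> T \<and> T \<subseteq> range \<Psi>" using open_left_translate[OF o] by blast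
    qed
    moreover have "open (- range \<Psi>)"
    proof (subst open_subopen, rule ballI)
      fix g assume g: "g \<in> - range \<Psi>"
      have "(+) g ` (\<Psi> ` ?B) \<subseteq> - range \<Psi>"
      proof safe
        fix x y assume "x \<in> ?B" "g + \<Psi> x = \<Psi> y"
        then have "g = \<Psi> (mul y (minv x))" by (simp add: hom \<Psi>inv flip: \<open>g + \<Psi> x = \<Psi> y\<close>)
        then show False using g by blast
      qed
      moreover have "g \<in> (+) g ` (\<Psi> ` ?B)" by (rule image_eqI[of _ _ 0]) (simp, rule z)
      ultimately show "\<exists>T. open T \<and> g \<in> T \<and> T \<subseteq> - range \<Psi>" using open_left_translate[OF o] by blast
    qed
    moreover have "range \<Psi> \<noteq> {}" by simp
    ultimately have "- range \<Psi> = {}" using conn unfolding connected_def by blast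
    then show ?thesis by blast
  qed
  ultimately show thesis using that[of \<Psi>] c hom loc unfolding bij_def by blast
qed

end

section \<open>Global coordinates on a filiform group\<close>

context filiform_chart
begin

text \<open>Near a point \<open>a\<close> both the coordinates and their inverse are the local
  isomorphism conjugated by left translations, which are smooth on either side. The formula for
  \<open>X j\<close> is the chain rule through \<open>mul (f a) (F y)\<close>, whose derivative at
  \<open>p0\<close> is \<open>inv \<kappa>\<close> followed by a shear.\<close>

lemma global_coordinates:
  assumes conn: "connected (UNIV :: 'g set)" and sc: "simply_connected (UNIV :: 'g set)"
  obtains f :: "'g \<Rightarrow> 'e" where "diffeomorphism A euclidean_atlas f" "\<And>x y. f (x + y) = mul (f x) (f y)"
    "\<And>h j a. smooth_on UNIV h \<Longrightarrow> j \<le> s \<Longrightarrow>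
       X j (\<lambda>x. h (f x)) a = frechet_derivative h (at (f a)) (shear (f a \<bullet> e 0) (e j))"
proof -
  obtain W N F g where W: "open W" "W \<subseteq> \<phi> ` U" "p0 \<in> W" and N: "open N" and hom: "homeomorphism W N F g"
    and F: "smooth_on W F" "F p0 = 0" "(F has_derivative inv \<kappa>) (at p0)" and g: "smooth_on N g"
    and ex: "\<exists>d>0. ball p0 d \<subseteq> W \<and> (\<forall>x\<in>ball p0 d. \<forall>y\<in>ball p0 d. (x, y) \<in> mu_dom \<and> mu (x, y) \<in> W \<and>
       F (mu (x, y)) = mul (F x) (F y))"
    using local_isomorphism by metis
  obtain d where d: "d > 0" "ball p0 d \<subseteq> W"
    and dm: "\<And>x y. x \<in> ball p0 d \<Longrightarrow> y \<in> ball p0 d \<Longrightarrow> (x, y) \<in> mu_dom \<and> mu (x, y) \<in> W \<and>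
       F (mu (x, y)) = mul (F x) (F y)"
    using ex by blast
  have gF: "g (F x) = x" "F x \<in> N" if "x \<in> W" for x using hom that unfolding homeomorphism_def by auto
  have Fg: "F (g y) = y" "g y \<in> W" if "y \<in> N" for y using hom that unfolding homeomorphism_def by auto
  have g0: "g 0 = p0" "0 \<in> N" using gF[OF W(3)] F(2) by auto
  have contg: "continuous_on N g" and contF: "continuous_on W F" using hom unfolding homeomorphism_def by auto
  have "open (N \<inter> g -` ball p0 d)" by (rule continuous_open_preimage[OF contg N open_ball])
  moreover have "0 \<in> N \<inter> g -` ball p0 d" using g0 d by simp
  ultimately obtain c where c: "c > 0" "ball 0 c \<subseteq> N \<inter> g -` ball p0 d" using open_contains_ball by meson
  define \<sigma> where "\<sigma> = (\<lambda>z. \<tau> (g z))"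
  have g_open: "open (g ` S)" if "open S" "S \<subseteq> N" for S
  proof -
    have "g ` S = W \<inter> F -` S"
    proof (intro equalityI subsetI)
      fix x assume "x \<in> g ` S" then show "x \<in> W \<inter> F -` S" using Fg that by auto
    next
      fix x assume "x \<in> W \<inter> F -` S" then show "x \<in> g ` S" using gF(1)[of x] by (metis IntE imageI vimageE)
    qed
    then show ?thesis using continuous_open_preimage[OF contF W(1) that(1)] by simp
  qed
  have \<tau>_open: "open (\<tau> ` S)" if "open S" "S \<subseteq> \<phi> ` U" for S
  proof -
    have "\<tau> ` S = U \<inter> \<phi> -` S"
    proof (intro equalityI subsetI)
      fix x assume "x \<in> \<tau> ` S"
      then obtain y where y: "y \<in> S" "x = \<tau> y" by blast
      then have "y \<in> \<phi> ` U" using that by blast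
      then show "x \<in> U \<inter> \<phi> -` S" using y by simp
    next
      fix x assume "x \<in> U \<inter> \<phi> -` S" then show "x \<in> \<tau> ` S" by (metis IntE \<tau>_\<phi> imageI vimageE)
    qed
    then show ?thesis using continuous_open_preimage[OF chart_facts(3,1) that(1)] by simp
  qed
  have hom\<sigma>: "\<sigma> (mul x y) = \<sigma> x + \<sigma> y" if "norm x < c" "norm y < c" for x y
  proof -
    have xy: "x \<in> N" "y \<in> N" "g x \<in> ball p0 d" "g y \<in> ball p0 d" using that c by auto
    note m = dm[OF xy(3,4)]
    have "g (F (mu (g x, g y))) = mu (g x, g y)" using m gF by blast
    moreover have "F (mu (g x, g y)) = mul x y" using m Fg(1)[OF xy(1)] Fg(1)[OF xy(2)] by simp
    ultimately have "g (mul x y) = mu (g x, g y)" by simp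
    then have "\<sigma> (mul x y) = \<tau> (\<phi> (\<tau> (g x) + \<tau> (g y)))" unfolding \<sigma>_def by (simp add: mu_def)
    then show ?thesis using m unfolding \<sigma>_def mu_dom_iff by simp
  qed
  have cN: "ball 0 c \<subseteq> N" using c by blast
  have gU: "g ` ball 0 c \<subseteq> \<phi> ` U" using cN Fg W(2) by blast
  have cont\<sigma>: "continuous_on (ball 0 c) \<sigma>" unfolding \<sigma>_def
    by (rule continuous_on_compose2[OF \<tau>_continuous continuous_on_subset[OF contg cN] gU])
  have inj\<sigma>: "inj_on \<sigma> (ball 0 c)"
  proof (rule inj_on_inverseI)
    fix x assume "x \<in> ball (0::'e) c"
    then have "g x \<in> \<phi> ` U" "x \<in> N" using gU cN by auto
    then show "F (\<phi> (\<sigma> x)) = x" using Fg unfolding \<sigma>_def by simp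
  qed
  have op\<sigma>: "open (\<sigma> ` S)" if "open S" "S \<subseteq> ball 0 c" for S
  proof -
    have "open (\<tau> ` (g ` S))" by (rule \<tau>_open[OF g_open[OF that(1)]]) (use that(2) cN gU in blast)+
    then show ?thesis unfolding \<sigma>_def by (simp add: image_image)
  qed
  obtain \<Psi> where bij: "bij \<Psi>" and cont: "continuous_on UNIV \<Psi>" and h\<Psi>: "\<And>x y. \<Psi> (mul x y) = \<Psi> x + \<Psi> y"
    and loc: "\<And>x. norm x < c / 2 \<Longrightarrow> \<Psi> x = \<sigma> x"
    using global_isomorphism[OF conn sc c(1) hom\<sigma> cont\<sigma> inj\<sigma> op\<sigma>] by metis
  define f where "f = inv \<Psi>"
  have f\<Psi>: "f (\<Psi> z) = z" and \<Psi>f: "\<Psi> (f x) = x" for z x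
    unfolding f_def using bij by (simp_all add: bij_is_inj bij_is_surj surj_f_inv_f)
  have inj\<Psi>: "\<Psi> x = \<Psi> y \<longleftrightarrow> x = y" for x y by (metis f\<Psi>)
  have fadd: "f (x + y) = mul (f x) (f y)" for x y
    using inj\<Psi>[of "f (x + y)" "mul (f x) (f y)"] by (simp add: h\<Psi> \<Psi>f)
  let ?B = "ball (0::'e) (c / 2)"
  define G where "G = g ` ?B"
  have BN: "?B \<subseteq> N" using cN c(1) by (auto simp: subset_iff)
  have "open G" unfolding G_def by (rule g_open[OF open_ball BN])
  moreover have "p0 \<in> G" unfolding G_def by (rule image_eqI[of _ _ 0]) (use g0 c(1) in auto)
  moreover have "G \<subseteq> W" unfolding G_def using Fg(2) BN by blast
  ultimately have G: "open G" "p0 \<in> G" "G \<subseteq> W" "G \<subseteq> \<phi> ` U" using W(2) by auto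
  have f\<tau>: "f (\<tau> y) = F y" if y: "y \<in> G" for y
  proof -
    obtain z where z: "z \<in> ?B" "y = g z" using y unfolding G_def by blast
    have "\<Psi> z = \<tau> y" using loc[of z] z unfolding \<sigma>_def by simp
    then have "f (\<tau> y) = z" using f\<Psi> by metis
    then show ?thesis using z BN Fg by auto
  qed
  have smf: "smooth_map A euclidean_atlas f"
  proof (rule smooth_funI[OF charted])
    fix V \<psi> assume v: "(V, \<psi>) \<in> A"
    note b = chartedD[OF charted v]
    show "smooth_on (\<psi> ` V) (\<lambda>x. f (inv_into V \<psi> x))"
    proof (rule smooth_on_local)
      fix x assume "x \<in> \<psi> ` V"
      then obtain a where a: "a \<in> V" "x = \<psi> a" by blast
      let ?L = "\<lambda>z. - a + z"
      have oG: "open (\<tau> ` G)" by (rule \<tau>_open[OF G(1,4)])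
      have oL: "open (?L -` (\<tau> ` G))" by (intro open_vimage oG continuous_intros)
      define T where "T = \<psi> ` (V \<inter> ?L -` (\<tau> ` G))"
      have T: "open T" unfolding T_def using b oL by blast
      have "smooth_on (\<psi> ` (V \<inter> ?L -` U)) (\<lambda>x. \<phi> (- a + inv_into V \<psi> x))"
        by (rule smooth_mapD[OF smooth_left_translation v chart])
      then have sY: "smooth_on T (\<lambda>x. \<phi> (- a + inv_into V \<psi> x))"
        by (rule smooth_on_subset) (use G(4) in \<open>auto simp: T_def\<close>)
      have Y: "\<phi> (- a + inv_into V \<psi> x) \<in> G" "\<tau> (\<phi> (- a + inv_into V \<psi> x)) = - a + inv_into V \<psi> x" if x: "x \<in> T" for x
      proof -
        obtain u y where u: "u \<in> V" "- a + u = \<tau> y" "y \<in> G" "x = \<psi> u" using x unfolding T_def by auto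
        then have "inv_into V \<psi> x = u" using b by simp
        then show "\<phi> (- a + inv_into V \<psi> x) \<in> G" "\<tau> (\<phi> (- a + inv_into V \<psi> x)) = - a + inv_into V \<psi> x"
          using u G(4) by auto
      qed
      have "smooth_on T (\<lambda>x. F (\<phi> (- a + inv_into V \<psi> x)))"
        by (rule smooth_on_compose[OF T W(1) sY F(1)]) (use Y G(3) in auto)
      then have "smooth_on T (\<lambda>x. mul (f a) (F (\<phi> (- a + inv_into V \<psi> x))))"
        by (intro smooth_on_mul T smooth_on_const)
      moreover have "mul (f a) (F (\<phi> (- a + inv_into V \<psi> x))) = f (inv_into V \<psi> x)" if "x \<in> T" for x
      proof -
        have "F (\<phi> (- a + inv_into V \<psi> x)) = f (- a + inv_into V \<psi> x)"
          using f\<tau>[OF Y(1)[OF that]] Y(2)[OF that] by simp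
        then show ?thesis by (simp flip: fadd add.assoc)
      qed
      ultimately have "smooth_on T (\<lambda>x. f (inv_into V \<psi> x))"
        using smooth_on_cong_open[OF T] by (metis (no_types, lifting))
      moreover have "0 \<in> \<tau> ` G" using G(2) \<tau>_p0 by (metis imageI)
      then have "x \<in> T" unfolding T_def a(2) using a(1) by (intro imageI) simp
      ultimately show "\<exists>T. open T \<and> x \<in> T \<and> smooth_on T (\<lambda>x. f (inv_into V \<psi> x))" using T by blast
    qed
  qed
  have smPsi_chart: "smooth_on (\<Psi> -` V) (\<lambda>z. \<psi> (\<Psi> z))" if v: "(V, \<psi>) \<in> A" for V \<psi>
  proof (rule smooth_on_local)
    fix z0 assume z0: "z0 \<in> \<Psi> -` V"
    note b = chartedD[OF charted v]
    define T where "T = (mul (minv z0) -` ?B) \<inter> \<Psi> -` V"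
    have "open (mul (minv z0) -` ?B)" by (intro open_vimage open_ball continuous_on_mul continuous_intros)
    moreover have "open (\<Psi> -` V)" by (rule open_vimage[OF b(1) cont])
    ultimately have T: "open T" unfolding T_def by blast
    let ?a = "\<Psi> z0"
    have oU: "open (\<phi> ` (U \<inter> (\<lambda>x. ?a + x) -` V))"
      by (intro chart_facts(4) open_Int chart_facts(1) open_vimage[OF b(1)] continuous_intros) auto
    have s1: "smooth_on (\<phi> ` (U \<inter> (\<lambda>x. ?a + x) -` V)) (\<lambda>y. \<psi> (?a + \<tau> y))"
      using smooth_mapD[OF smooth_left_translation chart v] unfolding \<tau>_def .
    have eq: "\<Psi> z = ?a + \<tau> (g (mul (minv z0) z))" "g (mul (minv z0) z) \<in> \<phi> ` U" "mul (minv z0) z \<in> N" if "z \<in> T" for z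
    proof -
      have B: "mul (minv z0) z \<in> ?B" using that unfolding T_def by auto
      have "\<Psi> (mul z0 (mul (minv z0) z)) = ?a + \<tau> (g (mul (minv z0) z))"
        using loc[of "mul (minv z0) z"] B by (simp only: h\<Psi>) (simp add: \<sigma>_def)
      then show "\<Psi> z = ?a + \<tau> (g (mul (minv z0) z))" by simp
      show "mul (minv z0) z \<in> N" using B BN by blast
      then show "g (mul (minv z0) z) \<in> \<phi> ` U" using Fg W(2) by blast
    qed
    have s2: "smooth_on T (\<lambda>z. g (mul (minv z0) z))"
      by (rule smooth_on_compose[OF T N smooth_on_mul g]) (use T eq in auto)
    have "smooth_on T (\<lambda>z. \<psi> (?a + \<tau> (g (mul (minv z0) z))))"
    proof (rule smooth_on_compose[OF T oU s2 s1], rule image_subsetI)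
      fix z assume z: "z \<in> T"
      then have "\<Psi> z \<in> V" unfolding T_def by auto
      then show "g (mul (minv z0) z) \<in> \<phi> ` (U \<inter> (\<lambda>x. ?a + x) -` V)"
        using eq[OF z] by (intro image_eqI[of _ _ "\<tau> (g (mul (minv z0) z))"]) auto
    qed
    then have "smooth_on T (\<lambda>z. \<psi> (\<Psi> z))"
      by (rule iffD1[OF smooth_on_cong_open[OF T], rotated]) (simp add: eq(1)[symmetric])
    moreover have "z0 \<in> T" unfolding T_def using z0 c(1) by simp
    ultimately show "\<exists>T. open T \<and> z0 \<in> T \<and> smooth_on T (\<lambda>z. \<psi> (\<Psi> z))" using T by blast
  qed
  have smPsi: "smooth_map euclidean_atlas A \<Psi>"
    unfolding smooth_map_def
  proof (intro conjI cont ballI)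
    fix z :: "('e, 'e) chart" assume z: "z \<in> euclidean_atlas"
    then have z': "z = (UNIV, \<lambda>x. x)" by (simp add: euclidean_atlas_def)
    have "inv_into UNIV (\<lambda>x::'e. x) = (\<lambda>x. x)" by (rule ext) (simp add: inv_into_def)
    then show "case z of (U, \<phi>) \<Rightarrow> \<forall>(V, \<psi>)\<in>A. smooth_on (\<phi> ` (U \<inter> \<Psi> -` V)) (\<psi> \<circ> \<Psi> \<circ> inv_into U \<phi>)"
      unfolding z' using smPsi_chart by (auto simp: comp_def)
  qed
  have invf: "inv f = \<Psi>" unfolding f_def using bij by (simp add: inv_inv_eq)
  have bijf: "bij f" unfolding f_def using bij by (rule bij_imp_bij_inv)
  show thesis
  proof (rule that)
    show "diffeomorphism A euclidean_atlas f"
      unfolding diffeomorphism_def invf using bijf smf smPsi by blast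
    show "f (x + y) = mul (f x) (f y)" for x y by (rule fadd)
    fix h :: "'e \<Rightarrow> real" and j a
    assume h: "smooth_on UNIV h" and j: "j \<le> s"
    have sh: "smooth_fun A (\<lambda>x. h (f x))"
      by (rule smooth_map_compose[OF charted charted_euclidean charted_euclidean smf])
        (simp add: smooth_map_euclidean_iff h)
    have fa: "mul (f a) (F p0) = f a" using F(2) by simp
    have "((\<lambda>y. mul (f a) (F y)) has_derivative (\<lambda>v. shear (f a \<bullet> e 0) (inv \<kappa> v))) (at p0)"
      by (rule has_derivative_compose[OF F(3) mul_has_derivative])
    moreover have "(h has_derivative frechet_derivative h (at (f a))) (at (mul (f a) (F p0)))"
      unfolding fa by (rule smooth_on_has_derivative[OF h UNIV_I])
    ultimately have "((\<lambda>y. h (mul (f a) (F y))) has_derivative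
        (\<lambda>v. frechet_derivative h (at (f a)) (shear (f a \<bullet> e 0) (inv \<kappa> v)))) (at p0)"
      by (rule has_derivative_compose)
    then have "((\<lambda>y. h (f (a + \<tau> y))) has_derivative
        (\<lambda>v. frechet_derivative h (at (f a)) (shear (f a \<bullet> e 0) (inv \<kappa> v)))) (at p0)"
      by (rule has_derivative_transform_within_open[OF _ G(1,2)]) (simp add: fadd f\<tau>)
    from lvf_eqI[OF sh this, of "\<kappa> (e j)"]
    show "X j (\<lambda>x. h (f x)) a = frechet_derivative h (at (f a)) (shear (f a \<bullet> e 0) (e j))"
      using lvf_\<kappa>[OF j] by simp
  qed
qed

end

lemma filiform_coordinates:
  fixes A :: "('g::{topological_group_add,t2_space,second_countable_topology},
               'e::euclidean_space) chart set"
  assumes fil: "filiform_first_kind A s X" and s: "1 \<le> s"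
  obtains e and f :: "'g \<Rightarrow> 'e" where "filiform_model e s" "diffeomorphism A euclidean_atlas f"
    "\<And>x y. f (x + y) = filiform_model.mul e s (f x) (f y)"
    "\<And>h j a. smooth_on UNIV h \<Longrightarrow> j \<le> s \<Longrightarrow>
       X j (\<lambda>x. h (f x)) a = frechet_derivative h (at (f a)) (filiform_model.shear e s (f a \<bullet> e 0) (e j))"
proof -
  have lie: "lie_group A" and dim: "DIM('e) = s + 1" and conn: "connected (UNIV :: 'g set)"
    and sc: "simply_connected (UNIV :: 'g set)" and basis: "lie_algebra_basis A s X"
    and br: "\<And>j. 2 \<le> j \<Longrightarrow> j \<le> s \<Longrightarrow> vf_bracket (X 0) (X (j - 1)) = X j"
      "vf_bracket (X 0) (X s) = vf_zero"
      "\<And>i j. 1 \<le> i \<Longrightarrow> i \<le> s \<Longrightarrow> 1 \<le> j \<Longrightarrow> j \<le> s \<Longrightarrow> vf_bracket (X i) (X j) = vf_zero"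
    using fil unfolding filiform_first_kind_def by auto
  obtain e where e: "bij_betw e {..s} (Basis :: 'e set)"
    using finite_same_card_bij[of "{..s}" "Basis :: 'e set"] dim by auto
  interpret lie_grp A by unfold_locales (rule lie)
  obtain U \<phi> where c: "(U, \<phi>) \<in> A" "(0::'g) \<in> U" using charted_chart_at[OF charted] by metis
  interpret lie_grp_chart A U \<phi> by unfold_locales (rule c)+
  obtain \<kappa> where \<kappa>: "linear \<kappa>" "bij \<kappa>" "\<And>j. j \<le> s \<Longrightarrow> lvf (\<kappa> (e j)) = X j"
    using lie_algebra_basis_tangent[OF basis e] by blast
  interpret filiform_model e s by unfold_locales (rule e, rule s)
  interpret filiform_chart A U \<phi> e s X \<kappa> 
    by unfold_locales (rule linear_add[OF \<kappa>(1)] linear_scale[OF \<kappa>(1)] \<kappa>(2,3) br; assumption)+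
  show thesis
  proof (rule global_coordinates[OF conn sc])
    fix f :: "'g \<Rightarrow> 'e"
    assume f: "diffeomorphism A euclidean_atlas f" "\<And>x y. f (x + y) = mul (f x) (f y)"
      "\<And>h j a. smooth_on UNIV h \<Longrightarrow> j \<le> s \<Longrightarrow>
         X j (\<lambda>x. h (f x)) a = frechet_derivative h (at (f a)) (shear (f a \<bullet> e 0) (e j))"
    show thesis by (rule that[OF filiform_model_axioms f])
  qed
qed

section \<open>Lebesgue measure as Haar measure of the model group\<close>

definition lborel_preserving :: "('e::euclidean_space \<Rightarrow> 'e) \<Rightarrow> bool" where
  "lborel_preserving T \<longleftrightarrow> T \<in> borel_measurable borel \<and> distr lborel borel T = lborel"

lemma lborel_preserving_nn_integral:
  assumes "lborel_preserving T" "F \<in> borel_measurable borel"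
  shows "(\<integral>\<^sup>+x. F (T x) \<partial>lborel) = (\<integral>\<^sup>+x. F x \<partial>lborel)"
proof -
  have "(\<integral>\<^sup>+x. F x \<partial>lborel) = (\<integral>\<^sup>+x. F x \<partial>distr lborel borel T)"
    using assms(1) unfolding lborel_preserving_def by simp
  also have "\<dots> = (\<integral>\<^sup>+x. F (T x) \<partial>lborel)"
    using assms unfolding lborel_preserving_def by (intro nn_integral_distr) auto
  finally show ?thesis by simp
qed

lemma lborel_preservingI:
  assumes T[measurable]: "T \<in> borel_measurable borel"
    and F: "\<And>F :: 'e \<Rightarrow> ennreal. F \<in> borel_measurable borel \<Longrightarrow>
      (\<integral>\<^sup>+x. F (T x) \<partial>lborel) = (\<integral>\<^sup>+x. F x \<partial>(lborel :: 'e::euclidean_space measure))"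
  shows "lborel_preserving T"
proof -
  have "distr lborel borel T = lborel"
  proof (rule measure_eqI)
    fix B assume "B \<in> sets (distr lborel borel T)"
    then have B[measurable]: "B \<in> sets borel" by simp
    have "emeasure (distr lborel borel T) B = emeasure lborel (T -` B)" by (subst emeasure_distr) auto
    also have "\<dots> = (\<integral>\<^sup>+x. indicator (T -` B) x \<partial>lborel)"
      by (rule nn_integral_indicator[symmetric]) (use measurable_sets[OF T B] in simp)
    also have "\<dots> = (\<integral>\<^sup>+x. indicator B (T x) \<partial>lborel)"
      by (rule nn_integral_cong) (simp add: indicator_def)
    also have "\<dots> = emeasure lborel B" using F[of "indicator B"] by simp
    finally show "emeasure (distr lborel borel T) B = emeasure lborel B" .
  qed simp
  then show ?thesis unfolding lborel_preserving_def using T by simp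
qed

lemma lborel_preserving_compose:
  assumes S: "lborel_preserving S" and T: "lborel_preserving T"
  shows "lborel_preserving (\<lambda>x. S (T x))"
proof (rule lborel_preservingI)
  have [measurable]: "S \<in> borel_measurable borel" "T \<in> borel_measurable borel"
    using assms unfolding lborel_preserving_def by auto
  show "(\<lambda>x. S (T x)) \<in> borel_measurable borel" by measurable
  fix F :: "'a \<Rightarrow> ennreal" assume [measurable]: "F \<in> borel_measurable borel"
  show "(\<integral>\<^sup>+x. F (S (T x)) \<partial>lborel) = (\<integral>\<^sup>+x. F x \<partial>lborel)"
    using lborel_preserving_nn_integral[OF T, of "\<lambda>x. F (S x)"] lborel_preserving_nn_integral[OF S, of F] by simp
qed

lemma lborel_preserving_plus: "lborel_preserving (\<lambda>x. c + x)"
  using lborel_distr_plus[of c] unfolding lborel_preserving_def by simp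

lemma lborel_preserving_uminus: "lborel_preserving (\<lambda>x. - x)"
proof -
  have "lborel = density (distr lborel borel (\<lambda>x :: 'a. 0 + (- 1) *\<^sub>R x)) (\<lambda>_. ennreal (\<bar>- 1\<bar> ^ DIM('a)))"
    by (rule lborel_affine) simp
  then have "distr lborel borel (\<lambda>x :: 'a. - x) = lborel" by (simp add: density_1)
  then show ?thesis unfolding lborel_preserving_def by simp
qed

lemma lborel_preserving_id: "lborel_preserving (\<lambda>x. x)"
  by (rule lborel_preservingI) auto

lemma lborel_preserving_AE:
  assumes T: "lborel_preserving T" and P: "Measurable.pred borel P" and AE: "AE x in lborel. P x"
  shows "AE x in lborel. P (T x)"
proof -
  have d: "distr lborel borel T = lborel" using T unfolding lborel_preserving_def by blast
  have "AE x in distr lborel borel T. P x" unfolding d by (rule AE)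
  then show ?thesis using T P unfolding lborel_preserving_def
    by (subst (asm) AE_distr_iff) auto
qed

text \<open>Averaging over translates in direction \<open>b\<close>, weighted so that the shift by \<open>h x\<close> can be
  absorbed into a one-dimensional translation.\<close>

lemma lborel_preserving_shift:
  fixes h :: "'e::euclidean_space \<Rightarrow> real"
  assumes b: "b \<in> Basis" and h[measurable]: "h \<in> borel_measurable borel"
    and inv: "\<And>x r. h (x + r *\<^sub>R b) = h x"
  shows "lborel_preserving (\<lambda>x. x + h x *\<^sub>R b)"
proof (rule lborel_preservingI)
  show "(\<lambda>x. x + h x *\<^sub>R b) \<in> borel_measurable borel" by measurable
  fix F :: "'e \<Rightarrow> ennreal" assume F[measurable]: "F \<in> borel_measurable borel"
  \<comment> \<open>A weight on the line of total mass 1; inserting its translates is free of cost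
    and produces the extra variable to be shifted.\<close>
  define w :: "real \<Rightarrow> ennreal" where "w = indicator {0..1}"
  have w[measurable]: "w \<in> borel_measurable borel" unfolding w_def by measurable
  have w1: "(\<integral>\<^sup>+r. w (c + r) \<partial>lborel) = 1" for c
  proof -
    have "(\<integral>\<^sup>+r. w (c + r) \<partial>lborel) = (\<integral>\<^sup>+r. w r \<partial>lborel)"
      using lborel_preserving_nn_integral[OF lborel_preserving_plus w] .
    then show ?thesis by (simp add: w_def)
  qed
  \<comment> \<open>The right-hand side no longer involves \<open>k\<close>, so the cases
    \<open>k = h\<close> and \<open>k = 0\<close> have equal left-hand sides.\<close>
  have key: "(\<integral>\<^sup>+x. F (x + k x *\<^sub>R b) \<partial>lborel) = (\<integral>\<^sup>+x. w (x \<bullet> b) * (\<integral>\<^sup>+r. F (x - r *\<^sub>R b) \<partial>lborel) \<partial>lborel)"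
    if k[measurable]: "k \<in> borel_measurable borel" and kinv: "\<And>x r. k (x + r *\<^sub>R b) = k x" for k :: "'e \<Rightarrow> real"
  proof -
    have "(\<integral>\<^sup>+x. F (x + k x *\<^sub>R b) \<partial>lborel) = (\<integral>\<^sup>+x. (\<integral>\<^sup>+r. F (x + k x *\<^sub>R b) * w (x \<bullet> b + r) \<partial>lborel) \<partial>lborel)"
      by (intro nn_integral_cong) (simp add: nn_integral_cmult w1)
    also have "\<dots> = (\<integral>\<^sup>+r. (\<integral>\<^sup>+x. F (x + k x *\<^sub>R b) * w (x \<bullet> b + r) \<partial>lborel) \<partial>lborel)"
      by (rule lborel_pair.Fubini'[symmetric]) (simp add: split_beta')
    also have "\<dots> = (\<integral>\<^sup>+r. (\<integral>\<^sup>+x. F (x - r *\<^sub>R b + k x *\<^sub>R b) * w (x \<bullet> b) \<partial>lborel) \<partial>lborel)"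
    proof (rule nn_integral_cong)
      fix r :: real
      have kk: "k (- r *\<^sub>R b + x) = k x" for x using kinv[of x "- r"] by (simp add: add.commute)
      have "(\<integral>\<^sup>+x. F ((- r *\<^sub>R b + x) + k (- r *\<^sub>R b + x) *\<^sub>R b) * w ((- r *\<^sub>R b + x) \<bullet> b + r) \<partial>lborel)
          = (\<integral>\<^sup>+x. F (x + k x *\<^sub>R b) * w (x \<bullet> b + r) \<partial>lborel)"
        by (rule lborel_preserving_nn_integral[OF lborel_preserving_plus]) measurable
      then show "(\<integral>\<^sup>+x. F (x + k x *\<^sub>R b) * w (x \<bullet> b + r) \<partial>lborel) =
          (\<integral>\<^sup>+x. F (x - r *\<^sub>R b + k x *\<^sub>R b) * w (x \<bullet> b) \<partial>lborel)"
        unfolding kk using b by (simp add: inner_diff_left inner_add_left)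
    qed
    also have "\<dots> = (\<integral>\<^sup>+x. (\<integral>\<^sup>+r. F (x - r *\<^sub>R b + k x *\<^sub>R b) * w (x \<bullet> b) \<partial>lborel) \<partial>lborel)"
      by (rule lborel_pair.Fubini') (simp add: split_beta')
    also have "\<dots> = (\<integral>\<^sup>+x. w (x \<bullet> b) * (\<integral>\<^sup>+r. F (x - r *\<^sub>R b) \<partial>lborel) \<partial>lborel)"
    proof (rule nn_integral_cong)
      fix x :: 'e
      have "(\<integral>\<^sup>+r. F (x - r *\<^sub>R b + k x *\<^sub>R b) * w (x \<bullet> b) \<partial>lborel)
          = w (x \<bullet> b) * (\<integral>\<^sup>+r. F (x - (- k x + r) *\<^sub>R b) \<partial>lborel)"
        by (subst nn_integral_cmult[symmetric]) (simp_all add: algebra_simps)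
      also have "(\<integral>\<^sup>+r. F (x - (- k x + r) *\<^sub>R b) \<partial>lborel) = (\<integral>\<^sup>+r. F (x - r *\<^sub>R b) \<partial>lborel)"
        by (rule lborel_preserving_nn_integral[OF lborel_preserving_plus, of "\<lambda>r. F (x - r *\<^sub>R b)"]) measurable
      finally show "(\<integral>\<^sup>+r. F (x - r *\<^sub>R b + k x *\<^sub>R b) * w (x \<bullet> b) \<partial>lborel)
          = w (x \<bullet> b) * (\<integral>\<^sup>+r. F (x - r *\<^sub>R b) \<partial>lborel)" .
    qed
    finally show ?thesis .
  qed
  show "(\<integral>\<^sup>+x. F (x + h x *\<^sub>R b) \<partial>lborel) = (\<integral>\<^sup>+x. F x \<partial>lborel)"
    using key[OF h inv] key[of "\<lambda>x. 0"] by simp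
qed

section \<open>Triangular maps and uniqueness of the Haar measure\<close>

context filiform_model
begin

text \<open>A composition of coordinate shifts, the last coordinate being shifted first: the amount
  added to coordinate \<open>j\<close> depends on coordinates below \<open>j\<close>, which are
  still unaltered when its turn comes.\<close>

lemma triangular_preserving:
  assumes h[measurable]: "\<And>j. j \<le> s \<Longrightarrow> h j \<in> borel_measurable borel"
    and tri: "\<And>j x y. j \<le> s \<Longrightarrow> (\<And>i. i < j \<Longrightarrow> x \<bullet> e i = y \<bullet> e i) \<Longrightarrow> h j x = h j y"
  shows "lborel_preserving (\<lambda>x. x + (\<Sum>j\<le>s. h j x *\<^sub>R e j))"
proof -
  have "lborel_preserving (\<lambda>x. x + (\<Sum>j\<in>{j. j \<le> s \<and> s < j + n}. h j x *\<^sub>R e j))" if "n \<le> Suc s" for n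
    using that
  proof (induction n)
    case 0
    have 0: "{j. j \<le> s \<and> s < j + 0} = {}" by auto
    show ?case unfolding 0 by (simp add: lborel_preserving_id)
  next
    case (Suc n)
    let ?R = "\<lambda>x. x + (\<Sum>j\<in>{j. j \<le> s \<and> s < j + n}. h j x *\<^sub>R e j)" and ?m = "s - n"
    have m: "?m \<le> s" "n \<le> s" using Suc by auto
    have agree: "h ?m (x + (\<Sum>j\<in>J. c j *\<^sub>R e j)) = h ?m x" if J: "J \<subseteq> {j. j \<le> s \<and> ?m \<le> j}" for J c x
    proof (rule tri[OF m(1)])
      fix i assume i: "i < ?m"
      have "(\<Sum>j\<in>J. c j *\<^sub>R e j) \<bullet> e i = 0"
        unfolding inner_sum_left using J i m by (intro sum.neutral) (auto simp: e_inner)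
      then show "(x + (\<Sum>j\<in>J. c j *\<^sub>R e j)) \<bullet> e i = x \<bullet> e i" by (simp add: inner_add_left)
    qed
    have S: "lborel_preserving (\<lambda>x. x + h ?m x *\<^sub>R e ?m)"
    proof (rule lborel_preserving_shift)
      show "e ?m \<in> Basis" "h ?m \<in> borel_measurable borel" using m h by auto
      show "h ?m (x + r *\<^sub>R e ?m) = h ?m x" for x r using agree[of "{?m}" x "\<lambda>_. r"] by simp
    qed
    have "lborel_preserving (\<lambda>x. ?R x + h ?m (?R x) *\<^sub>R e ?m)"
      by (rule lborel_preserving_compose[OF S]) (use Suc in simp)
    moreover have "h ?m (?R x) = h ?m x" for x by (rule agree) auto
    moreover have "{j. j \<le> s \<and> s < j + Suc n} = insert ?m {j. j \<le> s \<and> s < j + n}" using m by auto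
    then have "(\<Sum>j\<in>{j. j \<le> s \<and> s < j + Suc n}. h j x *\<^sub>R e j) =
        h ?m x *\<^sub>R e ?m + (\<Sum>j\<in>{j. j \<le> s \<and> s < j + n}. h j x *\<^sub>R e j)" for x
      using m by (subst sum.insert[symmetric]) auto
    ultimately show ?case by (simp add: algebra_simps)
  qed
  from this[of "Suc s"] have "lborel_preserving (\<lambda>x. x + (\<Sum>j\<in>{j. j \<le> s \<and> s < j + Suc s}. h j x *\<^sub>R e j))" by simp
  moreover have "{j. j \<le> s \<and> s < j + Suc s} = {..s}" by auto
  ultimately show ?thesis by simp
qed

lemma triangular_preserving':
  assumes T: "continuous_on UNIV T"
    and tri: "\<And>j x y. j \<le> s \<Longrightarrow> (\<And>i. i < j \<Longrightarrow> x \<bullet> e i = y \<bullet> e i) \<Longrightarrow> (T x - x) \<bullet> e j = (T y - y) \<bullet> e j"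
  shows "lborel_preserving T"
proof -
  have "lborel_preserving (\<lambda>x. x + (\<Sum>j\<le>s. ((T x - x) \<bullet> e j) *\<^sub>R e j))"
  proof (rule triangular_preserving)
    show "(\<lambda>x. (T x - x) \<bullet> e j) \<in> borel_measurable borel" for j
      by (intro borel_measurable_continuous_onI continuous_intros T)
  qed (rule tri)
  then show ?thesis by (simp add: coord_expand)
qed

text \<open>Unipotence of \<open>shear\<close>: its diagonal entries are 1 and cancel against
  \<open>v\<close>, leaving strictly lower coordinates.\<close>

lemma shear_coord_agree:
  assumes "j \<le> s" "\<And>i. i < j \<Longrightarrow> v \<bullet> e i = w \<bullet> e i"
  shows "(shear t v - v) \<bullet> e j = (shear t w - w) \<bullet> e j"
proof (cases "j = 0")
  case False
  have *: "(shear t v - v) \<bullet> e j = (\<Sum>i=1..<j. divpow t (j - i) * (v \<bullet> e i))" for v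
  proof -
    have "{1..j} = insert j {1..<j}" using False by auto
    then show ?thesis using assms(1) False by (simp add: shear_ej inner_diff_left)
  qed
  show ?thesis unfolding * using assms(2) by (intro sum.cong) auto
qed (simp add: inner_diff_left)

lemma mul_right_preserving: "lborel_preserving (\<lambda>x. mul x y)"
proof (rule triangular_preserving')
  show "continuous_on UNIV (\<lambda>x. mul x y)" by (intro continuous_on_mul continuous_intros)
  show "(mul x y - x) \<bullet> e j = (mul x' y - x') \<bullet> e j" if "j \<le> s" "\<And>i. i < j \<Longrightarrow> x \<bullet> e i = x' \<bullet> e i" for j x x'
    using that by (cases "j = 0") (simp_all add: mul_def)
qed

lemma mul_left_preserving: "lborel_preserving (mul x)"
proof (rule triangular_preserving')
  show "continuous_on UNIV (mul x)" by (intro continuous_on_mul continuous_intros)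
  show "(mul x y - y) \<bullet> e j = (mul x y' - y') \<bullet> e j" if "j \<le> s" "\<And>i. i < j \<Longrightarrow> y \<bullet> e i = y' \<bullet> e i" for j y y'
    using shear_coord_agree[OF that, of "x \<bullet> e 0"] by (simp add: mul_def inner_add_left inner_diff_left)
qed

text \<open>Up to a sign this is a shear of \<open>y - x\<close> with parameter minus the
  \<open>e 0\<close> coordinate of \<open>y\<close>, which is triangular in \<open>y\<close>. It
  supplies the inversion of variables in the uniqueness argument.\<close>

lemma minv_mul_preserving: "lborel_preserving (\<lambda>y. mul (minv y) x)"
proof -
  have eq: "- mul (minv y) x = shear (- (y \<bullet> e 0)) (y - x)" for y
    by (simp add: mul_def minv_def shear_diff)
  have "lborel_preserving (\<lambda>y. - mul (minv y) x)"
  proof (rule triangular_preserving')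
    show "continuous_on UNIV (\<lambda>y. - mul (minv y) x)" by (intro continuous_on_mul continuous_on_minv continuous_intros)
    show "(- mul (minv y) x - y) \<bullet> e j = (- mul (minv y') x - y') \<bullet> e j"
      if j: "j \<le> s" and a: "\<And>i. i < j \<Longrightarrow> y \<bullet> e i = y' \<bullet> e i" for j y y'
    proof (cases "j = 0")
      case True
      then show ?thesis unfolding eq by (simp add: inner_diff_left)
    next
      case False
      then have "y \<bullet> e 0 = y' \<bullet> e 0" using a by simp
      moreover have "(shear t (y - x) - (y - x)) \<bullet> e j = (shear t (y' - x) - (y' - x)) \<bullet> e j" for t
        by (rule shear_coord_agree[OF j]) (simp add: a inner_diff_left)
      ultimately show ?thesis unfolding eq by (simp add: inner_diff_left)
    qed
  qed
  from lborel_preserving_compose[OF lborel_preserving_uminus this] show ?thesis by simp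
qed

lemma measurable_mul[measurable]:
  assumes [measurable]: "f \<in> borel_measurable M" "g \<in> borel_measurable M"
  shows "(\<lambda>x. mul (f x) (g x)) \<in> borel_measurable M"
proof -
  have [measurable]: "(\<lambda>z. mul (fst z) (snd z)) \<in> borel_measurable (borel \<Otimes>\<^sub>M borel)"
    unfolding borel_prod by (intro borel_measurable_continuous_onI continuous_on_mul continuous_intros)
  have "(\<lambda>x. (\<lambda>z. mul (fst z) (snd z)) (f x, g x)) \<in> borel_measurable M" by measurable
  then show ?thesis by simp
qed

lemma measurable_minv[measurable]:
  assumes [measurable]: "f \<in> borel_measurable M"
  shows "(\<lambda>x. minv (f x)) \<in> borel_measurable M"
proof -
  have [measurable]: "minv \<in> borel_measurable borel"
    by (intro borel_measurable_continuous_onI continuous_on_minv continuous_intros)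
  show ?thesis by measurable
qed

text \<open>The double integral of \<open>f x * g (mul y x)\<close> is evaluated in two ways, using
  left invariance of \<mu> and the invariance of Lebesgue measure under
  \<open>mul_right_preserving\<close> and \<open>minv_mul_preserving\<close>. The integrals against
  the two measures come out proportional.\<close>

lemma haar_unique:
  assumes sets: "sets \<mu> = sets borel" and fin: "\<And>K. compact K \<Longrightarrow> emeasure \<mu> K < \<infinity>"
    and nz: "emeasure \<mu> UNIV \<noteq> 0"
    and inv: "\<And>a B. B \<in> sets borel \<Longrightarrow> emeasure \<mu> (mul a -` B) = emeasure \<mu> B"
  obtains c :: real where "c > 0" "\<mu> = density lborel (\<lambda>_. ennreal c)"
proof -
  have sp: "space \<mu> = UNIV" using sets_eq_imp_space_eq[OF sets] by simp
  have meas[measurable_cong]: "sets \<mu> = sets borel" by (rule sets)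
  interpret \<mu>: sigma_finite_measure \<mu>
  proof
    show "\<exists>A. countable A \<and> A \<subseteq> sets \<mu> \<and> \<Union>A = space \<mu> \<and> (\<forall>a\<in>A. emeasure \<mu> a \<noteq> \<infinity>)"
    proof (intro exI conjI ballI)
      show "countable (range (\<lambda>n. cball (0::'e) (real n)))" by simp
      show "range (\<lambda>n. cball (0::'e) (real n)) \<subseteq> sets \<mu>" unfolding sets by (intro image_subsetI) simp
      show "\<Union>(range (\<lambda>n. cball (0::'e) (real n))) = space \<mu>" unfolding sp using real_arch_simple by auto
      show "emeasure \<mu> a \<noteq> \<infinity>" if "a \<in> range (\<lambda>n. cball (0::'e) (real n))" for a
        using that fin[OF compact_cball] by (auto simp: less_top)
    qed
  qed
  interpret \<mu>l: pair_sigma_finite \<mu> "lborel :: 'e measure" ..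
  interpret l\<mu>: pair_sigma_finite "lborel :: 'e measure" \<mu> ..
  have inv': "(\<integral>\<^sup>+x. F (mul a x) \<partial>\<mu>) = (\<integral>\<^sup>+x. F x \<partial>\<mu>)" if F: "F \<in> borel_measurable borel" for F a
  proof -
    have m: "mul a \<in> measurable \<mu> borel" by measurable
    have "distr \<mu> borel (mul a) = \<mu>"
    proof (rule measure_eqI)
      fix B assume "B \<in> sets (distr \<mu> borel (mul a))"
      then have "B \<in> sets borel" by simp
      then show "emeasure (distr \<mu> borel (mul a)) B = emeasure \<mu> B"
        using inv[of B a] m by (subst emeasure_distr) (auto simp: sp)
    qed (simp add: sets)
    then show ?thesis using nn_integral_distr[OF m, of F] F by simp
  qed
  have key: "(\<integral>\<^sup>+y. g y \<partial>lborel) * (\<integral>\<^sup>+x. f x \<partial>\<mu>) = (\<integral>\<^sup>+y. f y \<partial>lborel) * (\<integral>\<^sup>+x. g x \<partial>\<mu>)"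
    if f[measurable]: "f \<in> borel_measurable borel" and g[measurable]: "g \<in> borel_measurable borel" for f g :: "'e \<Rightarrow> ennreal"
  proof -
    have "(\<integral>\<^sup>+y. g y \<partial>lborel) * (\<integral>\<^sup>+x. f x \<partial>\<mu>) = (\<integral>\<^sup>+x. f x * (\<integral>\<^sup>+y. g y \<partial>lborel) \<partial>\<mu>)"
      by (subst nn_integral_multc) (auto simp: mult.commute)
    also have "\<dots> = (\<integral>\<^sup>+x. (\<integral>\<^sup>+y. f x * g (mul y x) \<partial>lborel) \<partial>\<mu>)"
      by (intro nn_integral_cong)
        (simp add: nn_integral_cmult lborel_preserving_nn_integral[OF mul_right_preserving g])
    also have "\<dots> = (\<integral>\<^sup>+y. (\<integral>\<^sup>+x. f x * g (mul y x) \<partial>\<mu>) \<partial>lborel)"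
      by (rule l\<mu>.Fubini'[of "\<lambda>y x. f x * g (mul y x)"]) (simp add: split_beta')
    also have "\<dots> = (\<integral>\<^sup>+y. (\<integral>\<^sup>+x. f (mul (minv y) x) * g x \<partial>\<mu>) \<partial>lborel)"
    proof (rule nn_integral_cong)
      fix y
      show "(\<integral>\<^sup>+x. f x * g (mul y x) \<partial>\<mu>) = (\<integral>\<^sup>+x. f (mul (minv y) x) * g x \<partial>\<mu>)"
        using inv'[of "\<lambda>x. f (mul (minv y) x) * g x" y] by simp
    qed
    also have "\<dots> = (\<integral>\<^sup>+x. (\<integral>\<^sup>+y. f (mul (minv y) x) * g x \<partial>lborel) \<partial>\<mu>)"
      by (rule l\<mu>.Fubini'[of "\<lambda>y x. f (mul (minv y) x) * g x", symmetric]) (simp add: split_beta')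
    also have "\<dots> = (\<integral>\<^sup>+x. (\<integral>\<^sup>+y. f y \<partial>lborel) * g x \<partial>\<mu>)"
      by (intro nn_integral_cong)
        (simp add: nn_integral_multc lborel_preserving_nn_integral[OF minv_mul_preserving f])
    also have "\<dots> = (\<integral>\<^sup>+y. f y \<partial>lborel) * (\<integral>\<^sup>+x. g x \<partial>\<mu>)"
      by (subst nn_integral_cmult) auto
    finally show ?thesis .
  qed
  \<comment> \<open>The unit cube has Lebesgue measure 1, so its \<mu>-measure is the constant of
    proportionality.\<close>
  let ?Q = "cbox (0::'e) One"
  have Q: "emeasure lborel ?Q = 1" by simp
  have Qf: "emeasure \<mu> ?Q < \<infinity>" by (rule fin) (rule compact_cbox)
  have eq: "emeasure \<mu> B = emeasure \<mu> ?Q * emeasure lborel B" if B[measurable]: "B \<in> sets borel" for B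
    using key[of "indicator B" "indicator ?Q"] Q by (simp add: sets mult.commute)
  define c where "c = enn2real (emeasure \<mu> ?Q)"
  have c: "ennreal c = emeasure \<mu> ?Q" unfolding c_def using Qf by (simp add: less_top)
  have "emeasure \<mu> ?Q \<noteq> 0" using nz eq[of UNIV] by auto
  then have "c > 0" unfolding c_def using Qf by (simp add: enn2real_positive_iff less_top zero_less_iff_neq_zero)
  moreover have "\<mu> = density lborel (\<lambda>_. ennreal c)"
  proof (rule measure_eqI)
    show "sets \<mu> = sets (density lborel (\<lambda>_. ennreal c))" by (simp add: sets)
    fix B assume "B \<in> sets \<mu>"
    then have "B \<in> sets borel" unfolding sets .
    from eq[OF this] this show "emeasure \<mu> B = emeasure (density lborel (\<lambda>_. ennreal c)) B"
      by (simp add: c emeasure_density_const)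
  qed
  ultimately show thesis using that by blast
qed

end

section \<open>Sets that are monotone along a flow\<close>

text \<open>Inner approximation by closed sets, each of which is a countable union of compact pieces
  and therefore null.\<close>

lemma compact_measure_pos:
  fixes S :: "'e::euclidean_space set"
  assumes S: "S \<in> sets lborel" and K: "\<And>K. compact K \<Longrightarrow> K \<subseteq> S \<Longrightarrow> emeasure lborel K = 0"
  shows "emeasure lborel S = 0"
proof -
  have "emeasure lebesgue S \<le> ennreal r" if r: "r > 0" for r :: real
  proof -
    have SL: "S \<in> sets lebesgue" using S by simp
    obtain T where T: "closed T" "T \<subseteq> S" "S - T \<in> lmeasurable" "emeasure lebesgue (S - T) < ennreal r"
      using sets_lebesgue_inner_closed[OF SL r] by blast
    have "T = (\<Union>n. T \<inter> cball 0 (real n))" using real_arch_simple by (auto simp: dist_norm)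
    have "emeasure lborel (\<Union>n. T \<inter> cball 0 (real n)) = 0"
    proof (rule emeasure_UN_eq_0)
      fix n
      show "emeasure lborel (T \<inter> cball 0 (real n)) = 0"
        by (rule K) (use T in \<open>auto intro: closed_Int_compact\<close>)
    qed (use T(1) in auto)
    then have "emeasure lborel T = 0" using \<open>T = (\<Union>n. T \<inter> cball 0 (real n))\<close> by simp
    then have T0: "emeasure lebesgue T = 0" using T(1) by simp
    have "emeasure lebesgue S \<le> emeasure lebesgue ((S - T) \<union> T)" by (intro emeasure_mono) (use SL T(1) in auto)
    also have "\<dots> \<le> emeasure lebesgue (S - T) + emeasure lebesgue T"
      by (intro emeasure_subadditive) (use SL T(1) in auto)
    finally show ?thesis using T0 T(4) by simp
  qed
  then have "emeasure lebesgue S \<le> 0" by (intro ennreal_le_epsilon[of 0]) simp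
  then show ?thesis using S by simp
qed

lemma integrable_test:
  fixes \<theta> :: "'e::euclidean_space \<Rightarrow> real"
  assumes c: "continuous_on UNIV \<theta>" and K: "compact (closure {x. \<theta> x \<noteq> 0})"
  shows "integrable lborel \<theta>"
proof -
  have "integrable lborel (\<lambda>x. indicator (closure {x. \<theta> x \<noteq> 0}) x *\<^sub>R \<theta> x)"
    by (rule borel_integrable_compact[OF K continuous_on_subset[OF c]]) simp
  moreover have "(\<lambda>x. indicator (closure {x. \<theta> x \<noteq> 0}) x *\<^sub>R \<theta> x) = \<theta>"
  proof
    fix x
    show "indicator (closure {x. \<theta> x \<noteq> 0}) x *\<^sub>R \<theta> x = \<theta> x"
      using closure_subset[of "{x. \<theta> x \<noteq> 0}"] by (cases "\<theta> x = 0") (auto simp: indicator_def)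
  qed
  ultimately show ?thesis by simp
qed

lemma integrable_indicator_mult:
  fixes \<theta> :: "'e::euclidean_space \<Rightarrow> real"
  assumes "integrable lborel \<theta>" "D \<in> sets borel"
  shows "integrable lborel (\<lambda>x. indicator D x * \<theta> x)"
  using integrable_mult_indicator[of D lborel \<theta>] assms by simp

text \<open>For compact \<open>K\<close> inside \<open>D - D'\<close>, test with a cutoff that is 1
  on \<open>K\<close> and supported in a slightly larger open \<open>U\<close>. The left integral is
  at least the measure of \<open>K\<close>, the right one at most that of \<open>U - K\<close>,
  which is arbitrarily small.\<close>

lemma AE_subset_of_test:
  fixes D D' :: "'e::euclidean_space set"
  assumes D: "D \<in> sets borel" and D': "D' \<in> sets borel"
    and test: "\<And>\<theta> :: 'e \<Rightarrow> real. smooth_on UNIV \<theta> \<Longrightarrow> compact (closure {x. \<theta> x \<noteq> 0}) \<Longrightarrow> (\<And>x. 0 \<le> \<theta> x) \<Longrightarrow>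
      (\<integral>x. indicator D x * \<theta> x \<partial>lborel) \<le> (\<integral>x. indicator D' x * \<theta> x \<partial>lborel)"
  shows "AE x in lborel. x \<in> D \<longrightarrow> x \<in> D'"
proof -
  have "emeasure lborel (D - D') = 0"
  proof (rule compact_measure_pos)
    show "D - D' \<in> sets lborel" using D D' by simp
    fix K assume K: "compact K" "K \<subseteq> D - D'"
    have Kb: "K \<in> sets borel" using K(1) compact_imp_closed borel_closed by blast
    have "emeasure lborel K \<le> 0 + ennreal r" if r: "r > 0" for r :: real
    proof -
      obtain U where U: "open U" "K \<subseteq> U" "U - K \<in> lmeasurable" "emeasure lebesgue (U - K) < ennreal r"
        using sets_lebesgue_outer_open[of K r] Kb r by auto
      have UK: "U - K \<in> sets borel" using U(1) Kb by auto
      show ?thesis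
      proof (rule smooth_Urysohn[OF K(1) U(1,2)])
      fix \<theta> :: "'e \<Rightarrow> real"
      assume \<theta>: "smooth_on UNIV \<theta>" "\<And>x. 0 \<le> \<theta> x" "\<And>x. \<theta> x \<le> 1"
        "\<And>x. x \<in> K \<Longrightarrow> \<theta> x = 1" "closure {x. \<theta> x \<noteq> 0} \<subseteq> U" "compact (closure {x. \<theta> x \<noteq> 0})"
      have int: "integrable lborel \<theta>" by (rule integrable_test[OF smooth_on_continuous[OF \<theta>(1)] \<theta>(6)])
      have i1: "integrable lborel (\<lambda>x. indicator D x * \<theta> x)" and i2: "integrable lborel (\<lambda>x. indicator D' x * \<theta> x)"
        using int D D' by (intro integrable_indicator_mult; simp)+
      have "emeasure lborel K = (\<integral>\<^sup>+x. indicator K x \<partial>lborel)" using Kb by simp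
      also have "\<dots> \<le> (\<integral>\<^sup>+x. ennreal (indicator D x * \<theta> x) \<partial>lborel)"
        using K(2) \<theta>(4) by (intro nn_integral_mono) (auto simp: indicator_def)
      also have "\<dots> = ennreal (\<integral>x. indicator D x * \<theta> x \<partial>lborel)"
        by (rule nn_integral_eq_integral[OF i1]) (use \<theta>(2) in simp)
      also have "\<dots> \<le> ennreal (\<integral>x. indicator D' x * \<theta> x \<partial>lborel)"
        by (intro ennreal_leI test \<theta>)
      also have "\<dots> = (\<integral>\<^sup>+x. ennreal (indicator D' x * \<theta> x) \<partial>lborel)"
        by (rule nn_integral_eq_integral[OF i2, symmetric]) (use \<theta>(2) in simp)
      also have "\<dots> \<le> (\<integral>\<^sup>+x. indicator (U - K) x \<partial>lborel)"
      proof (rule nn_integral_mono)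
        fix x
        show "ennreal (indicator D' x * \<theta> x) \<le> indicator (U - K) x"
        proof (cases "x \<in> D' \<and> \<theta> x \<noteq> 0")
          case True
          then have "x \<in> U" using \<theta>(5) closure_subset[of "{x. \<theta> x \<noteq> 0}"] by blast
          then show ?thesis using True K(2) \<theta>(3)[of x] by (auto simp: indicator_def)
        qed (auto simp: indicator_def)
      qed
      also have "\<dots> = emeasure lborel (U - K)" by (rule nn_integral_indicator) (use UK in simp)
      also have "\<dots> \<le> ennreal r" using U(4) UK by simp
      finally show "emeasure lborel K \<le> 0 + ennreal r" by simp
      qed
    qed
    then have "emeasure lborel K \<le> 0" by (intro ennreal_le_epsilon[of 0]) simp
    then show "emeasure lborel K = 0" by simp
  qed
  then have "AE x in lborel. x \<notin> D - D'"
    using D D' by (intro AE_not_in) (auto simp: null_sets_def)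
  then show ?thesis by (rule AE_mp) auto
qed

context filiform_model
begin

text \<open>The assumption on \<open>v\<close> makes the field \<open>P\<close> constant along its
  own orbits, so the flow consists of straight lines and coincides with right translation by
  \<open>r *\<^sub>R v\<close>. Writing the change of a test function along the flow as a time
  integral, Fubini and the distributional inequality compare its integrals over \<open>D\<close>
  before and after the flow; invariance of Lebesgue measure moves the flow onto
  \<open>D\<close>.\<close>

lemma monotone_flow:
  assumes D[measurable]: "D \<in> sets borel" and v: "\<And>r. shear (r * (v \<bullet> e 0)) v = v"
    and test: "\<And>\<theta> :: 'e \<Rightarrow> real. smooth_on UNIV \<theta> \<Longrightarrow> compact (closure {x. \<theta> x \<noteq> 0}) \<Longrightarrow> (\<And>x. 0 \<le> \<theta> x) \<Longrightarrow>
      (\<integral>x. indicator D x * frechet_derivative \<theta> (at x) (shear (x \<bullet> e 0) v) \<partial>lborel) \<le> 0"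
    and r: "0 \<le> r"
  shows "AE x in lborel. x \<in> D \<longrightarrow> mul x (r *\<^sub>R v) \<in> D"
proof -
  define D' where "D' = (\<lambda>x. mul x (r *\<^sub>R v)) -` D"
  define P where "P = (\<lambda>x. shear (x \<bullet> e 0) v)"
  have flow: "mul x (t *\<^sub>R v) = x + t *\<^sub>R P x" for x t by (simp add: mul_def P_def shear_scale)
  have Pflow: "P (x + t *\<^sub>R P x) = P x" for x t
  proof -
    have "P (x + t *\<^sub>R P x) = shear (x \<bullet> e 0) (shear (t * (v \<bullet> e 0)) v)"
      by (simp add: P_def inner_add_left shear_shear)
    then show ?thesis by (simp only: v P_def)
  qed
  have smP: "smooth_on UNIV P" unfolding P_def by (intro smooth_on_shear smooth_on_inner_const) auto
  have contP: "continuous_on UNIV P" by (rule smooth_on_continuous[OF smP])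
  have mflow: "(\<lambda>x. mul x (r *\<^sub>R v)) \<in> borel_measurable borel" by measurable
  have D'b: "D' \<in> sets borel" unfolding D'_def using measurable_sets[OF mflow D] by simp
  have "AE x in lborel. x \<in> D \<longrightarrow> x \<in> D'"
  proof (rule AE_subset_of_test[OF D D'b])
    fix \<theta> :: "'e \<Rightarrow> real"
    assume \<theta>: "smooth_on UNIV \<theta>" "compact (closure {x. \<theta> x \<noteq> 0})" "\<And>x. 0 \<le> \<theta> x"
    have contth: "continuous_on UNIV \<theta>" by (rule smooth_on_continuous[OF \<theta>(1)])
    have [measurable]: "\<theta> \<in> borel_measurable borel" by (rule borel_measurable_continuous_onI[OF contth])
    define K where "K = closure {x. \<theta> x \<noteq> 0}"
    define \<Phi> where "\<Phi> = (\<lambda>t x. x + t *\<^sub>R P x)"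
    have \<Phi>inv: "\<Phi> (- t) (\<Phi> t x) = x" "\<Phi> t (\<Phi> (- t) x) = x" for t x
      using Pflow[of x t] Pflow[of x "- t"] unfolding \<Phi>_def by simp_all
    have contPhi: "continuous_on UNIV (\<lambda>z. \<Phi> (snd z) (fst z))" unfolding \<Phi>_def
      by (intro continuous_intros continuous_on_compose2[OF contP]) auto
    have smPhi: "smooth_on UNIV (\<Phi> t)" for t unfolding \<Phi>_def
      by (intro smooth_on_add smooth_on_scaleR smP) auto
    define k where "k = (\<lambda>x t. frechet_derivative \<theta> (at (\<Phi> (- t) x)) (P x))"
    have dth: "smooth_on UNIV (\<lambda>x. frechet_derivative \<theta> (at x) (P x))"
      by (rule smooth_on_derivative_along[OF open_UNIV \<theta>(1) smP])
    have PPhi: "P (\<Phi> t x) = P x" for t x unfolding \<Phi>_def by (rule Pflow)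
    have k_eq: "k x t = (\<lambda>x. frechet_derivative \<theta> (at x) (P x)) (\<Phi> (- t) x)" for x t
      unfolding k_def by (simp add: PPhi)
    have contk: "continuous_on UNIV (\<lambda>z. k (fst z) (snd z))"
    proof -
      have "continuous_on UNIV (\<lambda>z. \<Phi> (- snd z) (fst z))"
      proof -
        have "continuous_on UNIV (\<lambda>z :: 'e \<times> real. (fst z, - snd z))" by (intro continuous_intros)
        from continuous_on_compose2[OF contPhi this] show ?thesis by simp
      qed
      from continuous_on_compose2[OF smooth_on_continuous[OF dth] this] show ?thesis unfolding k_eq by simp
    qed
    have k_supp: "\<Phi> (- t) x \<in> K" if "k x t \<noteq> 0" for x t
    proof (rule ccontr)
      assume "\<Phi> (- t) x \<notin> K"
      then have o: "open (- K)" "\<Phi> (- t) x \<in> - K" unfolding K_def by auto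
      have "((\<lambda>x. 0) has_derivative (\<lambda>h. 0)) (at (\<Phi> (- t) x))" by simp
      then have "(\<theta> has_derivative (\<lambda>h. 0)) (at (\<Phi> (- t) x))"
        by (rule has_derivative_transform_within_open[OF _ o])
          (use closure_subset[of "{x. \<theta> x \<noteq> 0}"] in \<open>auto simp: K_def\<close>)
      then have "frechet_derivative \<theta> (at (\<Phi> (- t) x)) = (\<lambda>h. 0)" by (metis frechet_derivative_at)
      then show False using that unfolding k_def by simp
    qed
    \<comment> \<open>A compact set of pairs \<open>(x, t)\<close> that contains all those with
      \<open>t\<close> in the range of integration where \<open>k\<close> is nonzero; it makes the
      integrand integrable on the product, as Fubini requires.\<close>
    define L where "L = (\<lambda>z. (\<Phi> (snd z) (fst z), snd z)) ` (K \<times> {0..r})"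
    have Lc: "compact L" unfolding L_def
      by (intro compact_continuous_image compact_Times continuous_on_Pair continuous_on_subset[OF contPhi]
          continuous_intros) (use \<theta>(2) K_def in auto)
    have L: "(x, t) \<in> L" if "k x t \<noteq> 0" "t \<in> {0..r}" for x t
      unfolding L_def using k_supp[OF that(1)] that(2) \<Phi>inv
      by (intro image_eqI[of _ _ "(\<Phi> (- t) x, t)"]) auto
    have intk: "integrable (lborel \<Otimes>\<^sub>M lborel) (\<lambda>(x, t). indicator D x * (indicator {0..r} t * k x t))"
    proof -
      have i0: "integrable lborel (\<lambda>z. indicator L z *\<^sub>R k (fst z) (snd z))"
        by (rule borel_integrable_compact[OF Lc continuous_on_subset[OF contk]]) simp
      have "integrable lborel (\<lambda>z. indicator (D \<times> {0..r}) z *\<^sub>R (indicator L z *\<^sub>R k (fst z) (snd z)))"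
        by (rule integrable_mult_indicator[OF _ i0]) (use D in \<open>auto intro!: borel_Times\<close>)
      moreover have "indicator (D \<times> {0..r}) z *\<^sub>R (indicator L z *\<^sub>R k (fst z) (snd z))
          = (\<lambda>(x, t). indicator D x * (indicator {0..r} t * k x t)) z" for z
        using L[of "fst z" "snd z"] by (cases z) (auto simp: indicator_def)
      ultimately show ?thesis by (simp add: lborel_prod)
    qed
    have FTC: "(\<integral>t. indicator {0..r} t * k x t \<partial>lborel) = \<theta> x - \<theta> (\<Phi> (- r) x)" for x
    proof -
      have "(\<integral>t. indicator {0..r} t *\<^sub>R k x t \<partial>lborel) = - \<theta> (\<Phi> (- r) x) - (- \<theta> (\<Phi> (- 0) x))"
      proof (rule integral_FTC_Icc[OF r])
        show "continuous_on {0..r} (k x)"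
        proof -
          have "continuous_on {0..r} (Pair x)" by (intro continuous_intros)
          from continuous_on_compose2[OF contk this] show ?thesis by simp
        qed
        fix t
        have "((\<lambda>t. \<Phi> (- t) x) has_derivative (\<lambda>h. h *\<^sub>R (- P x))) (at t)"
          unfolding \<Phi>_def by (auto intro!: derivative_eq_intros)
        moreover have th: "(\<theta> has_derivative frechet_derivative \<theta> (at (\<Phi> (- t) x))) (at (\<Phi> (- t) x))"
          by (rule smooth_on_has_derivative[OF \<theta>(1) UNIV_I])
        ultimately have "((\<lambda>t. \<theta> (\<Phi> (- t) x)) has_derivative
            (\<lambda>h. frechet_derivative \<theta> (at (\<Phi> (- t) x)) (h *\<^sub>R (- P x)))) (at t)"
          by (rule has_derivative_compose)
        then have "((\<lambda>t. - \<theta> (\<Phi> (- t) x)) has_derivative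
            (\<lambda>h. - frechet_derivative \<theta> (at (\<Phi> (- t) x)) (h *\<^sub>R (- P x)))) (at t)"
          by (rule has_derivative_minus)
        moreover have "- frechet_derivative \<theta> (at (\<Phi> (- t) x)) (h *\<^sub>R (- P x)) = h *\<^sub>R k x t" for h
          using has_derivative_linear[OF th] unfolding k_def by (simp only: linear_scale linear_neg) simp
        ultimately show "((\<lambda>t. - \<theta> (\<Phi> (- t) x)) has_vector_derivative k x t) (at t within {0..r})"
          unfolding has_vector_derivative_def using has_derivative_at_withinI by simp
      qed
      then show ?thesis by (simp add: \<Phi>_def)
    qed
    have PhiK: "\<theta> (\<Phi> t x) \<noteq> 0 \<Longrightarrow> x \<in> \<Phi> (- t) ` K" for t x
      using closure_subset[of "{x. \<theta> x \<noteq> 0}"] \<Phi>inv(1)[of t x] unfolding K_def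
      by (intro image_eqI[of _ _ "\<Phi> t x"]) auto
    have testPhi: "smooth_on UNIV (\<lambda>x. \<theta> (\<Phi> t x))" "compact (closure {x. \<theta> (\<Phi> t x) \<noteq> 0})" for t
    proof -
      show "smooth_on UNIV (\<lambda>x. \<theta> (\<Phi> t x))"
        by (rule smooth_on_compose[OF open_UNIV open_UNIV smPhi \<theta>(1)]) simp
      have c: "compact (\<Phi> (- t) ` K)"
        by (rule compact_continuous_image[OF continuous_on_subset[OF smooth_on_continuous[OF smPhi]]])
          (use \<theta>(2) K_def in auto)
      have "{x. \<theta> (\<Phi> t x) \<noteq> 0} \<subseteq> \<Phi> (- t) ` K" using PhiK by blast
      then have "closure {x. \<theta> (\<Phi> t x) \<noteq> 0} \<subseteq> \<Phi> (- t) ` K" using c by (simp add: closure_minimal compact_imp_closed)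
      then show "compact (closure {x. \<theta> (\<Phi> t x) \<noteq> 0})"
        using compact_Int_closed[OF c closed_closure[of "{x. \<theta> (\<Phi> t x) \<noteq> 0}"]] by (simp add: Int_absorb1)
    qed
    have int: "integrable lborel (\<lambda>x. indicator D x * \<theta> (\<Phi> t x))" for t
      by (intro integrable_indicator_mult integrable_test smooth_on_continuous testPhi D)
    have "(\<integral>x. indicator D x * \<theta> x \<partial>lborel) - (\<integral>x. indicator D x * \<theta> (\<Phi> (- r) x) \<partial>lborel)
        = (\<integral>x. indicator D x * (\<theta> x - \<theta> (\<Phi> (- r) x)) \<partial>lborel)"
      using Bochner_Integration.integral_diff[OF int[of 0] int[of "- r"]] by (simp add: \<Phi>_def right_diff_distrib)
    also have "\<dots> = (\<integral>x. (\<integral>t. indicator D x * (indicator {0..r} t * k x t) \<partial>lborel) \<partial>lborel)"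
      by (simp add: FTC)
    also have "\<dots> = (\<integral>t. (\<integral>x. indicator D x * (indicator {0..r} t * k x t) \<partial>lborel) \<partial>lborel)"
      by (rule lborel_pair.Fubini_integral[OF intk, symmetric])
    also have "\<dots> \<le> 0"
    proof -
      define J where "J = (\<lambda>t. \<integral>x. indicator D x * (indicator {0..r} t * k x t) \<partial>lborel)"
      have "(\<integral>x. indicator D x * (indicator {0..r} t * k x t) \<partial>lborel) \<le> 0" for t
      proof -
        \<comment> \<open>Since \<open>P\<close> is constant along orbits, \<open>k x t\<close> is
          the derivative along the field of the transported function, itself a test function, so the
          assumption \<open>test\<close> applies at each time.\<close>
        have "frechet_derivative (\<lambda>x. \<theta> (\<Phi> (- t) x)) (at x) (P x) = k x t" for x
        proof -
          have a: "((\<lambda>h. \<Phi> (- t) (x + h *\<^sub>R P x)) has_derivative (\<lambda>h. h *\<^sub>R P x)) (at (0::real))"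
            unfolding \<Phi>_def Pflow by (auto intro!: derivative_eq_intros)
          have b: "(\<theta> has_derivative frechet_derivative \<theta> (at (\<Phi> (- t) x))) (at (\<Phi> (- t) (x + 0 *\<^sub>R P x)))"
            using smooth_on_has_derivative[OF \<theta>(1) UNIV_I] by simp
          have 1: "((\<lambda>h. \<theta> (\<Phi> (- t) (x + h *\<^sub>R P x))) has_derivative
              (\<lambda>h. frechet_derivative \<theta> (at (\<Phi> (- t) x)) (h *\<^sub>R P x))) (at 0)"
            by (rule has_derivative_compose[OF a b])
          have c: "((\<lambda>h. x + h *\<^sub>R P x) has_derivative (\<lambda>h. h *\<^sub>R P x)) (at (0::real))"
            by (auto intro!: derivative_eq_intros)
          have d: "((\<lambda>x. \<theta> (\<Phi> (- t) x)) has_derivative frechet_derivative (\<lambda>x. \<theta> (\<Phi> (- t) x)) (at x)) (at (x + 0 *\<^sub>R P x))"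
            using smooth_on_has_derivative[OF testPhi(1) UNIV_I, of "- t" x] by simp
          have 2: "((\<lambda>h. \<theta> (\<Phi> (- t) (x + h *\<^sub>R P x))) has_derivative
              (\<lambda>h. frechet_derivative (\<lambda>x. \<theta> (\<Phi> (- t) x)) (at x) (h *\<^sub>R P x))) (at 0)"
            by (rule has_derivative_compose[OF c d])
          show ?thesis using fun_cong[OF has_derivative_unique[OF 1 2], of 1] unfolding k_def by simp
        qed
        then have "(\<integral>x. indicator D x * k x t \<partial>lborel) \<le> 0"
          using test[OF testPhi[of "- t"]] \<theta>(3) unfolding P_def by simp
        moreover have "(\<integral>x. indicator D x * (indicator {0..r} t * k x t) \<partial>lborel) = indicator {0..r} t * (\<integral>x. indicator D x * k x t \<partial>lborel)"
          by (subst integral_mult_right_zero[symmetric]) (simp add: mult.left_commute)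
        ultimately show ?thesis by (auto simp: indicator_def)
      qed
      then have "0 \<le> - J t" for t unfolding J_def by simp
      then have "0 \<le> (\<integral>t. - J t \<partial>lborel)" by (rule Bochner_Integration.integral_nonneg)
      then show ?thesis unfolding J_def[symmetric] by simp
    qed
    finally have "(\<integral>x. indicator D x * \<theta> x \<partial>lborel) \<le> (\<integral>x. indicator D x * \<theta> (\<Phi> (- r) x) \<partial>lborel)" by simp
    also have "\<dots> = (\<integral>x. indicator D x * \<theta> (\<Phi> (- r) x) \<partial>distr lborel borel (\<lambda>x. mul x (r *\<^sub>R v)))"
      using mul_right_preserving[of "r *\<^sub>R v"] unfolding lborel_preserving_def by simp
    also have "\<dots> = (\<integral>x. indicator D (mul x (r *\<^sub>R v)) * \<theta> (\<Phi> (- r) (mul x (r *\<^sub>R v))) \<partial>lborel)"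
    proof (rule integral_distr)
      have [measurable]: "\<Phi> (- r) \<in> borel_measurable borel"
        by (rule borel_measurable_continuous_onI[OF smooth_on_continuous[OF smPhi]])
      show "(\<lambda>x. indicator D x * \<theta> (\<Phi> (- r) x)) \<in> borel_measurable borel" by measurable
    qed measurable
    also have "\<dots> = (\<integral>x. indicator D' x * \<theta> x \<partial>lborel)"
    proof -
      have "mul x (r *\<^sub>R v) = \<Phi> r x" for x by (simp only: flow \<Phi>_def)
      then have "indicator D (mul x (r *\<^sub>R v)) * \<theta> (\<Phi> (- r) (mul x (r *\<^sub>R v))) = indicator D' x * \<theta> x" for x
        by (simp add: D'_def \<Phi>inv indicator_def)
      then show ?thesis by simp
    qed
    finally show "(\<integral>x. indicator D x * \<theta> x \<partial>lborel) \<le> (\<integral>x. indicator D' x * \<theta> x \<partial>lborel)" .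
  qed
  then show ?thesis by (simp add: D'_def)
qed

end

section \<open>Sets that are monotone along a cone of directions\<close>

text \<open>Along any line in a direction \<open>c0\<close> of the cone, \<open>E\<close> is an open
  half-line, bounded below when \<open>E\<close> is neither empty nor everything. The ball of radius
  \<rho> around \<open>c0\<close> in \<open>C\<close> makes its starting time Lipschitz with
  constant \<open>1 / \<rho>\<close>. A single graph describes all of \<open>E\<close>.\<close>

lemma lipschitz_domain_of_cone:
  fixes E C :: "'e::euclidean_space set"
  assumes E: "open E" and C: "open C" "C \<noteq> {}"
    and cone: "\<And>c t. c \<in> C \<Longrightarrow> t > 0 \<Longrightarrow> t *\<^sub>R c \<in> C"
    and EC: "\<And>x c. x \<in> E \<Longrightarrow> c \<in> C \<Longrightarrow> x + c \<in> E"
  shows "lipschitz_domain E"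
proof (cases "E = {} \<or> E = UNIV")
  case True
  then show ?thesis unfolding lipschitz_domain_def using E by auto
next
  case False
  then obtain x0 x1 where x0: "x0 \<in> E" and x1: "x1 \<notin> E" by blast
  have "\<not> C \<subseteq> {0}"
  proof
    assume "C \<subseteq> {0}"
    then have "C = {0}" using C(2) by blast
    then show False using C(1) not_open_singleton by metis
  qed
  then obtain c0 where c0: "c0 \<in> C" "c0 \<noteq> 0" by blast
  then obtain b where b: "b \<in> Basis" "c0 \<bullet> b \<noteq> 0" by (metis euclidean_all_zero_iff)
  obtain \<rho> where \<rho>: "\<rho> > 0" "ball c0 \<rho> \<subseteq> C" using C(1) c0(1) open_contains_ball by metis
  \<comment> \<open>The displacement is \<open>t\<close> times a vector of
    \<open>ball c0 \<rho>\<close>, hence a direction of the cone.\<close>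
  have key: "x + d + t *\<^sub>R c0 \<in> E" if "x \<in> E" "norm d < \<rho> * t" for x d t
  proof -
    have t: "t > 0"
    proof (rule ccontr)
      assume "\<not> t > 0"
      then have "\<rho> * t \<le> 0" using \<rho>(1) by (simp add: mult_le_0_iff)
      then show False using that(2) norm_ge_zero[of d] by linarith
    qed
    have "dist c0 (c0 + (1 / t) *\<^sub>R d) < \<rho>" using that(2) t by (simp add: dist_norm field_simps)
    then have "c0 + (1 / t) *\<^sub>R d \<in> C" using \<rho>(2) by auto
    then have "t *\<^sub>R (c0 + (1 / t) *\<^sub>R d) \<in> C" using cone t by blast
    then have "x + t *\<^sub>R (c0 + (1 / t) *\<^sub>R d) \<in> E" using EC that(1) by blast
    then show ?thesis using t by (simp add: scaleR_add_right add.assoc add.commute[of d])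
  qed
  define A where "A = (\<lambda>w. {\<tau>. w + \<tau> *\<^sub>R c0 \<in> E})"
  define h where "h = (\<lambda>w. Inf (A w))"
  have step: "\<tau>' \<in> A w'" if "\<tau> \<in> A w" "norm (w' - w) < \<rho> * (\<tau>' - \<tau>)" for \<tau> \<tau>' w w'
  proof -
    have eq: "w + \<tau> *\<^sub>R c0 + (w' - w) + (\<tau>' - \<tau>) *\<^sub>R c0 = w' + \<tau>' *\<^sub>R c0" by (simp add: scaleR_diff_left)
    have "w + \<tau> *\<^sub>R c0 + (w' - w) + (\<tau>' - \<tau>) *\<^sub>R c0 \<in> E"
      by (rule key) (use that in \<open>simp_all add: A_def\<close>)
    then show ?thesis by (simp only: eq A_def mem_Collect_eq)
  qed
  have ne: "A w \<noteq> {}" for w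
  proof -
    have "norm (w - x0) < \<rho> * ((norm (w - x0) + 1) / \<rho> - 0)" using \<rho> by simp
    moreover have "0 \<in> A x0" unfolding A_def using x0 by simp
    ultimately show ?thesis using step by blast
  qed
  \<comment> \<open>A sufficiently negative time in \<open>A w\<close> would force
    \<open>x1\<close>, which lies outside \<open>E\<close>, into \<open>E\<close>.\<close>
  have bdd: "bdd_below (A w)" for w
  proof (rule bdd_belowI)
    fix \<tau> assume t: "\<tau> \<in> A w"
    show "- (norm (x1 - w) / \<rho>) \<le> \<tau>"
    proof (rule ccontr)
      assume "\<not> - (norm (x1 - w) / \<rho>) \<le> \<tau>"
      then have "norm (x1 - w) < \<rho> * (0 - \<tau>)" using \<rho>(1) by (simp add: field_simps)
      then have "0 \<in> A x1" using step t by blast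
      then show False using x1 unfolding A_def by simp
    qed
  qed
  have opn: "\<exists>\<tau>'\<in>A w. \<tau>' < \<tau>" if \<tau>: "\<tau> \<in> A w" for w \<tau>
  proof -
    have "A w = (\<lambda>\<tau>. w + \<tau> *\<^sub>R c0) -` E" unfolding A_def by auto
    moreover have "open ((\<lambda>\<tau>. w + \<tau> *\<^sub>R c0) -` E)" by (intro open_vimage E continuous_intros)
    ultimately obtain r where r: "r > 0" "ball \<tau> r \<subseteq> A w" using \<tau> by (metis open_contains_ball)
    have "\<tau> - r / 2 \<in> ball \<tau> r" using r(1) by (simp add: dist_real_def)
    then have "\<tau> - r / 2 \<in> A w" "\<tau> - r / 2 < \<tau>" using r by auto
    then show ?thesis by blast
  qed
  have Ah: "\<tau> \<in> A w \<longleftrightarrow> h w < \<tau>" for w \<tau>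
  proof
    assume "\<tau> \<in> A w"
    then obtain \<tau>' where "\<tau>' \<in> A w" "\<tau>' < \<tau>" using opn by blast
    then show "h w < \<tau>" unfolding h_def using cInf_lower[OF _ bdd] by fastforce
  next
    assume "h w < \<tau>"
    then obtain \<tau>' where "\<tau>' \<in> A w" "\<tau>' < \<tau>" unfolding h_def using cInf_lessD[OF ne] by blast
    then show "\<tau> \<in> A w" using step[of \<tau>' w w \<tau>] \<rho>(1) by simp
  qed
  have hle: "h w' \<le> h w + norm (w' - w) / \<rho>" for w w'
  proof (rule field_le_epsilon)
    fix \<epsilon> :: real assume e: "\<epsilon> > 0"
    have "h w + \<epsilon> / 2 \<in> A w" using Ah e by simp
    moreover have "norm (w' - w) < \<rho> * ((h w + norm (w' - w) / \<rho> + \<epsilon>) - (h w + \<epsilon> / 2))"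
      using \<rho>(1) e by (simp add: field_simps)
    ultimately have "h w + norm (w' - w) / \<rho> + \<epsilon> \<in> A w'" using step by blast
    then show "h w' \<le> h w + norm (w' - w) / \<rho> + \<epsilon>" using Ah by simp
  qed
  have lip: "(1 / \<rho>)-lipschitz_on {y. y \<bullet> b = 0} h"
  proof (rule lipschitz_onI)
    fix x y
    show "dist (h x) (h y) \<le> 1 / \<rho> * dist x y"
      using hle[of x y] hle[of y x] by (simp add: dist_real_def dist_norm norm_minus_commute)
  qed (use \<rho>(1) in simp)
  \<comment> \<open>The linear map that sends \<open>c0\<close> to \<open>b\<close> and fixes the
    hyperplane orthogonal to \<open>b\<close>; in the new coordinates lines in direction
    \<open>c0\<close> run along \<open>b\<close>.\<close>
  define T where "T = (\<lambda>x. x - ((x \<bullet> b) / (c0 \<bullet> b)) *\<^sub>R (c0 - b))"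
  have linT: "linear T" unfolding T_def
    by (rule linearI) (simp_all add: inner_add_left algebra_simps add_divide_distrib)
  have Tb: "T x \<bullet> b = (x \<bullet> b) / (c0 \<bullet> b)" for x
  proof -
    have "b \<bullet> b = 1" using b(1) by (simp add: inner_same_Basis)
    then have "T x \<bullet> b = x \<bullet> b - (x \<bullet> b) / (c0 \<bullet> b) * (c0 \<bullet> b - 1)" by (simp add: T_def inner_diff_left)
    then show ?thesis using b(2) by (simp add: right_diff_distrib)
  qed
  have Tw: "T x - (T x \<bullet> b) *\<^sub>R b = x - (T x \<bullet> b) *\<^sub>R c0" for x
    unfolding Tb by (simp add: T_def algebra_simps)
  have "inj T"
  proof (rule linear_injective_0[OF linT, THEN iffD2], intro allI impI)
    fix x assume "T x = 0"
    then show "x = 0" using Tw[of x] by simp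
  qed
  then have bijT: "bij T" using linear_injective_imp_surjective[OF linT] by (simp add: bij_def)
  have "E = {x. T x \<bullet> b > h (T x - (T x \<bullet> b) *\<^sub>R b)}"
  proof -
    have "x \<in> E \<longleftrightarrow> T x \<bullet> b \<in> A (T x - (T x \<bullet> b) *\<^sub>R b)" for x unfolding Tw A_def by simp
    then show ?thesis unfolding Ah by blast
  qed
  then have "E \<inter> UNIV = {x \<in> UNIV. T x \<bullet> b > h (T x - (T x \<bullet> b) *\<^sub>R b)}" by simp
  then show ?thesis unfolding lipschitz_domain_def using E linT bijT b(1) lip
    by (intro conjI ballI exI[of _ UNIV] exI[of _ T] exI[of _ b] exI[of _ h] exI[of _ "1 / \<rho>"]) auto
qed

text \<open>Infinitely many disjoint translates of a bounded set of positive measure do not fit into a ball.\<close>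

lemma null_if_lines_meet_once:
  fixes W :: "'e::euclidean_space set"
  assumes W: "W \<in> sets borel" and c: "\<And>x t. x \<in> W \<Longrightarrow> t > 0 \<Longrightarrow> x + t *\<^sub>R c \<notin> W"
  shows "emeasure lborel W = 0"
proof -
  have "emeasure lborel (W \<inter> ball 0 (real n)) = 0" for n
  proof -
    define V where "V = W \<inter> ball 0 (real n)"
    have V[measurable]: "V \<in> sets borel" unfolding V_def using W by simp
    \<comment> \<open>Distinct but bounded lengths: the translates are pairwise disjoint and remain
      in one ball.\<close>
    define t where "t = (\<lambda>k. 1 / real (Suc k))"
    define F where "F = (\<lambda>k. (+) (- (t k *\<^sub>R c)) -` V)"
    have Fm: "(+) (- (t k *\<^sub>R c)) \<in> borel_measurable borel" for k by measurable
    have Fb: "F k \<in> sets borel" for k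
      using measurable_sets[OF Fm V] by (simp only: F_def space_borel Int_UNIV_right)
    have eF: "emeasure lborel (F k) = emeasure lborel V" for k
    proof -
      have "emeasure lborel V = emeasure (distr lborel borel ((+) (- (t k *\<^sub>R c)))) V"
        by (simp only: lborel_distr_plus)
      also have "\<dots> = emeasure lborel (F k)"
        unfolding F_def by (subst emeasure_distr) auto
      finally show ?thesis by simp
    qed
    have disj: "disjoint_family F"
    proof -
      have *: "F i \<inter> F j = {}" if "i < j" for i j
      proof (rule ccontr)
        assume "F i \<inter> F j \<noteq> {}"
        then obtain x where "- (t i *\<^sub>R c) + x \<in> W" "- (t j *\<^sub>R c) + x \<in> W" unfolding F_def V_def by auto
        moreover have "t j < t i" unfolding t_def using that by (intro divide_strict_left_mono) auto
        then have "t i - t j > 0" by simp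
        moreover have "- (t i *\<^sub>R c) + x + (t i - t j) *\<^sub>R c = - (t j *\<^sub>R c) + x" by (simp add: algebra_simps)
        ultimately show False using c by metis
      qed
      show ?thesis unfolding disjoint_family_on_def using * by (metis inf_commute linorder_neqE_nat)
    qed
    have Fsub: "F k \<subseteq> ball 0 (real n + norm c)" for k
    proof
      fix x assume "x \<in> F k"
      then have "norm (- (t k *\<^sub>R c) + x) < real n" unfolding F_def V_def by simp
      moreover have "norm x \<le> norm (- (t k *\<^sub>R c) + x) + norm (t k *\<^sub>R c)"
        using norm_triangle_ineq[of "- (t k *\<^sub>R c) + x" "t k *\<^sub>R c"] by simp
      moreover have "norm (t k *\<^sub>R c) \<le> norm c" 
      proof -
        have "0 \<le> t k" "t k \<le> 1" unfolding t_def by auto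
        then show ?thesis by (simp add: mult_left_le_one_le)
      qed
      ultimately show "x \<in> ball 0 (real n + norm c)" by simp
    qed
    have Vf: "emeasure lborel V < \<infinity>"
    proof -
      have "emeasure lborel V \<le> emeasure lborel (ball (0::'e) (real n))"
        unfolding V_def by (intro emeasure_mono) auto
      also have "\<dots> < \<infinity>" by (rule emeasure_lborel_ball_finite)
      finally show ?thesis .
    qed
    have Bf: "emeasure lborel (ball (0::'e) (real n + norm c)) < \<infinity>" by (rule emeasure_lborel_ball_finite)
    define m where "m = enn2real (emeasure lborel V)"
    define B where "B = enn2real (emeasure lborel (ball (0::'e) (real n + norm c)))"
    have m: "emeasure lborel V = ennreal m" "m \<ge> 0" and B: "emeasure lborel (ball (0::'e) (real n + norm c)) = ennreal B" "B \<ge> 0"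
      unfolding m_def B_def using Vf Bf by (simp_all add: less_top)
    have "real N * m \<le> B" for N
    proof -
      have "ennreal (real N * m) = (\<Sum>k<N. emeasure lborel (F k))"
        using m(2) by (simp add: eF m(1) ennreal_mult ennreal_of_nat_eq_real_of_nat)
      also have "\<dots> = emeasure lborel (\<Union>k<N. F k)"
        by (rule sum_emeasure) (use Fb disj in \<open>auto simp: disjoint_family_on_def\<close>)
      also have "\<dots> \<le> emeasure lborel (ball (0::'e) (real n + norm c))"
        by (rule emeasure_mono) (use Fsub in auto)
      finally show ?thesis using B m by simp
    qed
    then have "m = 0" using m(2) reals_Archimedean3[of m] by (metis antisym_conv2 not_le)
    then show ?thesis using m unfolding V_def by simp
  qed
  then have "emeasure lborel (\<Union>n. W \<inter> ball 0 (real n)) = 0" using W by (intro emeasure_UN_eq_0) auto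
  moreover have "(\<Union>n. W \<inter> ball 0 (real n)) = W" using reals_Archimedean2 by auto
  ultimately show ?thesis by simp
qed

text \<open>The set \<open>G\<close> of good points is not known to be measurable. Therefore the
  exceptional points are enclosed in a measurable null set \<open>N\<close>, and the set left over,
  \<open>D - N - E\<close>, is Borel because \<open>E\<close> is open.\<close>

lemma cone_monotone_lipschitz:
  fixes D C :: "'e::euclidean_space set"
  assumes D: "D \<in> sets borel" and C: "open C" "C \<noteq> {}"
    and cone: "\<And>c t. c \<in> C \<Longrightarrow> t > 0 \<Longrightarrow> t *\<^sub>R c \<in> C" and add: "\<And>c c'. c \<in> C \<Longrightarrow> c' \<in> C \<Longrightarrow> c + c' \<in> C"
    and mono: "AE p in lborel. p \<in> D \<longrightarrow> (AE y in lborel. y - p \<in> C \<longrightarrow> y \<in> D)"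
  obtains E where "lipschitz_domain E" "AE x in lborel. x \<in> D \<longleftrightarrow> x \<in> E"
proof -
  obtain N where N: "N \<in> null_sets lborel"
    "{p \<in> space lborel. \<not> (p \<in> D \<longrightarrow> (AE y in lborel. y - p \<in> C \<longrightarrow> y \<in> D))} \<subseteq> N"
    using iffD1[OF eventually_ae_filter mono] by (elim bexE)
  have Nb: "N \<in> sets borel" using null_setsD2[OF N(1)] by simp
  define G where "G = {p \<in> D. AE y in lborel. y - p \<in> C \<longrightarrow> y \<in> D}"
  have DN: "D - N \<subseteq> G" unfolding G_def using N(2) by auto
  have op: "open ((\<lambda>y. y - p) -` C)" for p by (intro open_vimage C continuous_intros)
  define E where "E = (\<Union>p\<in>G. (\<lambda>y. y - p) -` C)"
  have oE: "open E" unfolding E_def using op by blast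
  have lip: "lipschitz_domain E"
  proof (rule lipschitz_domain_of_cone[OF oE C cone])
    fix x c assume "x \<in> E" "c \<in> C"
    then obtain p where "p \<in> G" "x - p \<in> C" unfolding E_def by auto
    then have "x + c - p \<in> C" using add[of "x - p" c] \<open>c \<in> C\<close> by (simp add: algebra_simps)
    then show "x + c \<in> E" using \<open>p \<in> G\<close> unfolding E_def by auto
  qed
  have ED: "AE y in lborel. y \<in> E \<longrightarrow> y \<in> D"
  proof -
    \<comment> \<open>The union of cones is uncountable, whereas each cone lies in \<open>D\<close>
      only up to its own null set; Lindelof reduces it to a countable union.\<close>
    obtain F' where F': "F' \<subseteq> (\<lambda>p. (\<lambda>y. y - p) -` C) ` G" "countable F'" "\<Union>F' = \<Union>((\<lambda>p. (\<lambda>y. y - p) -` C) ` G)"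
      using Lindelof[of "(\<lambda>p. (\<lambda>y. y - p) -` C) ` G"] op by auto
    have "AE y in lborel. \<forall>S\<in>F'. y \<in> S \<longrightarrow> y \<in> D"
    proof (rule AE_ball_countable[OF F'(2), THEN iffD2], rule ballI)
      fix S assume "S \<in> F'"
      then obtain p where "p \<in> G" "S = (\<lambda>y. y - p) -` C" using F'(1) by blast
      then show "AE y in lborel. y \<in> S \<longrightarrow> y \<in> D" unfolding G_def by simp
    qed
    moreover have "E \<subseteq> \<Union>F'" unfolding E_def F'(3) ..
    ultimately show ?thesis by (elim eventually_mono) blast
  qed
  obtain c0 where c0: "c0 \<in> C" using C(2) by blast
  have "emeasure lborel (D - N - E) = 0"
  proof (rule null_if_lines_meet_once[of _ c0])
    show "D - N - E \<in> sets borel" using D Nb oE by simp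
    fix x t assume x: "x \<in> D - N - E" and t: "(t::real) > 0"
    then have "x \<in> G" using DN by blast
    moreover have "(x + t *\<^sub>R c0) - x \<in> C" using cone[OF c0 t] by simp
    ultimately have "x + t *\<^sub>R c0 \<in> E" unfolding E_def by blast
    then show "x + t *\<^sub>R c0 \<notin> D - N - E" by blast
  qed
  then have "D - N - E \<in> null_sets lborel" using D Nb oE by (auto simp: null_sets_def)
  then have "AE x in lborel. x \<notin> D - N - E" by (rule AE_not_in)
  moreover have "AE x in lborel. x \<notin> N" by (rule AE_not_in[OF N(1)])
  ultimately have "AE x in lborel. x \<in> D \<longleftrightarrow> x \<in> E" using ED by eventually_elim blast
  then show thesis using that lip by blast
qed

section \<open>The semigroup of monotone directions and its two possible shapes\<close>

context filiform_model
begin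

definition mono_dirs :: "'e set \<Rightarrow> 'e set" where
  "mono_dirs D = {c. AE x in lborel. x \<in> D \<longrightarrow> mul x c \<in> D}"

text \<open>The exceptional null set for \<open>d\<close> is pulled back by right translation by
  \<open>c\<close>, which preserves Lebesgue measure.\<close>

lemma mono_dirs_mul:
  assumes D[measurable]: "D \<in> sets borel" and c: "c \<in> mono_dirs D" and d: "d \<in> mono_dirs D"
  shows "mul c d \<in> mono_dirs D"
proof -
  have "AE x in lborel. mul x c \<in> D \<longrightarrow> mul (mul x c) d \<in> D"
    by (rule lborel_preserving_AE[OF mul_right_preserving[of c], of "\<lambda>y. y \<in> D \<longrightarrow> mul y d \<in> D"])
      (use d in \<open>auto simp: mono_dirs_def\<close>)
  moreover have "AE x in lborel. x \<in> D \<longrightarrow> mul x c \<in> D" using c by (simp add: mono_dirs_def)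
  ultimately show ?thesis unfolding mono_dirs_def mem_Collect_eq
    by eventually_elim (simp add: mul_assoc)
qed

text \<open>The null set of bad points depends on the direction \<open>c\<close>; exchanging the
  quantifiers yields, for almost every \<open>p\<close>, almost all directions at once. In the
  passage from \<open>c\<close> to \<open>y = mul p c\<close> the vector \<open>y - p\<close> is
  sheared, which the stability of \<open>C\<close> absorbs.\<close>

lemma cone_full_monotone:
  assumes D[measurable]: "D \<in> sets borel" and C: "open C" and sC: "\<And>t c. c \<in> C \<Longrightarrow> shear t c \<in> C"
    and CD: "C \<subseteq> mono_dirs D"
  shows "AE p in lborel. p \<in> D \<longrightarrow> (AE y in lborel. y - p \<in> C \<longrightarrow> y \<in> D)"
proof -
  have Cb[measurable]: "C \<in> sets borel" using C by simp
  have "AE c in lborel. AE p in lborel. c \<in> C \<longrightarrow> p \<in> D \<longrightarrow> mul p c \<in> D"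
  proof (rule AE_I2)
    fix c
    show "AE p in lborel. c \<in> C \<longrightarrow> p \<in> D \<longrightarrow> mul p c \<in> D"
      using CD unfolding mono_dirs_def by (cases "c \<in> C") auto
  qed
  note swapped = this
  have "AE p in lborel. AE c in lborel. c \<in> C \<longrightarrow> p \<in> D \<longrightarrow> mul p c \<in> D"
  proof (rule iffD2[OF lborel_pair.AE_commute, OF _ swapped])
    show "{x \<in> space (lborel \<Otimes>\<^sub>M lborel). snd x \<in> C \<longrightarrow> fst x \<in> D \<longrightarrow> mul (fst x) (snd x) \<in> D} \<in> sets (lborel \<Otimes>\<^sub>M lborel)"
      by measurable
  qed
  then show ?thesis
  proof eventually_elim
    case (elim p)
    show ?case
    proof
      assume "p \<in> D"
      then have "AE c in lborel. c \<in> C \<longrightarrow> mul p c \<in> D" using elim by simp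
      from lborel_preserving_AE[OF mul_left_preserving[of "minv p"] _ this]
      have "AE y in lborel. mul (minv p) y \<in> C \<longrightarrow> y \<in> D" by simp
      moreover have "mul (minv p) y = shear (- (p \<bullet> e 0)) (y - p)" for y
        by (simp add: mul_def minv_def shear_diff)
      ultimately show "AE y in lborel. y - p \<in> C \<longrightarrow> y \<in> D"
        by (elim eventually_mono) (auto intro: sC)
    qed
  qed
qed

text \<open>The pairing of \<open>a\<close> with the curve is a polynomial in \<open>t\<close> of
  degree at most \<open>s - 1\<close> whose coefficients are the coordinates of \<open>a\<close>
  divided by factorials; infinitely many zeros make all of them vanish.\<close>

lemma vanish_on_curve:
  assumes a0: "a \<bullet> e 0 = 0" and I: "infinite I" and v: "\<And>t. t \<in> I \<Longrightarrow> a \<bullet> shear t (e 1) = 0"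
  shows "a = 0"
proof -
  define c where "c = (\<lambda>i. (a \<bullet> e (Suc i)) / fact i)"
  have "a \<bullet> shear t (e 1) = (\<Sum>i\<le>s - 1. c i * t ^ i)" for t
  proof -
    have "shear t (e 1) = (\<Sum>j\<le>s. (shear t (e 1) \<bullet> e j) *\<^sub>R e j)" by (rule coord_expand[symmetric])
    then have "a \<bullet> shear t (e 1) = (\<Sum>j\<le>s. (shear t (e 1) \<bullet> e j) * (a \<bullet> e j))"
      by (metis (no_types, lifting) inner_scaleR_right inner_sum_right sum.cong)
    also have "\<dots> = (\<Sum>j\<in>Suc ` {..s - 1}. (shear t (e 1) \<bullet> e j) * (a \<bullet> e j))"
    proof (rule sum.mono_neutral_right)
      show "\<forall>j\<in>{..s} - Suc ` {..s - 1}. shear t (e 1) \<bullet> e j * (a \<bullet> e j) = 0"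
      proof
        fix j assume "j \<in> {..s} - Suc ` {..s - 1}"
        then have "j = 0" using s_pos by (cases j) auto
        then show "shear t (e 1) \<bullet> e j * (a \<bullet> e j) = 0" using a0 by simp
      qed
    qed (use s_pos in auto)
    also have "\<dots> = (\<Sum>i\<le>s - 1. c i * t ^ i)"
      unfolding sum.reindex[OF inj_Suc] using s_pos
      by (intro sum.cong) (auto simp: shear_basis_coord c_def divpow_def)
    finally show ?thesis .
  qed
  then have "I \<subseteq> {t. (\<Sum>i\<le>s - 1. c i * t ^ i) = 0}" using v by auto
  then have "infinite {t. (\<Sum>i\<le>s - 1. c i * t ^ i) = 0}" using I infinite_super by blast
  then have "\<forall>i\<le>s - 1. c i = 0" using polyfun_finite_roots[where n = "s - 1" and c = c] by blast
  then have c0: "a \<bullet> e (Suc i) = 0" if "i \<le> s - 1" for i using that unfolding c_def by simp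
  show ?thesis
  proof (rule coord_eqI)
    fix j assume "j \<le> s"
    then show "a \<bullet> e j = 0 \<bullet> e j" using a0 c0[of "j - 1"] by (cases j) auto
  qed
qed

text \<open>The convex cone over the moment curve, built by adding one multiple at a time so that
  each step corresponds to one group product. \<open>e (Suc 0)\<close> is the simplifier's form of
  \<open>e 1\<close>.\<close>

inductive_set curve_cone :: "'e set" where
  zero: "0 \<in> curve_cone"
| add: "v \<in> curve_cone \<Longrightarrow> 0 \<le> r \<Longrightarrow> v + r *\<^sub>R shear t (e (Suc 0)) \<in> curve_cone"

lemma e1_e0 [simp]: "e (Suc 0) \<bullet> e 0 = 0"
  using s_pos by (simp add: e_inner)

lemma curve_cone_e0: "v \<in> curve_cone \<Longrightarrow> v \<bullet> e 0 = 0"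
  by (induction rule: curve_cone.induct) (simp_all add: inner_add_left)

lemma curve_cone_add: "w \<in> curve_cone \<Longrightarrow> v \<in> curve_cone \<Longrightarrow> v + w \<in> curve_cone"
  by (induction rule: curve_cone.induct) (auto simp flip: add.assoc intro: curve_cone.intros)

lemma curve_cone_scale: "v \<in> curve_cone \<Longrightarrow> 0 \<le> k \<Longrightarrow> k *\<^sub>R v \<in> curve_cone"
  by (induction rule: curve_cone.induct) (auto simp: scaleR_add_right intro: curve_cone.intros)

lemma curve_cone_shear: "v \<in> curve_cone \<Longrightarrow> shear t v \<in> curve_cone"
  by (induction rule: curve_cone.induct) (auto simp: shear_add shear_scale shear_shear intro: curve_cone.intros)

text \<open>Inside the abelian ideal products are sums, so the semigroup contains the cone over the
  curve, and also its sum \<open>Q\<close> with the line along \<open>e 0\<close>. This convex set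
  lies in no hyperplane, hence has interior; the interior inherits stability under shears, scaling
  and addition.\<close>

lemma lipschitz_if_curve_monotone:
  assumes D: "D \<in> sets borel" and S0: "\<And>r. r *\<^sub>R e 0 \<in> mono_dirs D"
    and S1: "\<And>r. 0 \<le> r \<Longrightarrow> r *\<^sub>R e 1 \<in> mono_dirs D"
  obtains E where "lipschitz_domain E" "AE x in lborel. x \<in> D \<longleftrightarrow> x \<in> E"
proof -
  have gen: "r *\<^sub>R shear t (e (Suc 0)) \<in> mono_dirs D" if "0 \<le> r" for r t
  proof -
    have "mul (mul (t *\<^sub>R e 0) (r *\<^sub>R e 1)) ((- t) *\<^sub>R e 0) \<in> mono_dirs D"
      by (intro mono_dirs_mul D S0 S1 that)
    then show ?thesis by (subst (asm) mul_scale_basis0) (simp add: mul_def e_inner shear_scale)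
  qed
  have K: "v \<in> mono_dirs D" if "v \<in> curve_cone" for v
    using that
  proof (induction rule: curve_cone.induct)
    case zero
    show ?case using S0[of 0] by simp
  next
    case (add v r t)
    have "mul v (r *\<^sub>R shear t (e (Suc 0))) \<in> mono_dirs D" by (intro mono_dirs_mul D add gen)
    then show ?case by (simp add: mul_def curve_cone_e0[OF add.hyps(1)])
  qed
  define Q where "Q = {v + t *\<^sub>R e 0 | v t. v \<in> curve_cone}"
  have QI: "v + t *\<^sub>R e 0 \<in> Q" if "v \<in> curve_cone" for v t unfolding Q_def using that by blast
  have QD: "Q \<subseteq> mono_dirs D"
  proof
    fix q assume "q \<in> Q"
    then obtain v t where q: "q = v + t *\<^sub>R e 0" "v \<in> curve_cone" unfolding Q_def by blast
    have "mul v (t *\<^sub>R e 0) \<in> mono_dirs D" by (intro mono_dirs_mul D K q S0)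
    then show "q \<in> mono_dirs D" by (simp add: q(1) mul_scale_basis0)
  qed
  have Qadd: "x + y \<in> Q" if xy: "x \<in> Q" "y \<in> Q" for x y
  proof -
    obtain v t w r where "x = v + t *\<^sub>R e 0" "y = w + r *\<^sub>R e 0" "v \<in> curve_cone" "w \<in> curve_cone"
      using xy unfolding Q_def by blast
    then show ?thesis using QI[OF curve_cone_add, of w v "t + r"] by (simp add: algebra_simps)
  qed
  have Qscale: "k *\<^sub>R x \<in> Q" if "x \<in> Q" "0 \<le> k" for x k
    using that QI[OF curve_cone_scale] unfolding Q_def by (auto simp: scaleR_add_right)
  have Qshear: "shear t x \<in> Q" if "x \<in> Q" for x t
    using that QI[OF curve_cone_shear] unfolding Q_def by (auto simp: shear_add shear_scale)
  have conv: "convex Q" by (rule convexI) (intro Qadd Qscale)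
  define C where "C = interior Q"
  have ne: "C \<noteq> {}"
  proof
    assume "C = {}"
    then obtain a b where ab: "a \<noteq> 0" "Q \<subseteq> {x. a \<bullet> x = b}"
      using empty_interior_subset_hyperplane[OF conv] unfolding C_def by metis
    \<comment> \<open>The hyperplane passes through 0, which belongs to \<open>Q\<close>. Its normal
      is orthogonal to \<open>e 0\<close> and to the whole moment curve, and so vanishes.\<close>
    have b: "b = 0" using ab(2) QI[OF curve_cone.zero, of 0] by auto
    have a0: "a \<bullet> e 0 = 0" using ab(2) QI[OF curve_cone.zero, of 1] b by auto
    have "a \<bullet> shear t (e 1) = 0" for t
      using ab(2) QI[OF curve_cone.add[OF curve_cone.zero, of 1 t], of 0] b by auto
    then have "a = 0" using vanish_on_curve[OF a0, of UNIV] infinite_UNIV_char_0 by blast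
    then show False using ab by simp
  qed
  have oC: "open C" and CQ: "C \<subseteq> Q" unfolding C_def by (auto simp: interior_subset)
  \<comment> \<open>A homeomorphism that maps \<open>Q\<close> into itself maps interior points to
    interior points.\<close>
  have Cmap: "f c \<in> C" if c: "c \<in> C" and f: "\<And>x. x \<in> Q \<Longrightarrow> f x \<in> Q" "continuous_on UNIV g" "\<And>x. f (g x) = x" "\<And>x. g (f x) = x"
    for f g :: "'e \<Rightarrow> 'e" and c
  proof -
    have "open (g -` C)" by (rule open_vimage[OF oC f(2)])
    moreover have "g -` C \<subseteq> Q" using f(1,3) CQ by (metis subsetD subsetI vimageE)
    moreover have "f c \<in> g -` C" using c f(4) by simp
    ultimately show ?thesis unfolding C_def by (metis interiorI)
  qed
  have Cshear: "shear t c \<in> C" if "c \<in> C" for t c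
    by (rule Cmap[OF that, of "shear t" "shear (- t)"])
      (auto intro: Qshear linear_continuous_on bounded_linear_shear simp: shear_shear)
  have Cscale: "t *\<^sub>R c \<in> C" if "c \<in> C" "t > 0" for t c
    by (rule Cmap[OF that(1), of "\<lambda>x. t *\<^sub>R x" "\<lambda>x. (1 / t) *\<^sub>R x"])
      (use that(2) in \<open>auto intro: Qscale continuous_intros\<close>)
  have Cadd: "c + c' \<in> C" if "c \<in> C" "c' \<in> C" for c c'
  proof -
    have "(1 / 2) *\<^sub>R c + (1 / 2) *\<^sub>R c' \<in> C"
      using convexD[OF convex_interior[OF conv], of c c' "1 / 2" "1 / 2"] that unfolding C_def by simp
    from Cscale[OF this, of 2] show ?thesis by (simp add: scaleR_add_right)
  qed
  show thesis
    using cone_monotone_lipschitz[OF D oC ne Cscale Cadd cone_full_monotone[OF D oC Cshear]] CQ QD that by blast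
qed

text \<open>Multiples of \<open>X 1\<close> of either sign are free, while \<open>X 0\<close> can be
  followed forwards only. A multiple of \<open>X 1\<close> inserted at time \<open>x\<close>
  contributes that multiple of \<open>shear x (e 1)\<close>, and the times between 0 and \<tau>
  already span the hyperplane. Thus every point with positive \<open>e 0\<close> coordinate \<tau>
  is reached, and this half-space is stable under shears.\<close>

lemma lipschitz_if_time_monotone:
  assumes D: "D \<in> sets borel" and S1: "\<And>r. r *\<^sub>R e 1 \<in> mono_dirs D"
    and S0: "\<And>r. 0 \<le> r \<Longrightarrow> r *\<^sub>R e 0 \<in> mono_dirs D"
  obtains E where "lipschitz_domain E" "AE x in lborel. x \<in> D \<longleftrightarrow> x \<in> E"
proof -
  \<comment> \<open>Induction on the largest time: it is reached by moving forward, the kick along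
    \<open>e 1\<close> is applied there, and the remaining time is spent along
    \<open>e 0\<close>.\<close>
  have sums: "(\<Sum>x\<in>F. g x *\<^sub>R shear x (e 1)) + \<tau> *\<^sub>R e 0 \<in> mono_dirs D"
    if "finite F" "\<forall>x\<in>F. 0 \<le> x \<and> x \<le> \<tau>" "0 \<le> \<tau>" for F g \<tau>
    using that
  proof (induction F arbitrary: \<tau> rule: finite_linorder_max_induct)
    case empty
    then show ?case using S0 by simp
  next
    case (insert b F)
    let ?c = "(\<Sum>x\<in>F. g x *\<^sub>R shear x (e 1)) + b *\<^sub>R e 0"
    have bF: "b \<notin> F" using insert by auto
    have "?c \<in> mono_dirs D" using insert by (intro insert.IH) force+
    moreover have "0 \<le> \<tau> - b" using insert by auto
    ultimately have "mul (mul ?c (g b *\<^sub>R e 1)) ((\<tau> - b) *\<^sub>R e 0) \<in> mono_dirs D"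
      by (intro mono_dirs_mul D S1 S0)
    moreover have "?c \<bullet> e 0 = b" by (simp add: inner_add_left inner_sum_left e_inner)
    then have "mul ?c (g b *\<^sub>R e 1) = ?c + g b *\<^sub>R shear b (e 1)" by (simp add: mul_def shear_scale)
    ultimately have "?c + g b *\<^sub>R shear b (e 1) + (\<tau> - b) *\<^sub>R e 0 \<in> mono_dirs D" by (simp only: mul_scale_basis0)
    then show ?case using bF insert.hyps(1) by (simp add: algebra_simps)
  qed
  define C where "C = {x. x \<bullet> e 0 > 0}"
  have CD: "C \<subseteq> mono_dirs D"
  proof
    fix c assume "c \<in> C"
    define \<tau> where "\<tau> = c \<bullet> e 0"
    have \<tau>: "\<tau> > 0" using \<open>c \<in> C\<close> unfolding C_def \<tau>_def by simp
    let ?B = "(\<lambda>t. shear t (e 1)) ` {0..\<tau>}"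
    have u0: "horiz c \<bullet> e 0 = 0" by simp
    obtain y z where yz: "y \<in> span ?B" "\<And>w. w \<in> span ?B \<Longrightarrow> orthogonal z w" "horiz c = y + z"
      using orthogonal_subspace_decomp_exists[of ?B "horiz c"] by metis
    have "y \<bullet> e 0 = 0" using yz(1) by (induction rule: span_induct_alt) (auto simp: inner_add_left)
    then have z0: "z \<bullet> e 0 = 0" using u0 yz(3) by (simp add: inner_add_left)
    \<comment> \<open>The component orthogonal to the arc of the curve vanishes, so the arc spans
      the hyperplane.\<close>
    have "z = 0"
    proof (rule vanish_on_curve[OF z0, of "{0..\<tau>}"])
      show "infinite {0..\<tau>}" using \<tau> by (simp add: infinite_Icc)
      fix t assume "t \<in> {0..\<tau>}"
      then have "shear t (e 1) \<in> span ?B" by (intro span_base) blast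
      then show "z \<bullet> shear t (e 1) = 0" using yz(2) by (simp add: orthogonal_def)
    qed
    then have "horiz c \<in> span ?B" using yz by simp
    then obtain t r where tr: "finite t" "t \<subseteq> ?B" "horiz c = (\<Sum>a\<in>t. r a *\<^sub>R a)"
      unfolding span_explicit by blast
    \<comment> \<open>Each vector of the linear combination is assigned one time; distinct vectors
      receive distinct times, so coefficients can be indexed by times as in
      \<open>sums\<close>.\<close>
    have "\<forall>a\<in>t. \<exists>x. x \<in> {0..\<tau>} \<and> shear x (e 1) = a" using tr(2) by blast
    from bchoice[OF this] obtain x where x: "\<forall>a\<in>t. x a \<in> {0..\<tau>} \<and> shear (x a) (e 1) = a" by blast
    then have x1: "\<And>a. a \<in> t \<Longrightarrow> x a \<in> {0..\<tau>}" and x2: "\<And>a. a \<in> t \<Longrightarrow> shear (x a) (e 1) = a" by auto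
    have inj: "inj_on x t" by (rule inj_onI) (metis x2)
    have "(\<Sum>y\<in>x ` t. r (shear y (e 1)) *\<^sub>R shear y (e 1)) = (\<Sum>a\<in>t. r (shear (x a) (e 1)) *\<^sub>R shear (x a) (e 1))"
      by (simp add: sum.reindex[OF inj])
    also have "\<dots> = (\<Sum>a\<in>t. r a *\<^sub>R a)"
    proof (rule sum.cong[OF refl])
      fix a assume "a \<in> t"
      then have "shear (x a) (e 1) = a" by (rule x2)
      then show "r (shear (x a) (e 1)) *\<^sub>R shear (x a) (e 1) = r a *\<^sub>R a" by (simp only:)
    qed
    finally have "(\<Sum>y\<in>x ` t. r (shear y (e 1)) *\<^sub>R shear y (e 1)) = horiz c" by (simp only: tr(3))
    moreover have "(\<Sum>y\<in>x ` t. r (shear y (e 1)) *\<^sub>R shear y (e 1)) + \<tau> *\<^sub>R e 0 \<in> mono_dirs D"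
      by (rule sums) (use tr(1) x1 \<tau> in auto)
    ultimately show "c \<in> mono_dirs D" by (simp add: horiz_def \<tau>_def)
  qed
  have oC: "open C" unfolding C_def by (intro open_Collect_less continuous_intros)
  have ne: "C \<noteq> {}" unfolding C_def using e_inner[of 0 0] by (auto intro!: exI[of _ "e 0"])
  have "AE p in lborel. p \<in> D \<longrightarrow> (AE y in lborel. y - p \<in> C \<longrightarrow> y \<in> D)"
    by (rule cone_full_monotone[OF D oC _ CD]) (simp add: C_def)
  then show thesis
    by (rule cone_monotone_lipschitz[OF D oC ne, rotated 2]) (auto simp: C_def inner_add_left intro: that)
qed

end

section \<open>Transfer between the group and its coordinates\<close>

context filiform_model
begin

definition dir_integral :: "'e set \<Rightarrow> nat \<Rightarrow> ('e \<Rightarrow> real) \<Rightarrow> real" where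
  "dir_integral D j \<theta> = (\<integral>x. indicator D x * frechet_derivative \<theta> (at x) (shear (x \<bullet> e 0) (e j)) \<partial>lborel)"

definition test_fun :: "('e \<Rightarrow> real) \<Rightarrow> bool" where
  "test_fun \<theta> \<longleftrightarrow> smooth_on UNIV \<theta> \<and> compact (closure {x. \<theta> x \<noteq> 0})"

lemma shear_e_fixed: "j \<le> 1 \<Longrightarrow> shear (r * (e j \<bullet> e 0)) (e j) = e j"
  using e1_e0 by (cases "j = 0") (auto simp: le_Suc_eq)

lemma mono_dirs_nonneg:
  assumes D: "D \<in> sets borel" and j: "j \<le> 1"
    and t: "\<And>\<theta>. test_fun \<theta> \<Longrightarrow> (\<And>x. 0 \<le> \<theta> x) \<Longrightarrow> dir_integral D j \<theta> \<le> 0" and r: "0 \<le> r"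
  shows "r *\<^sub>R e j \<in> mono_dirs D"
  unfolding mono_dirs_def mem_Collect_eq
  by (rule monotone_flow[OF D _ _ r]) (use t shear_e_fixed[OF j] in \<open>auto simp: dir_integral_def test_fun_def\<close>)

text \<open>Vanishing of the integral gives monotonicity along \<open>- e j\<close> too, which
  covers negative \<open>r\<close>.\<close>

lemma mono_dirs_all:
  assumes D: "D \<in> sets borel" and j: "j \<le> 1"
    and t: "\<And>\<theta>. test_fun \<theta> \<Longrightarrow> (\<And>x. 0 \<le> \<theta> x) \<Longrightarrow> dir_integral D j \<theta> = 0"
  shows "r *\<^sub>R e j \<in> mono_dirs D"
proof (cases "0 \<le> r")
  case True
  then show ?thesis by (intro mono_dirs_nonneg[OF D j]) (use t in auto)
next
  case False
  have "AE x in lborel. x \<in> D \<longrightarrow> mul x ((- r) *\<^sub>R (- e j)) \<in> D"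
  proof (rule monotone_flow[OF D])
    show "shear (r * (- e j \<bullet> e 0)) (- e j) = - e j" for r
      using shear_e_fixed[OF j, of "- r"] by (simp add: shear_minus)
    fix \<theta> :: "'e \<Rightarrow> real"
    assume \<theta>: "smooth_on UNIV \<theta>" "compact (closure {x. \<theta> x \<noteq> 0})" "\<And>x. 0 \<le> \<theta> x"
    have "frechet_derivative \<theta> (at x) (shear (x \<bullet> e 0) (- e j)) = - frechet_derivative \<theta> (at x) (shear (x \<bullet> e 0) (e j))" for x
      using has_derivative_linear[OF smooth_on_has_derivative[OF \<theta>(1) UNIV_I]] by (simp add: shear_minus linear_neg)
    then show "(\<integral>x. indicator D x * frechet_derivative \<theta> (at x) (shear (x \<bullet> e 0) (- e j)) \<partial>lborel) \<le> 0"
      using t[of \<theta>] \<theta> by (simp add: dir_integral_def test_fun_def)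
  qed (use False in auto)
  then show ?thesis unfolding mono_dirs_def by simp
qed

lemma continuous_on_dir_derivative:
  assumes "smooth_on UNIV \<theta>"
  shows "continuous_on UNIV (\<lambda>x. frechet_derivative \<theta> (at x) (shear (x \<bullet> e 0) v))"
  by (intro smooth_on_continuous smooth_on_derivative_along assms smooth_on_shear smooth_on_inner_const) auto

lemma integrable_dir_derivative:
  assumes \<theta>: "test_fun \<theta>"
  shows "integrable lborel (\<lambda>x. frechet_derivative \<theta> (at x) (shear (x \<bullet> e 0) v))"
proof (rule integrable_test)
  let ?K = "closure {x. \<theta> x \<noteq> 0}" and ?g = "\<lambda>x. frechet_derivative \<theta> (at x) (shear (x \<bullet> e 0) v)"
  show "continuous_on UNIV ?g" using \<theta> continuous_on_dir_derivative unfolding test_fun_def by blast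
  have "?g x = 0" if "x \<notin> ?K" for x
  proof -
    have o: "open (- ?K)" "x \<in> - ?K" using that by auto
    have "((\<lambda>x. 0) has_derivative (\<lambda>h. 0)) (at x)" by simp
    then have "(\<theta> has_derivative (\<lambda>h. 0)) (at x)"
      by (rule has_derivative_transform_within_open[OF _ o]) (use closure_subset[of "{x. \<theta> x \<noteq> 0}"] in auto)
    then have "frechet_derivative \<theta> (at x) = (\<lambda>h. 0)" by (metis frechet_derivative_at)
    then show ?thesis by simp
  qed
  then have "{x. ?g x \<noteq> 0} \<subseteq> ?K" by blast
  then have "closure {x. ?g x \<noteq> 0} \<subseteq> ?K" by (simp add: closure_minimal)
  moreover have "compact ?K" using \<theta> unfolding test_fun_def by blast
  ultimately show "compact (closure {x. ?g x \<noteq> 0})"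
    using compact_Int_closed[of ?K "closure {x. ?g x \<noteq> 0}"] by (simp add: Int_absorb1)
qed

end

section \<open>Transport of Haar measure and test functions to the coordinates\<close>

locale filiform_measure = filiform_model e s
  for e :: "nat \<Rightarrow> 'e::euclidean_space" and s :: nat +
  fixes A :: "('g::{topological_group_add,t2_space,second_countable_topology}, 'e) chart set"
    and X :: "nat \<Rightarrow> 'g vfield" and f :: "'g \<Rightarrow> 'e" and vol :: "'g measure" and E :: "'g set"
  assumes charted_A: "charted A" and diffeo: "diffeomorphism A euclidean_atlas f"
    and f_add: "\<And>x y. f (x + y) = mul (f x) (f y)"
    and X_f: "\<And>h j a. smooth_on UNIV h \<Longrightarrow> j \<le> s \<Longrightarrow>
       X j (\<lambda>x. h (f x)) a = frechet_derivative h (at (f a)) (shear (f a \<bullet> e 0) (e j))"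
    and haar: "haar_measure vol" and E: "E \<in> sets (completion vol)"
begin

lemma bij_f: "bij f" and smooth_f: "smooth_map A euclidean_atlas f"
  and smooth_inv_f: "smooth_map euclidean_atlas A (inv f)"
  using diffeo unfolding diffeomorphism_def by auto

lemma f_inv [simp]: "f (inv f y) = y" "inv f (f x) = x"
  using bij_f by (simp_all add: bij_is_inj bij_is_surj surj_f_inv_f)

lemma cont_f: "continuous_on UNIV f" and cont_inv_f: "continuous_on UNIV (inv f)"
  using smooth_f smooth_inv_f by (auto dest: smooth_map_continuous)

lemma sets_vol: "sets vol = sets borel" and space_vol: "space vol = UNIV"
proof -
  show *: "sets vol = sets borel" using haar unfolding haar_measure_def by (rule conjunct1)
  show "space vol = UNIV" using sets_eq_imp_space_eq[OF *] by simp
qed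

lemma f_measurable: "f \<in> measurable vol borel"
  using borel_measurable_continuous_onI[OF cont_f] by (simp add: measurable_cong_sets[OF sets_vol refl])

lemma inv_f_measurable: "inv f \<in> measurable borel vol"
  using borel_measurable_continuous_onI[OF cont_inv_f] by (simp add: measurable_cong_sets[OF refl sets_vol])

text \<open>The push-forward is left invariant because the preimage under \<open>f\<close> of a
  left-translated set is a left translate by the inverse element; \<open>haar_unique\<close>
  identifies it.\<close>

lemma distr_vol:
  obtains c where "c > 0" "distr vol borel f = density lborel (\<lambda>_. ennreal c)"
proof -
  have em: "emeasure (distr vol borel f) B = emeasure vol (f -` B)" if "B \<in> sets borel" for B
    using emeasure_distr[OF f_measurable that] by (simp add: space_vol)
  show thesis
  proof (rule haar_unique[of "distr vol borel f"])
    fix K :: "'e set" assume K: "compact K"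
    then have Kb: "K \<in> sets borel" using compact_imp_closed borel_closed by blast
    have "f -` K = inv f ` K" by (auto simp: image_iff) (metis f_inv(2))
    then have "compact (f -` K)" using compact_continuous_image[OF continuous_on_subset[OF cont_inv_f] K] by simp
    moreover have "f -` K \<in> sets vol" using measurable_sets[OF f_measurable Kb] by (simp add: space_vol)
    ultimately show "emeasure (distr vol borel f) K < \<infinity>"
      unfolding em[OF Kb] using haar unfolding haar_measure_def by blast
  next
    show "emeasure (distr vol borel f) UNIV \<noteq> 0"
      using em[of UNIV] haar unfolding haar_measure_def by simp
  next
    fix a and B :: "'e set" assume B: "B \<in> sets borel"
    have Bv: "f -` B \<in> sets vol" using measurable_sets[OF f_measurable B] by (simp add: space_vol)
    have mB: "mul a -` B \<in> sets borel"
      using measurable_sets[of "mul a" borel borel B] B by simp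
    have "f -` (mul a -` B) = (\<lambda>x. - inv f a + x) ` (f -` B)"
    proof (intro equalityI subsetI)
      fix x assume "x \<in> f -` (mul a -` B)"
      then have "inv f a + x \<in> f -` B" by (simp add: f_add)
      moreover have "x = - inv f a + (inv f a + x)" by simp
      ultimately show "x \<in> (\<lambda>x. - inv f a + x) ` (f -` B)" by blast
    next
      fix x assume "x \<in> (\<lambda>x. - inv f a + x) ` (f -` B)"
      then obtain y where y: "f y \<in> B" "x = - inv f a + y" by auto
      have "mul a (f x) = f (inv f a + x)" by (simp add: f_add)
      also have "inv f a + x = y" using y(2) by simp
      finally show "x \<in> f -` (mul a -` B)" using y(1) by simp
    qed
    then show "emeasure (distr vol borel f) (mul a -` B) = emeasure (distr vol borel f) B"
      unfolding em[OF mB] em[OF B] using haar Bv unfolding haar_measure_def by simp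
  qed (auto intro: that)
qed

lemma AE_f:
  assumes P: "AE y in lborel. P y" and m: "Measurable.pred borel P"
  shows "AE x in vol. P (f x)"
proof -
  obtain c where c: "c > 0" "distr vol borel f = density lborel (\<lambda>_. ennreal c)" by (rule distr_vol)
  have "AE y in distr vol borel f. P y" unfolding c(2) using P by (subst AE_density) auto
  then show ?thesis using m by (subst (asm) AE_distr_iff[OF f_measurable]) auto
qed

lemma integrable_f:
  assumes g: "integrable lborel (g :: 'e \<Rightarrow> real)"
  shows "integrable vol (\<lambda>x. g (f x))"
proof -
  obtain c where c: "c > 0" "distr vol borel f = density lborel (\<lambda>_. ennreal c)" by (rule distr_vol)
  have gm: "g \<in> borel_measurable borel" using borel_measurable_integrable[OF g] by simp
  have "integrable (density lborel (\<lambda>_. ennreal c)) g"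
    by (subst integrable_density) (use c(1) g gm in auto)
  then have "integrable (distr vol borel f) g" unfolding c(2) .
  then show ?thesis using integrable_distr_eq[OF f_measurable gm] by simp
qed

text \<open>\<open>E\<close> is measurable only for the completion, so a Borel set differing from it
  by a null set is transported instead. The constant \<open>c\<close> is positive and hence does not
  affect the signs of integrals.\<close>

lemma borel_model:
  obtains c :: real and D :: "'e set" where "c > 0" "D \<in> sets borel" "\<exists>N\<in>null_sets vol. sym_diff E (f -` D) \<subseteq> N"
    "\<And>g :: 'e \<Rightarrow> real. g \<in> borel_measurable borel \<Longrightarrow> (LINT x:E|completion vol. g (f x)) = c * (\<integral>y. indicator D y * g y \<partial>lborel)"
proof -
  obtain c where c: "c > 0" "distr vol borel f = density lborel (\<lambda>_. ennreal c)" by (rule distr_vol)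
  obtain S N N' where S: "E = S \<union> N" "N \<subseteq> N'" "N' \<in> null_sets vol" "S \<in> sets vol"
    using sets_completionE[OF E] by blast
  define D where "D = inv f -` S"
  have D[measurable]: "D \<in> sets borel" unfolding D_def using measurable_sets[OF inv_f_measurable S(4)] by simp
  have fD: "f -` D = S" unfolding D_def by auto
  show thesis
  proof (rule that[OF c(1) D])
    show "\<exists>N\<in>null_sets vol. sym_diff E (f -` D) \<subseteq> N" unfolding fD using S by (intro bexI[of _ N']) auto
    fix g :: "'e \<Rightarrow> real" assume g[measurable]: "g \<in> borel_measurable borel"
    have gf: "(\<lambda>x. g (f x)) \<in> borel_measurable vol" using measurable_compose[OF f_measurable g] .
    have gf': "(\<lambda>x. g (f x)) \<in> borel_measurable (completion vol)" using gf by (rule measurable_completion)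
    have SE: "S \<in> sets (completion vol)" using S(4) by simp
    have AEE: "AE x in completion vol. x \<in> E \<longleftrightarrow> x \<in> S"
    proof (rule AE_completion)
      have "AE x in vol. x \<notin> N'" by (rule AE_not_in[OF S(3)])
      then show "AE x in vol. x \<in> E \<longleftrightarrow> x \<in> S" by (rule eventually_mono) (use S in auto)
    qed
    have "(LINT x:E|completion vol. g (f x)) = (\<integral>x. indicator E x *\<^sub>R g (f x) \<partial>completion vol)"
      unfolding set_lebesgue_integral_def ..
    also have "\<dots> = (\<integral>x. indicator S x *\<^sub>R g (f x) \<partial>completion vol)"
    proof (rule integral_cong_AE)
      show "(\<lambda>x. indicator E x *\<^sub>R g (f x)) \<in> borel_measurable (completion vol)"
        by (intro borel_measurable_scaleR borel_measurable_indicator E gf')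
      show "(\<lambda>x. indicator S x *\<^sub>R g (f x)) \<in> borel_measurable (completion vol)"
        by (intro borel_measurable_scaleR borel_measurable_indicator SE gf')
      show "AE x in completion vol. indicator E x *\<^sub>R g (f x) = indicator S x *\<^sub>R g (f x)"
        using AEE by (rule eventually_mono) (auto simp: indicator_def)
    qed
    also have "\<dots> = (\<integral>x. indicator S x *\<^sub>R g (f x) \<partial>vol)"
      by (rule integral_completion) (intro borel_measurable_scaleR borel_measurable_indicator S gf)
    also have "\<dots> = (\<integral>x. (\<lambda>y. indicator D y * g y) (f x) \<partial>vol)"
      by (rule Bochner_Integration.integral_cong) (auto simp: indicator_def D_def)
    also have "\<dots> = (\<integral>y. indicator D y * g y \<partial>distr vol borel f)"
      by (rule integral_distr[OF f_measurable, symmetric]) measurable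
    also have "\<dots> = (\<integral>y. c *\<^sub>R (indicator D y * g y) \<partial>lborel)"
      unfolding c(2) by (rule integral_density) (use c(1) in auto)
    also have "\<dots> = c * (\<integral>y. indicator D y * g y \<partial>lborel)" by simp
    finally show "(LINT x:E|completion vol. g (f x)) = c * (\<integral>y. indicator D y * g y \<partial>lborel)" .
  qed
qed

lemma test_function_f:
  assumes "test_fun \<theta>"
  shows "test_function A (\<lambda>x. \<theta> (f x))"
proof -
  have "smooth_fun A (\<lambda>x. \<theta> (f x))"
    by (rule smooth_map_compose[OF charted_A charted_euclidean charted_euclidean smooth_f])
      (use assms in \<open>simp add: smooth_map_euclidean_iff test_fun_def\<close>)
  moreover have "compact (closure {x. \<theta> (f x) \<noteq> 0})"
  proof -
    let ?K = "closure {y. \<theta> y \<noteq> 0}"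
    have K: "compact (inv f ` ?K)"
      by (rule compact_continuous_image[OF continuous_on_subset[OF cont_inv_f]]) (use assms in \<open>auto simp: test_fun_def\<close>)
    have "{x. \<theta> (f x) \<noteq> 0} \<subseteq> inv f ` ?K"
    proof
      fix x assume "x \<in> {x. \<theta> (f x) \<noteq> 0}"
      then have "f x \<in> ?K" using closure_subset[of "{y. \<theta> y \<noteq> 0}"] by auto
      then show "x \<in> inv f ` ?K" by (rule image_eqI[rotated]) simp
    qed
    then have "closure {x. \<theta> (f x) \<noteq> 0} \<subseteq> inv f ` ?K" using K by (simp add: closure_minimal compact_imp_closed)
    then show ?thesis using compact_Int_closed[OF K closed_closure[of "{x. \<theta> (f x) \<noteq> 0}"]] by (simp add: Int_absorb1)
  qed
  ultimately show ?thesis unfolding test_function_def by blast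
qed

lemma test_fun_inv:
  assumes "test_function A \<psi>"
  shows "test_fun (\<lambda>y. \<psi> (inv f y))"
proof -
  have "smooth_fun euclidean_atlas (\<lambda>y. \<psi> (inv f y))"
    by (rule smooth_map_compose[OF charted_euclidean charted_A charted_euclidean smooth_inv_f])
      (use assms in \<open>simp add: test_function_def\<close>)
  then have "smooth_on UNIV (\<lambda>y. \<psi> (inv f y))"
    using smooth_fun_chart[of euclidean_atlas _ UNIV "\<lambda>x. x"] by (simp add: euclidean_atlas_def inv_into_def)
  moreover have "compact (closure {y. \<psi> (inv f y) \<noteq> 0})"
  proof -
    let ?K = "closure {x. \<psi> x \<noteq> 0}"
    have K: "compact (f ` ?K)"
      by (rule compact_continuous_image[OF continuous_on_subset[OF cont_f]]) (use assms in \<open>auto simp: test_function_def\<close>)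
    have "{y. \<psi> (inv f y) \<noteq> 0} \<subseteq> f ` ?K"
    proof
      fix y assume "y \<in> {y. \<psi> (inv f y) \<noteq> 0}"
      then have "inv f y \<in> ?K" using closure_subset[of "{x. \<psi> x \<noteq> 0}"] by auto
      then show "y \<in> f ` ?K" by (rule image_eqI[rotated]) simp
    qed
    then have "closure {y. \<psi> (inv f y) \<noteq> 0} \<subseteq> f ` ?K" using K by (simp add: closure_minimal compact_imp_closed)
    then show ?thesis using compact_Int_closed[OF K closed_closure[of "{y. \<psi> (inv f y) \<noteq> 0}"]] by (simp add: Int_absorb1)
  qed
  ultimately show ?thesis unfolding test_fun_def by blast
qed

text \<open>In coordinates the derived test function is continuous with compact support.
  Integrability permits splitting the integral of a combination of \<open>X 0\<close> and
  \<open>X 1\<close>, which Bochner integrals require.\<close>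

lemma set_integrable_field:
  assumes "test_function A \<psi>" "j \<le> s"
  shows "set_integrable (completion vol) E (X j \<psi>)"
proof -
  let ?\<theta> = "\<lambda>y. \<psi> (inv f y)"
  have \<theta>: "test_fun ?\<theta>" by (rule test_fun_inv[OF assms(1)])
  let ?g = "\<lambda>y. frechet_derivative ?\<theta> (at y) (shear (y \<bullet> e 0) (e j))"
  have "X j \<psi> a = ?g (f a)" for a using X_f[of ?\<theta> j a] \<theta> assms(2) by (simp add: test_fun_def)
  then have "X j \<psi> = (\<lambda>a. ?g (f a))" by blast
  moreover have i: "integrable vol (\<lambda>a. ?g (f a))" by (rule integrable_f[OF integrable_dir_derivative[OF \<theta>]])
  then have "integrable (completion vol) (\<lambda>a. ?g (f a))"
    using integrable_completion borel_measurable_integrable[OF i] by blast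
  ultimately show ?thesis unfolding set_integrable_def by (simp only:) (rule integrable_mult_indicator[OF E])
qed

lemma lipschitz_from_model:
  assumes D: "D \<in> sets borel" and N: "\<exists>N\<in>null_sets vol. sym_diff E (f -` D) \<subseteq> N"
    and D': "lipschitz_domain D'" "AE x in lborel. x \<in> D \<longleftrightarrow> x \<in> D'"
  shows "\<exists>E'. lipschitz_euclidean_domain A E' \<and> sym_diff E E' \<in> null_sets (completion vol)"
proof (intro exI conjI)
  have "f ` (f -` D') = D'" using bij_f by (simp add: bij_is_surj surj_image_vimage_eq)
  then show "lipschitz_euclidean_domain A (f -` D')"
    unfolding lipschitz_euclidean_domain_def using diffeo D'(1) by (intro exI[of _ f]) simp
  have [measurable]: "D' \<in> sets borel" using D'(1) unfolding lipschitz_domain_def by simp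
  note [measurable] = D
  have "AE x in vol. f x \<in> D \<longleftrightarrow> f x \<in> D'" by (rule AE_f[OF D'(2)]) measurable
  then obtain N2 where N2: "N2 \<in> null_sets vol" "{x \<in> space vol. \<not> (f x \<in> D \<longleftrightarrow> f x \<in> D')} \<subseteq> N2"
    unfolding eventually_ae_filter by blast
  obtain N1 where N1: "N1 \<in> null_sets vol" "sym_diff E (f -` D) \<subseteq> N1" using N by blast
  have "sym_diff E (f -` D') \<subseteq> N1 \<union> N2"
    using N1(2) N2(2) unfolding space_vol by blast
  moreover have "N1 \<union> N2 \<in> null_sets vol" using N1(1) N2(1) by (rule null_sets.Un)
  ultimately show "sym_diff E (f -` D') \<in> null_sets (completion vol)" unfolding null_sets_completion_iff2 by blast
qed

lemma dir_integral_le: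
  assumes i: "indicator_nondecreasing A vol (X j) E" and j: "j \<le> s" and c: "(c::real) > 0"
    and L: "\<And>g :: 'e \<Rightarrow> real. g \<in> borel_measurable borel \<Longrightarrow> (LINT x:E|completion vol. g (f x)) = c * (\<integral>y. indicator D y * g y \<partial>lborel)"
    and \<theta>: "test_fun \<theta>" "\<And>x. 0 \<le> \<theta> x"
  shows "dir_integral D j \<theta> \<le> 0"
proof -
  let ?g = "\<lambda>y. frechet_derivative \<theta> (at y) (shear (y \<bullet> e 0) (e j))"
  have gm: "?g \<in> borel_measurable borel"
    by (rule borel_measurable_continuous_onI[OF continuous_on_dir_derivative]) (use \<theta>(1) in \<open>simp add: test_fun_def\<close>)
  have "X j (\<lambda>x. \<theta> (f x)) = (\<lambda>a. ?g (f a))" using X_f \<theta>(1) j unfolding test_fun_def by blast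
  then have "(LINT x:E|completion vol. X j (\<lambda>x. \<theta> (f x)) x) = c * dir_integral D j \<theta>"
    unfolding dir_integral_def by (simp only:) (rule L[OF gm])
  moreover have "(LINT x:E|completion vol. X j (\<lambda>x. \<theta> (f x)) x) \<le> 0"
    using i test_function_f[OF \<theta>(1)] \<theta>(2) unfolding indicator_nondecreasing_def by simp
  ultimately show ?thesis using c by (simp add: mult_le_0_iff)
qed

lemma dir_integral_eq:
  assumes i: "indicator_invariant A vol (X j) E" and j: "j \<le> s" and c: "(c::real) > 0"
    and L: "\<And>g :: 'e \<Rightarrow> real. g \<in> borel_measurable borel \<Longrightarrow> (LINT x:E|completion vol. g (f x)) = c * (\<integral>y. indicator D y * g y \<partial>lborel)"
    and \<theta>: "test_fun \<theta>" "\<And>x. 0 \<le> \<theta> x"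
  shows "dir_integral D j \<theta> = 0"
proof -
  let ?g = "\<lambda>y. frechet_derivative \<theta> (at y) (shear (y \<bullet> e 0) (e j))"
  have gm: "?g \<in> borel_measurable borel"
    by (rule borel_measurable_continuous_onI[OF continuous_on_dir_derivative]) (use \<theta>(1) in \<open>simp add: test_fun_def\<close>)
  have "X j (\<lambda>x. \<theta> (f x)) = (\<lambda>a. ?g (f a))" using X_f \<theta>(1) j unfolding test_fun_def by blast
  then have "(LINT x:E|completion vol. X j (\<lambda>x. \<theta> (f x)) x) = c * dir_integral D j \<theta>"
    unfolding dir_integral_def by (simp only:) (rule L[OF gm])
  moreover have "(LINT x:E|completion vol. X j (\<lambda>x. \<theta> (f x)) x) = 0"
    using i test_function_f[OF \<theta>(1)] \<theta>(2) unfolding indicator_invariant_def by simp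
  ultimately show ?thesis using c by simp
qed

lemma lipschitz_X1:
  assumes "indicator_invariant A vol (X 0) E" "indicator_nondecreasing A vol (X 1) E"
  shows "\<exists>E'. lipschitz_euclidean_domain A E' \<and> sym_diff E E' \<in> null_sets (completion vol)"
proof -
  obtain c :: real and D where c: "c > 0" and D: "D \<in> sets borel" and N: "\<exists>N\<in>null_sets vol. sym_diff E (f -` D) \<subseteq> N"
    and L: "\<And>g :: 'e \<Rightarrow> real. g \<in> borel_measurable borel \<Longrightarrow> (LINT x:E|completion vol. g (f x)) = c * (\<integral>y. indicator D y * g y \<partial>lborel)"
    using borel_model by blast
  have "r *\<^sub>R e 0 \<in> mono_dirs D" for r
    by (rule mono_dirs_all[OF D]) (use dir_integral_eq[OF assms(1) _ c L] in auto)
  moreover have "r *\<^sub>R e 1 \<in> mono_dirs D" if "0 \<le> r" for r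
    by (rule mono_dirs_nonneg[OF D _ _ that]) (use dir_integral_le[OF assms(2) s_pos c L] in auto)
  ultimately obtain D' where "lipschitz_domain D'" "AE x in lborel. x \<in> D \<longleftrightarrow> x \<in> D'"
    using lipschitz_if_curve_monotone[OF D] by blast
  then show ?thesis by (rule lipschitz_from_model[OF D N])
qed

lemma lipschitz_X0:
  assumes "indicator_invariant A vol (X 1) E" "indicator_nondecreasing A vol (X 0) E"
  shows "\<exists>E'. lipschitz_euclidean_domain A E' \<and> sym_diff E E' \<in> null_sets (completion vol)"
proof -
  obtain c :: real and D where c: "c > 0" and D: "D \<in> sets borel" and N: "\<exists>N\<in>null_sets vol. sym_diff E (f -` D) \<subseteq> N"
    and L: "\<And>g :: 'e \<Rightarrow> real. g \<in> borel_measurable borel \<Longrightarrow> (LINT x:E|completion vol. g (f x)) = c * (\<integral>y. indicator D y * g y \<partial>lborel)"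
    using borel_model by blast
  have "r *\<^sub>R e 1 \<in> mono_dirs D" for r
    by (rule mono_dirs_all[OF D]) (use dir_integral_eq[OF assms(1) s_pos c L] in auto)
  moreover have "r *\<^sub>R e 0 \<in> mono_dirs D" if "0 \<le> r" for r
    by (rule mono_dirs_nonneg[OF D _ _ that]) (use dir_integral_le[OF assms(2) _ c L] in auto)
  ultimately obtain D' where "lipschitz_domain D'" "AE x in lborel. x \<in> D \<longleftrightarrow> x \<in> D'"
    using lipschitz_if_time_monotone[OF D] by blast
  then show ?thesis by (rule lipschitz_from_model[OF D N])
qed

end

section \<open>Change of basis and conclusion\<close>

context lie_grp
begin

lemma smooth_fun_cmult: "smooth_fun A f \<Longrightarrow> smooth_fun A (\<lambda>x. c * f x)"
  using smooth_fun_mult[OF smooth_fun_const] .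

lemma lie_algebraD:
  assumes "X \<in> lie_algebra A"
  shows "smooth_fun A f \<Longrightarrow> smooth_fun A (X f)"
    and "smooth_fun A f \<Longrightarrow> smooth_fun A g \<Longrightarrow> X (\<lambda>x. f x + g x) = (\<lambda>x. X f x + X g x)"
    and "smooth_fun A f \<Longrightarrow> X (\<lambda>x. c * f x) = (\<lambda>x. c * X f x)"
    and "smooth_fun A f \<Longrightarrow> smooth_fun A g \<Longrightarrow> X (\<lambda>x. f x * g x) = (\<lambda>x. X f x * g x + f x * X g x)"
    and "\<not> smooth_fun A f \<Longrightarrow> X f = (\<lambda>x. 0)"
    and "smooth_fun A f \<Longrightarrow> X (\<lambda>x. f (a + x)) = (\<lambda>x. X f (a + x))"
proof -
  note * = assms[unfolded lie_algebra_def vector_field_def mem_Collect_eq]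
  note X = conjunct1[OF *] and X1 = conjunct2[OF conjunct1[OF *]] and X2 = conjunct2[OF conjunct2[OF conjunct1[OF *]]]
  show "smooth_fun A f \<Longrightarrow> smooth_fun A (X f)" using conjunct1[OF X] by blast
  show "smooth_fun A f \<Longrightarrow> smooth_fun A g \<Longrightarrow> X (\<lambda>x. f x + g x) = (\<lambda>x. X f x + X g x)"
    by (rule conjunct1[OF X1, rule_format])
  show "smooth_fun A f \<Longrightarrow> X (\<lambda>x. c * f x) = (\<lambda>x. c * X f x)"
    by (rule conjunct1[OF X2, rule_format])
  show "smooth_fun A f \<Longrightarrow> smooth_fun A g \<Longrightarrow> X (\<lambda>x. f x * g x) = (\<lambda>x. X f x * g x + f x * X g x)"
    by (rule conjunct1[OF conjunct2[OF X2], rule_format])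
  show "\<not> smooth_fun A f \<Longrightarrow> X f = (\<lambda>x. 0)"
    by (rule conjunct2[OF conjunct2[OF X2], rule_format])
  show "smooth_fun A f \<Longrightarrow> X (\<lambda>x. f (a + x)) = (\<lambda>x. X f (a + x))"
    by (rule conjunct2[OF *, rule_format])
qed

lemma lie_algebra_zero:
  assumes "X \<in> lie_algebra A"
  shows "X (\<lambda>x. 0) = (\<lambda>x. 0)"
  using lie_algebraD(3)[OF assms smooth_fun_const, of 0 0] by simp

lemma lie_algebra_comb:
  assumes X: "X \<in> lie_algebra A" and Y: "Y \<in> lie_algebra A"
  shows "vf_add (vf_scale a X) (vf_scale b Y) \<in> lie_algebra A"
proof -
  have s: "smooth_fun A (vf_add (vf_scale a X) (vf_scale b Y) f)" if "smooth_fun A f" for f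
    unfolding vf_add_def vf_scale_def
    by (intro smooth_fun_add smooth_fun_cmult) (use lie_algebraD(1)[OF X that] lie_algebraD(1)[OF Y that] in auto)
  show ?thesis
    unfolding lie_algebra_def vector_field_def mem_Collect_eq
  proof (intro conjI allI impI s)
    fix f g assume f: "smooth_fun A f" and g: "smooth_fun A g"
    show "vf_add (vf_scale a X) (vf_scale b Y) (\<lambda>x. f x + g x) =
       (\<lambda>x. vf_add (vf_scale a X) (vf_scale b Y) f x + vf_add (vf_scale a X) (vf_scale b Y) g x)"
      unfolding vf_add_def vf_scale_def lie_algebraD(2)[OF X f g] lie_algebraD(2)[OF Y f g]
      by (simp add: algebra_simps)
    show "vf_add (vf_scale a X) (vf_scale b Y) (\<lambda>x. f x * g x) =
       (\<lambda>x. vf_add (vf_scale a X) (vf_scale b Y) f x * g x + f x * vf_add (vf_scale a X) (vf_scale b Y) g x)"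
      unfolding vf_add_def vf_scale_def lie_algebraD(4)[OF X f g] lie_algebraD(4)[OF Y f g]
      by (simp add: algebra_simps)
  next
    fix c f assume f: "smooth_fun A f"
    show "vf_add (vf_scale a X) (vf_scale b Y) (\<lambda>x. c * f x) = (\<lambda>x. c * vf_add (vf_scale a X) (vf_scale b Y) f x)"
      unfolding vf_add_def vf_scale_def lie_algebraD(3)[OF X f] lie_algebraD(3)[OF Y f]
      by (simp add: algebra_simps)
  next
    fix f :: "'g \<Rightarrow> real" assume f: "\<not> smooth_fun A f"
    show "vf_add (vf_scale a X) (vf_scale b Y) f = (\<lambda>x. 0)"
      unfolding vf_add_def vf_scale_def lie_algebraD(5)[OF X f] lie_algebraD(5)[OF Y f] by simp
  next
    fix c f assume f: "smooth_fun A f"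
    show "vf_add (vf_scale a X) (vf_scale b Y) (\<lambda>x. f (c + x)) = (\<lambda>x. vf_add (vf_scale a X) (vf_scale b Y) f (c + x))"
      unfolding vf_add_def vf_scale_def lie_algebraD(6)[OF X f] lie_algebraD(6)[OF Y f] by simp
  qed
qed

text \<open>Bilinearity needs additivity of \<open>Z\<close>, which is available on smooth
  functions; on all other functions both sides are 0 by convention.\<close>

lemma bracket_comb:
  assumes X: "X \<in> lie_algebra A" and Y: "Y \<in> lie_algebra A" and Z: "Z \<in> lie_algebra A"
  shows "vf_bracket (vf_add (vf_scale a X) (vf_scale b Y)) (vf_scale c Z) =
    vf_add (vf_scale (a * c) (vf_bracket X Z)) (vf_scale (b * c) (vf_bracket Y Z))"
proof (intro ext)
  fix f x
  show "vf_bracket (vf_add (vf_scale a X) (vf_scale b Y)) (vf_scale c Z) f x =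
    vf_add (vf_scale (a * c) (vf_bracket X Z)) (vf_scale (b * c) (vf_bracket Y Z)) f x"
  proof (cases "smooth_fun A f")
    case True
    note XYZ = lie_algebraD(1)[OF X True] lie_algebraD(1)[OF Y True] lie_algebraD(1)[OF Z True]
    have "Z (\<lambda>x. a * X f x + b * Y f x) = (\<lambda>x. a * Z (X f) x + b * Z (Y f) x)"
      using lie_algebraD(2)[OF Z smooth_fun_cmult[OF XYZ(1)] smooth_fun_cmult[OF XYZ(2)], of a b]
        lie_algebraD(3)[OF Z XYZ(1), of a] lie_algebraD(3)[OF Z XYZ(2), of b] by simp
    then show ?thesis
      unfolding vf_bracket_def vf_add_def vf_scale_def lie_algebraD(3)[OF X XYZ(3)] lie_algebraD(3)[OF Y XYZ(3)]
      by (simp add: algebra_simps)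
  next
    case False
    have n: "X f = (\<lambda>x. 0)" "Y f = (\<lambda>x. 0)" "Z f = (\<lambda>x. 0)" using lie_algebraD(5)[OF _ False] X Y Z by blast+
    show ?thesis
      unfolding vf_bracket_def vf_add_def vf_scale_def n
      by (simp add: lie_algebra_zero[OF X] lie_algebra_zero[OF Y] lie_algebra_zero[OF Z])
  qed
qed

end

text \<open>Each bracket with the new \<open>X 0\<close> contributes one factor \<alpha>, and
  \<gamma> is the factor of the new \<open>X 1\<close>; this forces the coefficient of
  \<open>X j\<close>. The parameter \<beta> enters nowhere else because \<open>X 1\<close> commutes
  with every \<open>X j\<close> of positive index.\<close>

definition basis_change :: "real \<Rightarrow> real \<Rightarrow> real \<Rightarrow> (nat \<Rightarrow> 'g vfield) \<Rightarrow> nat \<Rightarrow> 'g vfield" where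
  "basis_change \<alpha> \<beta> \<gamma> X j =
     (if j = 0 then vf_add (vf_scale \<alpha> (X 0)) (vf_scale \<beta> (X 1)) else vf_scale (\<alpha> ^ (j - 1) * \<gamma>) (X j))"

lemma basis_change_lincomb:
  assumes s: "1 \<le> s"
  shows "vf_lincomb s c (basis_change \<alpha> \<beta> \<gamma> X) =
    vf_lincomb s (\<lambda>j. if j = 0 then c 0 * \<alpha> else c j * (\<alpha> ^ (j - 1) * \<gamma>) + (if j = 1 then c 0 * \<beta> else 0)) X"
proof (intro ext)
  fix f x
  have split: "(\<Sum>j\<le>s. h j) = h 0 + h 1 + (\<Sum>j\<in>{2..s}. h j)" for h :: "nat \<Rightarrow> real"
  proof -
    have "{..s} = insert 0 (insert 1 {2..s})" using s by auto
    then show ?thesis by simp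
  qed
  have "(\<Sum>j\<in>{2..s}. c j * basis_change \<alpha> \<beta> \<gamma> X j f x) =
      (\<Sum>j\<in>{2..s}. (if j = 0 then c 0 * \<alpha> else c j * (\<alpha> ^ (j - 1) * \<gamma>) + (if j = 1 then c 0 * \<beta> else 0)) * X j f x)"
    by (intro sum.cong refl) (auto simp: basis_change_def vf_scale_def)
  then show "vf_lincomb s c (basis_change \<alpha> \<beta> \<gamma> X) f x =
    vf_lincomb s (\<lambda>j. if j = 0 then c 0 * \<alpha> else c j * (\<alpha> ^ (j - 1) * \<gamma>) + (if j = 1 then c 0 * \<beta> else 0)) X f x"
    unfolding vf_lincomb_def split by (simp add: basis_change_def vf_scale_def vf_add_def algebra_simps)
qed

lemma filiform_basis_change:
  fixes A :: "('g::{topological_group_add,t2_space,second_countable_topology}, 'e::euclidean_space) chart set"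
  assumes fil: "filiform_first_kind A s X" and s: "1 \<le> s" and nz: "\<alpha> \<noteq> 0" "\<gamma> \<noteq> 0"
  shows "filiform_first_kind A s (basis_change \<alpha> \<beta> \<gamma> X)"
proof -
  have lie: "lie_group A" and dim: "DIM('e) = s + 1" and conn: "connected (UNIV :: 'g set)"
    and sc: "simply_connected (UNIV :: 'g set)" and basis: "lie_algebra_basis A s X"
    and br: "\<And>j. 2 \<le> j \<Longrightarrow> j \<le> s \<Longrightarrow> vf_bracket (X 0) (X (j - 1)) = X j"
      "vf_bracket (X 0) (X s) = vf_zero"
      "\<And>i j. 1 \<le> i \<Longrightarrow> i \<le> s \<Longrightarrow> 1 \<le> j \<Longrightarrow> j \<le> s \<Longrightarrow> vf_bracket (X i) (X j) = vf_zero"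
    using fil unfolding filiform_first_kind_def by auto
  interpret lie_grp A by unfold_locales (rule lie)
  let ?X = "basis_change \<alpha> \<beta> \<gamma> X"
  have XA: "X j \<in> lie_algebra A" if "j \<le> s" for j using basis that unfolding lie_algebra_basis_def by blast
  have scale: "vf_scale k Z = vf_add (vf_scale k Z) (vf_scale 0 Z)" for k and Z :: "'g vfield"
    by (simp add: vf_scale_def vf_add_def)
  have XA': "?X j \<in> lie_algebra A" if "j \<le> s" for j
  proof (cases "j = 0")
    case True
    then show ?thesis using lie_algebra_comb[OF XA XA, of 0 1] s by (simp add: basis_change_def)
  next
    case False
    then show ?thesis using lie_algebra_comb[OF XA XA, of j j "\<alpha> ^ (j - 1) * \<gamma>" 0] that
      by (simp add: basis_change_def flip: scale)
  qed
  have ind: "\<forall>j\<le>s. c j = 0" if z: "vf_lincomb s c ?X = vf_zero" for c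
  proof -
    have d: "(if j = 0 then c 0 * \<alpha> else c j * (\<alpha> ^ (j - 1) * \<gamma>) + (if j = 1 then c 0 * \<beta> else 0)) = 0" if "j \<le> s" for j
      using basis z that unfolding basis_change_lincomb[OF s] lie_algebra_basis_def by blast
    have c0: "c 0 = 0" using d[of 0] nz by simp
    show ?thesis
    proof (intro allI impI)
      fix j assume "j \<le> s"
      then show "c j = 0" using d[of j] c0 nz by (cases "j = 0") (auto split: if_splits)
    qed
  qed
  have span: "\<exists>c. Z = vf_lincomb s c ?X" if "Z \<in> lie_algebra A" for Z
  proof -
    have "\<forall>Z\<in>lie_algebra A. \<exists>d. Z = vf_lincomb s d X"
      using basis unfolding lie_algebra_basis_def by (elim conjE)
    from bspec[OF this that] obtain d where d: "Z = vf_lincomb s d X" by (rule exE)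
    \<comment> \<open>Solves the triangular system in \<open>basis_change_lincomb\<close>; only the
      coefficient of \<open>X 1\<close> receives a correction from \<beta>.\<close>
    define c where "c = (\<lambda>j. if j = 0 then d 0 / \<alpha> else (d j - (if j = 1 then d 0 / \<alpha> * \<beta> else 0)) / (\<alpha> ^ (j - 1) * \<gamma>))"
    have "(\<lambda>j. if j = 0 then c 0 * \<alpha> else c j * (\<alpha> ^ (j - 1) * \<gamma>) + (if j = 1 then c 0 * \<beta> else 0)) = d"
      using nz by (intro ext) (simp add: c_def)
    then have "Z = vf_lincomb s c ?X" unfolding basis_change_lincomb[OF s] d by (simp only:)
    then show ?thesis by (rule exI[of _ c])
  qed
  have B0: "vf_bracket (?X 0) (?X j) = vf_scale (\<alpha> * (\<alpha> ^ (j - 1) * \<gamma>)) (vf_bracket (X 0) (X j))" if "1 \<le> j" "j \<le> s" for j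
  proof -
    have "vf_bracket (?X 0) (?X j) = vf_add (vf_scale (\<alpha> * (\<alpha> ^ (j - 1) * \<gamma>)) (vf_bracket (X 0) (X j)))
        (vf_scale (\<beta> * (\<alpha> ^ (j - 1) * \<gamma>)) (vf_bracket (X 1) (X j)))"
      using bracket_comb[OF XA XA XA, of 0 1 j] that s by (simp add: basis_change_def)
    then show ?thesis using br(3)[of 1 j] s that by (simp add: vf_add_def vf_scale_def vf_zero_def)
  qed
  have B: "vf_bracket (?X i) (?X j) = vf_zero" if "1 \<le> i" "i \<le> s" "1 \<le> j" "j \<le> s" for i j
  proof -
    have "?X i = vf_add (vf_scale (\<alpha> ^ (i - 1) * \<gamma>) (X i)) (vf_scale 0 (X i))"
      using that by (simp add: basis_change_def flip: scale)
    moreover have "?X j = vf_scale (\<alpha> ^ (j - 1) * \<gamma>) (X j)" using that by (simp add: basis_change_def)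
    ultimately show ?thesis
      by (simp only: bracket_comb[OF XA[OF that(2)] XA[OF that(2)] XA[OF that(4)]] br(3)[OF that])
        (simp add: vf_add_def vf_scale_def vf_zero_def)
  qed
  have "vf_bracket (?X 0) (?X (j - 1)) = ?X j" if "2 \<le> j" "j \<le> s" for j
  proof -
    have "\<alpha> * \<alpha> ^ (j - 2) = \<alpha> ^ (j - 1)" using that by (metis Suc_1 Suc_diff_le diff_Suc_Suc power_Suc numeral_2_eq_2 Suc_diff_Suc less_eq_Suc_le)
    moreover have "?X j = vf_scale (\<alpha> ^ (j - 1) * \<gamma>) (X j)" using that by (simp add: basis_change_def)
    ultimately show ?thesis using B0[of "j - 1"] br(1)[OF that] that
      by (simp add: numeral_2_eq_2 flip: mult.assoc)
  qed
  moreover have "vf_bracket (?X 0) (?X s) = vf_zero"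
    using B0[of s] br(2) s by (simp add: vf_scale_def vf_zero_def)
  ultimately show ?thesis
    unfolding filiform_first_kind_def lie_algebra_basis_def
    using lie dim conn sc XA' ind span B by auto
qed

lemma filiform_measure_exists:
  fixes A :: "('g::{topological_group_add,t2_space,second_countable_topology}, 'e::euclidean_space) chart set"
  assumes fil: "filiform_first_kind A s X" and s: "1 \<le> s" and haar: "haar_measure vol" and E: "E \<in> sets (completion vol)"
  obtains e f where "filiform_measure e s A X f vol E"
proof (rule filiform_coordinates[OF fil s])
  fix e f
  assume m: "filiform_model e s" and d: "diffeomorphism A euclidean_atlas (f :: 'g \<Rightarrow> 'e)"
    and f: "\<And>x y. f (x + y) = filiform_model.mul e s (f x) (f y)"
      "\<And>h j a. smooth_on UNIV h \<Longrightarrow> j \<le> s \<Longrightarrow>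
       X j (\<lambda>x. h (f x)) a = frechet_derivative h (at (f a)) (filiform_model.shear e s (f a \<bullet> e 0) (e j))"
  have "charted A" using fil smooth_atlas_charted unfolding filiform_first_kind_def lie_group_def by blast
  then have "filiform_measure e s A X f vol E"
    using m d f haar E unfolding filiform_measure_def filiform_measure_axioms_def by blast
  then show thesis by (rule that)
qed

theorem theorem5p2:
  fixes A :: "('g::{topological_group_add,t2_space,second_countable_topology},
               'e::euclidean_space) chart set"
    and s :: nat
    and X :: "nat \<Rightarrow> 'g vfield"
    and ip :: "'g vfield \<Rightarrow> 'g vfield \<Rightarrow> real"
    and vol :: "'g measure"
    and E :: "'g set"
  assumes "s \<ge> 2"
    and "filiform_first_kind A s X"
    and "scalar_product_on (horizontal_layer X) ip"
    and "haar_measure vol"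
    and "E \<in> sets (completion vol)"
    and "constant_horizontal_normal A vol (horizontal_layer X) ip E"
  shows "\<exists>E'. lipschitz_euclidean_domain A E' \<and> sym_diff E E' \<in> null_sets (completion vol)"
proof -
  let ?V = "horizontal_layer X" and ?goal = "\<exists>E'. lipschitz_euclidean_domain A E' \<and> sym_diff E E' \<in> null_sets (completion vol)"
  have s: "1 \<le> s" using assms(1) by simp
  define H where "H = (\<lambda>a b. vf_add (vf_scale a (X 0)) (vf_scale b (X 1)))"
  have V: "H a b \<in> ?V" for a b unfolding horizontal_layer_def H_def by blast
  have VE: "\<exists>a b. Z = H a b" if "Z \<in> ?V" for Z using that unfolding horizontal_layer_def H_def by blast
  have H_apply: "H a b \<psi> x = a * X 0 \<psi> x + b * X 1 \<psi> x" for a b \<psi> x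
    by (simp add: H_def vf_add_def vf_scale_def)
  have Hlin: "vf_add (vf_scale c (H a b)) (vf_scale d (H a' b')) = H (c * a + d * a') (c * b + d * b')" for a b a' b' c d
    by (intro ext) (simp add: vf_add_def vf_scale_def H_apply algebra_simps)
  have Hscale: "vf_scale c (H a b) = H (c * a) (c * b)" for a b c
    by (intro ext) (simp add: vf_scale_def H_apply algebra_simps)
  have Hadd: "vf_add (H a b) (H a' b') = H (a + a') (b + b')" for a b a' b'
    by (intro ext) (simp add: vf_add_def H_apply algebra_simps)
  have sym: "ip Y Z = ip Z Y" if "Y \<in> ?V" "Z \<in> ?V" for Y Z
    using assms(3) that unfolding scalar_product_on_def by blast
  have ipa: "ip (vf_add Y Z) W = ip Y W + ip Z W" if "Y \<in> ?V" "Z \<in> ?V" "W \<in> ?V" for Y Z W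
    using assms(3) that unfolding scalar_product_on_def by blast
  have ips: "ip (vf_scale c Y) Z = c * ip Y Z" if "Y \<in> ?V" "Z \<in> ?V" for c Y Z
    using assms(3) that unfolding scalar_product_on_def by blast
  have pos: "ip Y Y > 0" if "Y \<in> ?V" "Y \<noteq> vf_zero" for Y
    using assms(3) that unfolding scalar_product_on_def by blast
  obtain Z where Z: "Z \<in> ?V" "indicator_nondecreasing A vol Z E"
    and orth: "\<And>Y. Y \<in> ?V \<Longrightarrow> ip Z Y = 0 \<Longrightarrow> indicator_invariant A vol Y E"
    using assms(6) unfolding constant_horizontal_normal_def by blast
  obtain a b where ab: "Z = H a b" using VE[OF Z(1)] by blast
  \<comment> \<open>A combination of \<open>X 0\<close> and \<open>X 1\<close> with coefficients
    \<open>c\<close>, \<open>d\<close> is orthogonal to the normal exactly when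
    \<open>c * p + d * q = 0\<close>.\<close>
  define p q where "p = ip (H 1 0) Z" and "q = ip (H 0 1) Z"
  have ipH: "ip (H c d) Z = c * p + d * q" for c d
  proof -
    have "H c d = vf_add (vf_scale c (H 1 0)) (vf_scale d (H 0 1))" by (simp add: Hlin)
    then have "ip (H c d) Z = ip (vf_scale c (H 1 0)) Z + ip (vf_scale d (H 0 1)) Z"
      using ipa[of "vf_scale c (H 1 0)" "vf_scale d (H 0 1)" Z] V Z(1) by (simp add: Hscale)
    then show ?thesis using ips V Z(1) by (simp add: p_def q_def)
  qed
  have inv: "indicator_invariant A vol (H c d) E" if "c * p + d * q = 0" for c d
    using orth[OF V] sym[OF Z(1) V] ipH[of c d] that by simp
  \<comment> \<open>The premise says that the normal has square norm 0. It is then the zero field,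
    and every horizontal field is orthogonal to it; the definition of constant normal admits this
    degenerate case.\<close>
  have Z0: "p = 0 \<and> q = 0" if "a * p + b * q = 0"
  proof -
    have "ip Z Z = 0" using ipH[of a b] that unfolding ab by simp
    then have "Z = vf_zero" using pos[OF Z(1)] by fastforce
    then have "Z = vf_scale 0 (H 1 0)" by (simp add: vf_scale_def vf_zero_def)
    then have "ip Z Y = 0" if "Y \<in> ?V" for Y using ips[OF V that, of 0] by simp
    then show ?thesis unfolding p_def q_def using sym V Z(1) by metis
  qed
  \<comment> \<open>Coordinates for the given basis serve to split integrals of combinations; the
    two cases below choose coordinates for an adapted basis.\<close>
  obtain e0 f0 where fm: "filiform_measure e0 s A X f0 vol E"
    using filiform_measure_exists[OF assms(2) s assms(4,5)] by blast
  interpret filiform_measure e0 s A X f0 vol E by (rule fm)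
  have LH: "(LINT x:E|completion vol. H c d \<psi> x) = c * (LINT x:E|completion vol. X 0 \<psi> x) + d * (LINT x:E|completion vol. X 1 \<psi> x)"
    if "test_function A \<psi>" for c d \<psi>
  proof -
    have "set_integrable (completion vol) E (\<lambda>x. c * X 0 \<psi> x)" "set_integrable (completion vol) E (\<lambda>x. d * X 1 \<psi> x)"
      using set_integrable_field[OF that] s by (auto intro!: set_integrable_mult_right)
    then show ?thesis unfolding H_apply by (simp add: set_integral_add(2))
  qed
  have nd: "a * (LINT x:E|completion vol. X 0 \<psi> x) + b * (LINT x:E|completion vol. X 1 \<psi> x) \<le> 0"
    if "test_function A \<psi>" "\<And>x. 0 \<le> \<psi> x" for \<psi>
    using Z(2) that LH[OF that(1), of a b] unfolding ab indicator_nondecreasing_def by fastforce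
  have iv: "c * (LINT x:E|completion vol. X 0 \<psi> x) + d * (LINT x:E|completion vol. X 1 \<psi> x) = 0"
    if "test_function A \<psi>" "\<And>x. 0 \<le> \<psi> x" "c * p + d * q = 0" for \<psi> c d
    using inv[OF that(3)] that(1,2) LH[OF that(1), of c d] unfolding indicator_invariant_def by fastforce
  have H_basis: "basis_change \<alpha> \<beta> \<gamma> X 0 = H \<alpha> \<beta>" "basis_change \<alpha> \<beta> \<gamma> X 1 = H 0 \<gamma>" for \<alpha> \<beta> \<gamma>
    by (intro ext; simp add: basis_change_def H_def vf_add_def vf_scale_def)+
  show ?goal
  \<comment> \<open>Either \<open>X 1\<close> itself is the invariant direction, or some
    \<open>X 0\<close> plus a multiple of \<open>X 1\<close> is orthogonal to the normal and can
    serve as the new \<open>X 0\<close>.\<close>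
  proof (cases "q = 0 \<and> p \<noteq> 0")
    case True
    have a0: "a \<noteq> 0" using Z0 True by auto
    \<comment> \<open>Orients \<open>X 0\<close> so that the indicator is nondecreasing along
      it.\<close>
    define \<alpha> where "\<alpha> = sgn a"
    have \<alpha>: "\<alpha> \<noteq> 0" unfolding \<alpha>_def using a0 by (simp add: sgn_if)
    obtain e f where fm': "filiform_measure e s A (basis_change \<alpha> 0 1 X) f vol E"
      using filiform_measure_exists[OF filiform_basis_change[OF assms(2) s \<alpha>] s assms(4,5)] by (metis one_neq_zero)
    have "indicator_invariant A vol (basis_change \<alpha> 0 1 X 1) E"
      unfolding H_basis using inv[of 0 1] True by simp
    moreover have "indicator_nondecreasing A vol (basis_change \<alpha> 0 1 X 0) E"
      unfolding indicator_nondecreasing_def H_basis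
    proof (intro allI impI)
      fix \<psi> assume \<psi>: "test_function A \<psi>" "\<forall>x. 0 \<le> \<psi> x"
      have "(LINT x:E|completion vol. X 1 \<psi> x) = 0" using iv[of \<psi> 0 1] \<psi> True by simp
      then have "a * (LINT x:E|completion vol. X 0 \<psi> x) \<le> 0" using nd[of \<psi>] \<psi> by simp
      then show "0 \<le> - (LINT x:E|completion vol. H \<alpha> 0 \<psi> x)"
        unfolding LH[OF \<psi>(1)] \<alpha>_def using a0 by (auto simp: sgn_if mult_le_0_iff split: if_splits)
    qed
    ultimately show ?thesis by (rule filiform_measure.lipschitz_X0[OF fm'])
  next
    case False
    \<comment> \<open>Chosen to make \<open>X 0\<close> plus \<beta> times \<open>X 1\<close>
      orthogonal to the normal. If \<open>q = 0\<close>, then \<open>p = 0\<close> as well in this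
      case, and the default 0 works.\<close>
    define \<beta> where "\<beta> = (if q = 0 then 0 else - p / q)"
    have pq: "p + \<beta> * q = 0" using False unfolding \<beta>_def by auto
    \<comment> \<open>The normal is \<open>a\<close> times the new \<open>X 0\<close> plus
      \<open>k\<close> times \<open>X 1\<close>. As the new \<open>X 0\<close> is an invariant
      direction, monotonicity is carried by the second term, whose sign is stored in
      \<gamma>.\<close>
    define k where "k = b - a * \<beta>"
    define \<gamma> where "\<gamma> = (if k < 0 then - 1 else 1 :: real)"
    have \<gamma>: "\<gamma> \<noteq> 0" unfolding \<gamma>_def by simp
    obtain e f where fm': "filiform_measure e s A (basis_change 1 \<beta> \<gamma> X) f vol E"
      using filiform_measure_exists[OF filiform_basis_change[OF assms(2) s _ \<gamma>] s assms(4,5)] by (metis one_neq_zero)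
    have "indicator_invariant A vol (basis_change 1 \<beta> \<gamma> X 0) E"
      unfolding H_basis using inv[of 1 \<beta>] pq by simp
    moreover have "indicator_nondecreasing A vol (basis_change 1 \<beta> \<gamma> X 1) E"
      unfolding indicator_nondecreasing_def H_basis
    proof (intro allI impI)
      fix \<psi> assume \<psi>: "test_function A \<psi>" "\<forall>x. 0 \<le> \<psi> x"
      let ?I0 = "LINT x:E|completion vol. X 0 \<psi> x" and ?I1 = "LINT x:E|completion vol. X 1 \<psi> x"
      have 1: "?I0 + \<beta> * ?I1 = 0" using iv[of \<psi> 1 \<beta>] \<psi> pq by simp
      have "k * ?I1 = a * ?I0 + b * ?I1 - a * (?I0 + \<beta> * ?I1)" unfolding k_def by (simp add: algebra_simps)
      then have 2: "k * ?I1 \<le> 0" using nd[of \<psi>] \<psi> 1 by simp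
      \<comment> \<open>If \<open>k = 0\<close>, the normal is a multiple of a vector orthogonal to
        it, hence zero, and then \<open>X 1\<close> is an invariant direction too.\<close>
      have 3: "?I1 = 0" if "k = 0"
      proof -
        have "a * p + b * q = a * (p + \<beta> * q)" using that unfolding k_def by (simp add: algebra_simps)
        then have "p = 0 \<and> q = 0" using Z0 pq by simp
        then show ?thesis using iv[of \<psi> 0 1] \<psi> by simp
      qed
      have "\<gamma> * ?I1 \<le> 0"
        using 2 3 unfolding \<gamma>_def by (cases "k = 0") (auto simp: mult_le_0_iff)
      then show "0 \<le> - (LINT x:E|completion vol. H 0 \<gamma> \<psi> x)" unfolding LH[OF \<psi>(1)] by simp
    qed
    ultimately show ?thesis by (rule filiform_measure.lipschitz_X1[OF fm'])
  qed
qed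

end
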